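(* Let $\mathfrak g=\mathfrak g_1\oplus\mathfrak g_2$ be a matched pair of complex Lie algebras with $\dim\mathfrak g_1=n\leq3$ and $\mathfrak g_2=\mathbb CA$ of dimension $1$. Define linear maps $\beta:\mathfrak g_1\to\mathfrak g_1$ and $\chi:\mathfrak g_1\to\mathbb C$ by $[X,A]=\beta(X)+\chi(X)A$ for $X\in\mathfrak g_1$, and suppose that $\chi$ and $\chi\beta$ are linearly independent and that $\beta(\operatorname{Ker}\chi\cap\operatorname{Ker}\chi\beta)\subset\operatorname{Ker}\chi\cap\operatorname{Ker}\chi\beta$. Then $(\mathfrak g_1,\mathfrak g_2)$ can be exponentiated to a matched pair of connected complex Lie groups.
   Context: Matched pair of Lie algebras: Lie subalgebras $\mathfrak g_1,\mathfrak g_2$ of a Lie algebra $\mathfrak{g}$ with $\mathfrak{g}=\mathfrak{g}_1\oplus\mathfrak{g}_2$ as vector spaces. Two are isomorphic if there is an isomorphism of the ambient Lie algebras sending $\mathfrak g_i$ onto $\mathfrak g_i'$ ($i=1,2$). Matched pair of (complex) Lie groups: $G$ is a complex Lie group, $G_1,G_2$ are groups with a homomorphism $i:G_1\to G$ and an anti-homomorphism $j:G_2\to G$, both with closed image and homeomorphisms onto their images, $i(G_1)\cap j(G_2)=\{e\}$, and the complement of $i(G_1)j(G_2)$ in $G$ has measure zero; $G_1,G_2$ are complex Lie groups under identification with closed complex Lie subgroups of $G$. Its matched pair of Lie algebras consists of the complex Lie subalgebras of ${\rm Lie}(G)$ tangent to $i(G_1)$ and $j(G_2)$. A matched pair of Lie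 algebras is exponentiated to a matched pair of Lie groups if the matched pair of Lie algebras of the latter is isomorphic to the given one. *)

theory Defs
  imports "HOL-Analysis.Analysis" "HOL-Algebra.Coset"
begin

section \<open>Complex Lie algebras and matched pairs of them\<close>

locale complex_lie_algebra = vector_space smul
  for smul :: "complex \<Rightarrow> 'g::ab_group_add \<Rightarrow> 'g" +
  fixes bracket :: "'g \<Rightarrow> 'g \<Rightarrow> 'g"
  assumes linear_left: "Vector_Spaces.linear smul smul (\<lambda>x. bracket x y)"
    and linear_right: "Vector_Spaces.linear smul smul (\<lambda>y. bracket x y)"
    and alternating: "bracket x x = 0"
    and jacobi: "bracket x (bracket y z) + bracket y (bracket z x) + bracket z (bracket x y) = 0"

definition lie_subalgebra ::
  "(complex \<Rightarrow> 'g::ab_group_add \<Rightarrow> 'g) \<Rightarrow> ('g \<Rightarrow> 'g \<Rightarrow> 'g) \<Rightarrow> 'g set \<Rightarrow> bool" where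
  "lie_subalgebra smul bracket h \<longleftrightarrow>
     module.subspace smul h \<and> (\<forall>x\<in>h. \<forall>y\<in>h. bracket x y \<in> h)"

definition matched_pair_lie_algebras ::
  "(complex \<Rightarrow> 'g::ab_group_add \<Rightarrow> 'g) \<Rightarrow> ('g \<Rightarrow> 'g \<Rightarrow> 'g) \<Rightarrow> 'g set \<Rightarrow> 'g set \<Rightarrow> bool" where
  "matched_pair_lie_algebras smul bracket g1 g2 \<longleftrightarrow>
     complex_lie_algebra smul bracket \<and>
     lie_subalgebra smul bracket g1 \<and> lie_subalgebra smul bracket g2 \<and>
     g1 \<inter> g2 = {0} \<and> (\<forall>x. \<exists>a\<in>g1. \<exists>b\<in>g2. x = a + b)"

definition matched_pair_lie_algebras_isomorphic ::
  "(complex \<Rightarrow> 'g::ab_group_add \<Rightarrow> 'g) \<Rightarrow> ('g \<Rightarrow> 'g \<Rightarrow> 'g) \<Rightarrow> 'g set \<Rightarrow> 'g set \<Rightarrow>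
   (complex \<Rightarrow> 'h::ab_group_add \<Rightarrow> 'h) \<Rightarrow> ('h \<Rightarrow> 'h \<Rightarrow> 'h) \<Rightarrow> 'h set \<Rightarrow> 'h set \<Rightarrow> bool" where
  "matched_pair_lie_algebras_isomorphic smul bracket g1 g2 smul' bracket' h1 h2 \<longleftrightarrow>
     (\<exists>f. Vector_Spaces.linear smul smul' f \<and> bij f \<and>
          (\<forall>x y. f (bracket x y) = bracket' (f x) (f y)) \<and> f ` g1 = h1 \<and> f ` g2 = h2)"


section \<open>Holomorphic maps\<close>

text \<open>The vector spaces below are finite-dimensional complex vector spaces (with complex scalar
  multiplications \<open>sa\<close>, \<open>sb\<close>); a map is holomorphic on an open set if it has a complex-linear
  Frechet derivative at every point.\<close>

definition holo_on ::
  "(complex \<Rightarrow> 'a::real_normed_vector \<Rightarrow> 'a) \<Rightarrow> (complex \<Rightarrow> 'b::real_normed_vector \<Rightarrow> 'b) \<Rightarrow>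
   ('a \<Rightarrow> 'b) \<Rightarrow> 'a set \<Rightarrow> bool" where
  "holo_on sa sb f S \<longleftrightarrow>
     open S \<and> (\<forall>x\<in>S. \<exists>f'. (f has_derivative f') (at x) \<and> Vector_Spaces.linear sa sb f')"

definition pair_scale :: "complex \<Rightarrow> (complex^'m) \<times> (complex^'n) \<Rightarrow> (complex^'m) \<times> (complex^'n)" where
  "pair_scale c v = (c *s fst v, c *s snd v)"


section \<open>Topological groups, complex manifolds and complex Lie groups\<close>

record 'a topgroup = "'a monoid" +
  topo :: "'a topology"

text \<open>A chart is a pair of its domain and its coordinate map; \<open>charts\<close> is an atlas, not
  necessarily maximal. The index type \<open>'d\<close> only serves to name the model space: the manifold has complex
  dimension \<open>CARD('d)\<close>.\<close>

type_synonym ('a, 'd) chart = "'a set \<times> ('a \<Rightarrow> (complex, 'd) vec)"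

record ('a, 'd) liegroup = "'a topgroup" +
  charts :: "('a, 'd) chart set"

definition topological_group :: "('a, 'b) topgroup_scheme \<Rightarrow> bool" where
  "topological_group G \<longleftrightarrow>
     group G \<and> topspace (topo G) = carrier G \<and>
     continuous_map (prod_topology (topo G) (topo G)) (topo G) (\<lambda>(x, y). x \<otimes>\<^bsub>G\<^esub> y) \<and>
     continuous_map (topo G) (topo G) (\<lambda>x. inv\<^bsub>G\<^esub> x)"

definition second_countable_space :: "'a topology \<Rightarrow> bool" where
  "second_countable_space T \<longleftrightarrow>
     (\<exists>\<B>. countable \<B> \<and> (\<forall>V\<in>\<B>. openin T V) \<and>
          (\<forall>U x. openin T U \<and> x \<in> U \<longrightarrow> (\<exists>V\<in>\<B>. x \<in> V \<and> V \<subseteq> U)))"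

definition is_chart :: "'a topology \<Rightarrow> ('a, 'd::finite) chart \<Rightarrow> bool" where
  "is_chart T c \<longleftrightarrow>
     openin T (fst c) \<and> open (snd c ` fst c) \<and>
     homeomorphic_map (subtopology T (fst c)) (top_of_set (snd c ` fst c)) (snd c)"

abbreviation param :: "('a, 'd) chart \<Rightarrow> (complex, 'd::finite) vec \<Rightarrow> 'a" where
  "param c \<equiv> inv_into (fst c) (snd c)"

definition charts_compatible :: "('a, 'd::finite) chart \<Rightarrow> ('a, 'd) chart \<Rightarrow> bool" where
  "charts_compatible c c' \<longleftrightarrow>
     holo_on (*s) (*s) (\<lambda>x. snd c' (param c x)) (snd c ` (fst c \<inter> fst c')) \<and>
     holo_on (*s) (*s) (\<lambda>x. snd c (param c' x)) (snd c' ` (fst c \<inter> fst c'))"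

definition complex_manifold :: "'a topology \<Rightarrow> ('a, 'd::finite) chart set \<Rightarrow> bool" where
  "complex_manifold T \<A> \<longleftrightarrow>
     Hausdorff_space T \<and> second_countable_space T \<and>
     (\<forall>c\<in>\<A>. is_chart T c) \<and> (\<Union>c\<in>\<A>. fst c) = topspace T \<and>
     (\<forall>c\<in>\<A>. \<forall>c'\<in>\<A>. charts_compatible c c')"

text \<open>The maximal atlas.\<close>

definition holomorphic_chart :: "'a topology \<Rightarrow> ('a, 'd::finite) chart set \<Rightarrow> ('a, 'd) chart \<Rightarrow> bool" where
  "holomorphic_chart T \<A> c \<longleftrightarrow> is_chart T c \<and> (\<forall>c'\<in>\<A>. charts_compatible c c')"

definition complex_lie_group :: "('a, 'd::finite) liegroup \<Rightarrow> bool" where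
  "complex_lie_group G \<longleftrightarrow>
     topological_group G \<and> complex_manifold (topo G) (charts G) \<and>
     (\<forall>a\<in>charts G. \<forall>b\<in>charts G. \<forall>c\<in>charts G.
        holo_on pair_scale (*s) (\<lambda>(x, y). snd c (param a x \<otimes>\<^bsub>G\<^esub> param b y))
          {(x, y). x \<in> snd a ` fst a \<and> y \<in> snd b ` fst b \<and> param a x \<otimes>\<^bsub>G\<^esub> param b y \<in> fst c}) \<and>
     (\<forall>a\<in>charts G. \<forall>c\<in>charts G.
        holo_on (*s) (*s) (\<lambda>x. snd c (inv\<^bsub>G\<^esub> (param a x)))
          {x. x \<in> snd a ` fst a \<and> inv\<^bsub>G\<^esub> (param a x) \<in> fst c})"

text \<open>A closed complex Lie subgroup is a closed subgroup that is a complex submanifold, that is,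
  around each of its points some holomorphic chart of \<open>G\<close> straightens it to a complex subspace.\<close>

definition closed_complex_lie_subgroup :: "'a set \<Rightarrow> ('a, 'd::finite) liegroup \<Rightarrow> bool" where
  "closed_complex_lie_subgroup H G \<longleftrightarrow>
     subgroup H G \<and> closedin (topo G) H \<and>
     (\<forall>h\<in>H. \<exists>c W. holomorphic_chart (topo G) (charts G) c \<and> h \<in> fst c \<and>
        module.subspace (*s) W \<and> snd c ` (fst c \<inter> H) = snd c ` fst c \<inter> W)"

text \<open>The null sets of the smooth measure class of \<open>G\<close>, which is the class of Haar measure.\<close>

definition measure_zero :: "('a, 'd::finite) liegroup \<Rightarrow> 'a set \<Rightarrow> bool" where
  "measure_zero G S \<longleftrightarrow> (\<forall>c\<in>charts G. negligible (snd c ` (fst c \<inter> S)))"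


section \<open>The Lie algebra of a complex Lie group\<close>

text \<open>A chart \<open>c\<close> around the identity identifies the tangent space of \<open>G\<close> at the identity with
  \<open>complex^'d\<close>. The bracket is the one of left-invariant vector fields: \<open>left_field G c v\<close> is the
  coordinate expression of the left-invariant vector field with value \<open>v\<close> at the identity, and in
  coordinates \<open>[V,W] = DW(V) - DV(W)\<close>.\<close>

definition chart_at_one :: "('a, 'd::finite) liegroup \<Rightarrow> ('a, 'd) chart \<Rightarrow> bool" where
  "chart_at_one G c \<longleftrightarrow> c \<in> charts G \<and> \<one>\<^bsub>G\<^esub> \<in> fst c"

definition left_field ::
  "('a, 'd::finite) liegroup \<Rightarrow> ('a, 'd) chart \<Rightarrow> complex^'d \<Rightarrow> complex^'d \<Rightarrow> complex^'d" where
  "left_field G c v x =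
     frechet_derivative (\<lambda>y. snd c (param c x \<otimes>\<^bsub>G\<^esub> param c y)) (at (snd c \<one>\<^bsub>G\<^esub>)) v"

definition lie_bracket ::
  "('a, 'd::finite) liegroup \<Rightarrow> ('a, 'd) chart \<Rightarrow> complex^'d \<Rightarrow> complex^'d \<Rightarrow> complex^'d" where
  "lie_bracket G c v w =
     frechet_derivative (left_field G c w) (at (snd c \<one>\<^bsub>G\<^esub>)) v -
     frechet_derivative (left_field G c v) (at (snd c \<one>\<^bsub>G\<^esub>)) w"

text \<open>The tangent space at the identity of a complex Lie subgroup \<open>H\<close>, in the chart \<open>c\<close>: the
  velocities of holomorphic curves in \<open>H\<close> through the identity.\<close>

definition tangent_at_one ::
  "('a, 'd::finite) liegroup \<Rightarrow> ('a, 'd) chart \<Rightarrow> 'a set \<Rightarrow> (complex^'d) set" where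
  "tangent_at_one G c H =
     {v. \<exists>\<gamma> :: complex \<Rightarrow> 'a. \<exists>r>0.
           \<gamma> 0 = \<one>\<^bsub>G\<^esub> \<and> \<gamma> ` ball 0 r \<subseteq> H \<inter> fst c \<and>
           holo_on (*) (*s) (\<lambda>z. snd c (\<gamma> z)) (ball 0 r) \<and>
           ((\<lambda>z. snd c (\<gamma> z)) has_derivative (\<lambda>z. z *s v)) (at 0)}"


section \<open>Matched pairs of complex Lie groups\<close>

definition antihom :: "('a, 'm) monoid_scheme \<Rightarrow> ('b, 'n) monoid_scheme \<Rightarrow> ('a \<Rightarrow> 'b) set" where
  "antihom G H = {h. h \<in> carrier G \<rightarrow> carrier H \<and>
     (\<forall>x\<in>carrier G. \<forall>y\<in>carrier G. h (x \<otimes>\<^bsub>G\<^esub> y) = h y \<otimes>\<^bsub>H\<^esub> h x)}"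

text \<open>The complex structures of \<open>G1\<close> and \<open>G2\<close> are those of the closed complex Lie subgroups
  \<open>i(G1)\<close> and \<open>j(G2)\<close>, so only the group and the topology are given for \<open>G1\<close> and \<open>G2\<close>.\<close>

definition matched_pair_complex_lie_groups ::
  "('a, 'd::finite) liegroup \<Rightarrow> 'b topgroup \<Rightarrow> 'c topgroup \<Rightarrow> ('b \<Rightarrow> 'a) \<Rightarrow> ('c \<Rightarrow> 'a) \<Rightarrow> bool" where
  "matched_pair_complex_lie_groups G G1 G2 i j \<longleftrightarrow>
     complex_lie_group G \<and> topological_group G1 \<and> topological_group G2 \<and>
     i \<in> hom G1 G \<and> j \<in> antihom G2 G \<and>
     embedding_map (topo G1) (topo G) i \<and> embedding_map (topo G2) (topo G) j \<and>
     closed_complex_lie_subgroup (i ` carrier G1) G \<and>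
     closed_complex_lie_subgroup (j ` carrier G2) G \<and>
     i ` carrier G1 \<inter> j ` carrier G2 = {\<one>\<^bsub>G\<^esub>} \<and>
     measure_zero G (carrier G - (i ` carrier G1 <#>\<^bsub>G\<^esub> j ` carrier G2))"

text \<open>The matched pair of Lie algebras of a matched pair of Lie groups, written in a chart around
  the identity, is isomorphic to the given one. A change of chart changes the former by an
  isomorphism only.\<close>

definition exponentiated_to ::
  "(complex \<Rightarrow> 'g::ab_group_add \<Rightarrow> 'g) \<Rightarrow> ('g \<Rightarrow> 'g \<Rightarrow> 'g) \<Rightarrow> 'g set \<Rightarrow> 'g set \<Rightarrow>
   ('a, 'd::finite) liegroup \<Rightarrow> 'b topgroup \<Rightarrow> 'c topgroup \<Rightarrow> ('b \<Rightarrow> 'a) \<Rightarrow> ('c \<Rightarrow> 'a) \<Rightarrow> bool" where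
  "exponentiated_to smul bracket g1 g2 G G1 G2 i j \<longleftrightarrow>
     matched_pair_complex_lie_groups G G1 G2 i j \<and>
     (\<exists>c. chart_at_one G c \<and>
        matched_pair_lie_algebras_isomorphic smul bracket g1 g2 (*s) (lie_bracket G c)
          (tangent_at_one G c (i ` carrier G1)) (tangent_at_one G c (j ` carrier G2)))"

end

theory Submission
  imports Defs
begin

text \<open>Jacobi's identity for \<open>X, Y, A\<close> and the invariance of \<open>K = Ker chi \<inter> Ker (chi beta)\<close> force
  \<open>K\<close> to be central of dimension at most one and \<open>g\<close> to be \<open>sl2 \<oplus> K\<close>, with \<open>g1\<close> the sum of \<open>K\<close> and the
  lower triangular Borel subalgebra, and \<open>A = (0, 1; r, 0) + \<mu> Z\<close> with \<open>Z\<close> spanning \<open>K\<close>. Since a nonzero \<open>Z\<close> can be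
  rescaled, only whether \<open>\<mu> = 0\<close> matters. The Lie group is \<open>PGL2\<close> or \<open>PGL2 \<times> C*\<close>; \<open>SL2\<close> would not do,
  because for \<open>r \<noteq> 0\<close> the one-parameter group of \<open>A\<close> meets the Borel subgroup in the centre.
  The second subgroup is the graph of a character on the group of matrices \<open>(u, v; r v, u)\<close>
  modulo scalars, and the big cell is \<open>a\<^sup>2 \<noteq> r b\<^sup>2\<close>, where \<open>(a, b)\<close> is the first row.\<close>

section \<open>Holomorphic functions\<close>

text \<open>The component of \<open>A\<close> along \<open>Z\<close> is what dictates the factor C*.
  In PGL2 x C the one-parameter group of \<open>A\<close> would, for nonzero r and \<mu>, return to
  the identity of PGL2 with a nonzero central component, hence meet the first subgroup, which
  contains the whole centre. Over C* a rescaling of \<open>Z\<close> turns the central component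
  into a character of the torus, namely the ratio of the eigenvalues u + \<rho> v and u - \<rho> v,
  where \<rho> is a square root of r; a graph meets the Borel subgroup times C* only where v = 0,
  that is, in the identity. For r = 0 the group is unipotent and exp (v / u) does the same. The
  group has to be a set of functions \<open>nat \<Rightarrow> complex\<close>. Encoding classes by
  invariants makes it a subspace of a product of lines, hence Hausdorff and second countable, but
  its operations pass through representatives picked by Hilbert choice, which need not vary
  continuously. So continuity is tested on local sections and holomorphy on holomorphic lifts to
  matrices. The atlas has four charts, each scaling one entry to 1; the charts straightening the
  second subgroup lie outside it and are only compatible with it.\<close>

definition hol :: "(complex \<Rightarrow> 'a::real_normed_vector \<Rightarrow> 'a) \<Rightarrow> ('a \<Rightarrow> complex) \<Rightarrow> 'a \<Rightarrow> bool" where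
  "hol sa f x \<longleftrightarrow> (\<exists>f'. (f has_derivative f') (at x) \<and> (\<forall>c v. f' (sa c v) = c * f' v))"

named_theorems hol_intros

lemma hol_const [hol_intros]: "hol sa (\<lambda>x. k) x"
  unfolding hol_def by (rule exI[of _ "\<lambda>_. 0"]) simp

lemma hol_add [hol_intros]: "hol sa f x \<Longrightarrow> hol sa g x \<Longrightarrow> hol sa (\<lambda>x. f x + g x) x"
  unfolding hol_def
proof (elim exE conjE)
  fix f' g' assume a: "(f has_derivative f') (at x)" "\<forall>c v. f' (sa c v) = c * f' v"
    "(g has_derivative g') (at x)" "\<forall>c v. g' (sa c v) = c * g' v"
  show "\<exists>f'. ((\<lambda>x. f x + g x) has_derivative f') (at x) \<and> (\<forall>c v. f' (sa c v) = c * f' v)"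
    by (rule exI, rule conjI, rule has_derivative_add[OF a(1,3)]) (simp add: a(2,4) algebra_simps)
qed

lemma hol_diff [hol_intros]: "hol sa f x \<Longrightarrow> hol sa g x \<Longrightarrow> hol sa (\<lambda>x. f x - g x) x"
  unfolding hol_def
proof (elim exE conjE)
  fix f' g' assume a: "(f has_derivative f') (at x)" "\<forall>c v. f' (sa c v) = c * f' v"
    "(g has_derivative g') (at x)" "\<forall>c v. g' (sa c v) = c * g' v"
  show "\<exists>f'. ((\<lambda>x. f x - g x) has_derivative f') (at x) \<and> (\<forall>c v. f' (sa c v) = c * f' v)"
    by (rule exI, rule conjI, rule has_derivative_diff[OF a(1,3)]) (simp add: a(2,4) algebra_simps)
qed

lemma hol_minus [hol_intros]: "hol sa f x \<Longrightarrow> hol sa (\<lambda>x. - f x) x"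
  using hol_diff[OF hol_const[of sa 0]] by simp

lemma hol_mult [hol_intros]: "hol sa f x \<Longrightarrow> hol sa g x \<Longrightarrow> hol sa (\<lambda>x. f x * g x) x"
  unfolding hol_def
proof (elim exE conjE)
  fix f' g' assume a: "(f has_derivative f') (at x)" "\<forall>c v. f' (sa c v) = c * f' v"
    "(g has_derivative g') (at x)" "\<forall>c v. g' (sa c v) = c * g' v"
  show "\<exists>f'. ((\<lambda>x. f x * g x) has_derivative f') (at x) \<and> (\<forall>c v. f' (sa c v) = c * f' v)"
    by (rule exI, rule conjI, rule has_derivative_mult[OF a(1,3)]) (simp add: a(2,4) algebra_simps)
qed

lemma hol_compose_field:
  assumes "hol sa f x" and "(g has_field_derivative D) (at (f x))"
  shows "hol sa (\<lambda>x. g (f x)) x"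
proof -
  obtain f' where f': "(f has_derivative f') (at x)" "\<forall>c v. f' (sa c v) = c * f' v"
    using assms(1) unfolding hol_def by blast
  have "((\<lambda>x. g (f x)) has_derivative (\<lambda>v. D * f' v)) (at x)"
    using has_derivative_compose[OF f'(1) assms(2)[unfolded has_field_derivative_def]] by simp
  then show ?thesis unfolding hol_def using f'(2) by (intro exI[of _ "\<lambda>v. D * f' v"]) auto
qed

lemma hol_exp [hol_intros]: "hol sa f x \<Longrightarrow> hol sa (\<lambda>x. exp (f x)) x"
  by (erule hol_compose_field) (rule DERIV_exp)

lemma hol_divide [hol_intros]:
  assumes "hol sa f x" "hol sa g x" "g x \<noteq> 0" shows "hol sa (\<lambda>x. f x / g x) x"
proof -
  have "hol sa (\<lambda>x. inverse (g x)) x"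
    by (rule hol_compose_field[OF assms(2)]) (rule DERIV_inverse[OF assms(3)])
  then show ?thesis using hol_mult[OF assms(1)] by (simp add: divide_inverse)
qed

lemma hol_power [hol_intros]: "hol sa f x \<Longrightarrow> hol sa (\<lambda>x. f x ^ n) x"
  by (induction n) (simp_all add: hol_intros)

lemma hol_compose:
  assumes "hol sb F (f x)" and "(f has_derivative f') (at x)" and "\<And>c v. f' (sa c v) = sb c (f' v)"
  shows "hol sa (\<lambda>x. F (f x)) x"
proof -
  obtain F' where F': "(F has_derivative F') (at (f x))" "\<forall>c v. F' (sb c v) = c * F' v"
    using assms(1) unfolding hol_def by blast
  show ?thesis unfolding hol_def using has_derivative_compose[OF assms(2) F'(1)] F'(2) assms(3)
    by (intro exI conjI) auto
qed

lemma hol_imp_isCont: "hol sa f x \<Longrightarrow> isCont f x"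
  unfolding hol_def using has_derivative_continuous by (auto simp: continuous_within)

lemma hol_cong_open:
  assumes "hol sa f x" "open S" "x \<in> S" "\<And>y. y \<in> S \<Longrightarrow> f y = g y"
  shows "hol sa g x"
  using assms unfolding hol_def by (metis has_derivative_transform_within_open)

lemma has_derivative_vec_nth [derivative_intros]:
  "(f has_derivative f') F \<Longrightarrow> ((\<lambda>x. f x $ i) has_derivative (\<lambda>v. f' v $ i)) F"
  by (rule bounded_linear.has_derivative[OF bounded_linear_vec_nth])

text \<open>A real basis vector has the form \<open>axis i u\<close>, so the inner product with it
  reads off coordinate \<open>i\<close> alone, and the criterion over the real basis becomes one
  over complex coordinates.\<close>

lemma has_derivative_vecI:
  fixes f :: "'a::real_normed_vector \<Rightarrow> complex ^ 'd::finite"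
  assumes "\<And>i. ((\<lambda>x. f x $ i) has_derivative (\<lambda>v. f' v $ i)) (at x)"
  shows "(f has_derivative f') (at x)"
  unfolding has_derivative_componentwise_within[of f f' x UNIV]
proof
  fix b :: "complex ^ 'd" assume "b \<in> Basis"
  then obtain i u where b: "b = axis i u" by (auto simp: Basis_vec_def)
  show "((\<lambda>x. f x \<bullet> b) has_derivative (\<lambda>x. f' x \<bullet> b)) (at x)"
    unfolding b inner_axis by (rule has_derivative_inner_left[OF assms])
qed

lemma hol_vec_nth [hol_intros]: "hol (*s) (\<lambda>x. x $ i) x"
  unfolding hol_def by (rule exI[of _ "\<lambda>v. v $ i"]) (auto intro!: derivative_eq_intros has_derivative_vec_nth)

lemma hol_id [hol_intros]: "hol (*) (\<lambda>x. x) x"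
  unfolding hol_def by (rule exI[of _ "\<lambda>v. v"]) auto

lemma hol_fst: "hol (*s) f (fst p) \<Longrightarrow> hol pair_scale (\<lambda>p. f (fst p)) p"
  by (rule hol_compose[where f=fst and f'=fst]) (auto simp: pair_scale_def intro!: derivative_eq_intros)

lemma hol_snd: "hol (*s) f (snd p) \<Longrightarrow> hol pair_scale (\<lambda>p. f (snd p)) p"
  by (rule hol_compose[where f=snd and f'=snd]) (auto simp: pair_scale_def intro!: derivative_eq_intros)

lemma vector_space_pair_scale: "vector_space pair_scale"
  by unfold_locales (auto simp: pair_scale_def vec.scale_right_distrib vec.scale_left_distrib)

lemma vector_space_complex_mult: "vector_space ((*) :: complex \<Rightarrow> _)"
  by unfold_locales (auto simp: algebra_simps)

text \<open>\<open>hol\<close> asks only for homogeneity, since additivity is part of being a real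
  derivative. Here the two are joined into complex linearity, coordinate by coordinate.\<close>

lemma holo_onI:
  fixes f :: "'a::real_normed_vector \<Rightarrow> complex ^ 'd::finite"
  assumes "vector_space sa" and "open S" and "\<And>x i. x \<in> S \<Longrightarrow> hol sa (\<lambda>x. f x $ i) x"
  shows "holo_on sa (*s) f S"
  unfolding holo_on_def
proof (intro conjI ballI)
  fix x assume "x \<in> S"
  then have "\<forall>i. \<exists>f'. ((\<lambda>x. f x $ i) has_derivative f') (at x) \<and> (\<forall>c v. f' (sa c v) = c * f' v)"
    using assms(3) unfolding hol_def by blast
  then obtain f' where f': "\<And>i. ((\<lambda>x. f x $ i) has_derivative f' i) (at x)"
    "\<And>i c v. f' i (sa c v) = c * f' i v" by metis
  let ?f' = "\<lambda>v. \<chi> i. f' i v"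
  have d: "(f has_derivative ?f') (at x)" by (rule has_derivative_vecI) (simp add: f')
  interpret V: vector_space sa by fact
  interpret W: vector_space "(*s) :: complex \<Rightarrow> complex ^ 'd \<Rightarrow> _" by unfold_locales
  have add: "f' i (v + w) = f' i v + f' i w" for i v w
    using linear_add[OF has_derivative_linear[OF f'(1)[of i]]] by simp
  have "Vector_Spaces.linear sa (*s) ?f'"
    by unfold_locales (simp_all add: vec_eq_iff add f')
  with d show "\<exists>f'. (f has_derivative f') (at x) \<and> Vector_Spaces.linear sa (*s) f'" by blast
qed (fact assms(2))

section \<open>The group PGL2 times C*\<close>

type_synonym rep = "complex \<times> complex \<times> complex \<times> complex \<times> complex"

fun entry :: "rep \<Rightarrow> nat \<Rightarrow> complex" where
  "entry (a, b, c, d, z) k = (if k = 0 then a else if k = 1 then b else if k = 2 then c else d)"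

fun rdet :: "rep \<Rightarrow> complex" where "rdet (a, b, c, d, z) = a * d - b * c"

fun rsnd :: "rep \<Rightarrow> complex" where "rsnd (a, b, c, d, z) = z"

fun rscale :: "complex \<Rightarrow> rep \<Rightarrow> rep" where
  "rscale l (a, b, c, d, z) = (l * a, l * b, l * c, l * d, z)"

fun rmul :: "rep \<Rightarrow> rep \<Rightarrow> rep" where
  "rmul (a, b, c, d, z) (a', b', c', d', z') =
     (a * a' + b * c', a * b' + b * d', c * a' + d * c', c * b' + d * d', z * z')"

text \<open>The adjugate in the matrix part: it inverts a matrix only up to the factor
  \<open>rdet m\<close>, which disappears in the class.\<close>

fun rinv :: "rep \<Rightarrow> rep" where "rinv (a, b, c, d, z) = (d, - b, - c, a, 1 / z)"

definition rone :: rep where "rone = (1, 0, 0, 1, 1)"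

definition Rep :: "bool \<Rightarrow> rep set" where
  "Rep full = {m. rdet m \<noteq> 0 \<and> rsnd m \<noteq> 0 \<and> (full \<or> rsnd m = 1)}"

text \<open>A class modulo scalars is encoded by its scale-invariant products \<open>m\<^sub>i m\<^sub>j / det m\<close>, which embed
  the quotient in a product of complex lines; position 16 holds the component in \<open>C*\<close>, which is frozen to 1
  unless \<open>full\<close>.\<close>

definition cls :: "rep \<Rightarrow> nat \<Rightarrow> complex" where
  "cls m k = (if k < 16 then entry m (k div 4) * entry m (k mod 4) / rdet m
              else if k = 16 then rsnd m else 0)"

lemma cls_prod: "i < 4 \<Longrightarrow> j < 4 \<Longrightarrow> cls m (4 * i + j) = entry m i * entry m j / rdet m"
  by (simp add: cls_def)

lemma cls_16 [simp]: "cls m 16 = rsnd m"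
  by (simp add: cls_def)

lemma rdet_rscale [simp]: "rdet (rscale l m) = l\<^sup>2 * rdet m"
  by (cases m) (simp add: power2_eq_square algebra_simps)

lemma rsnd_rscale [simp]: "rsnd (rscale l m) = rsnd m"
  by (cases m) simp

lemma entry_rscale [simp]: "entry (rscale l m) k = l * entry m k"
  by (cases m) simp

lemma rmul_rscale: "rmul (rscale k m) (rscale l n) = rscale (k * l) (rmul m n)"
  by (cases m; cases n) (simp add: algebra_simps)

lemma rdet_rmul [simp]: "rdet (rmul m n) = rdet m * rdet n"
  by (cases m; cases n) (simp add: algebra_simps)

lemma rsnd_rmul [simp]: "rsnd (rmul m n) = rsnd m * rsnd n"
  by (cases m; cases n) simp

lemma rdet_rinv [simp]: "rdet (rinv m) = rdet m"
  by (cases m) (simp add: algebra_simps)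

lemma rsnd_rinv [simp]: "rsnd (rinv m) = 1 / rsnd m"
  by (cases m) simp

lemma Rep_rscale [simp]: "l \<noteq> 0 \<Longrightarrow> rscale l m \<in> Rep full \<longleftrightarrow> m \<in> Rep full"
  by (simp add: Rep_def)

lemma Rep_rmul [intro]: "m \<in> Rep full \<Longrightarrow> n \<in> Rep full \<Longrightarrow> rmul m n \<in> Rep full"
  by (auto simp: Rep_def)

lemma Rep_rinv [intro]: "m \<in> Rep full \<Longrightarrow> rinv m \<in> Rep full"
  by (auto simp: Rep_def)

lemma Rep_rone [simp, intro]: "rone \<in> Rep full"
  by (simp add: Rep_def rone_def)

lemma cls_rscale [simp]: "l \<noteq> 0 \<Longrightarrow> cls (rscale l m) = cls m"
  by (rule ext) (simp add: cls_def power2_eq_square)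

lemma rep_eqI:
  assumes "\<And>i. i < 4 \<Longrightarrow> entry m i = entry n i" "rsnd m = rsnd n"
  shows "m = n"
  using assms(1)[of 0] assms(1)[of 1] assms(1)[of 2] assms(1)[of 3] assms(2)
  by (cases m; cases n) simp

lemma entry_nonzero: "rdet m \<noteq> 0 \<Longrightarrow> \<exists>i<4. entry m i \<noteq> 0"
proof (rule ccontr)
  assume "rdet m \<noteq> 0" and *: "\<not> (\<exists>i<4. entry m i \<noteq> 0)"
  moreover from * have "entry m 0 = 0" "entry m 1 = 0" "entry m 2 = 0" "entry m 3 = 0" by auto
  ultimately show False by (cases m) simp
qed

text \<open>The products determine all ratios of entries: an entry that is nonzero in
  \<open>m\<close> is nonzero in \<open>n\<close> by the diagonal product, and the quotient of these
  two entries is the scalar.\<close>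

lemma cls_eqD:
  assumes m: "m \<in> Rep full" and n: "n \<in> Rep full" and eq: "cls m = cls n"
  shows "\<exists>l. l \<noteq> 0 \<and> n = rscale l m"
proof -
  have D: "rdet m \<noteq> 0" "rdet n \<noteq> 0" using m n by (auto simp: Rep_def)
  have e: "entry m i * entry m j / rdet m = entry n i * entry n j / rdet n" if "i < 4" "j < 4" for i j
    using fun_cong[OF eq, of "4 * i + j"] cls_prod[OF that] by simp
  obtain i where i: "i < 4" "entry m i \<noteq> 0" using entry_nonzero D by blast
  then have ni: "entry n i \<noteq> 0" using e[of i i] D by auto
  define l where "l = entry n i / entry m i"
  have l: "l \<noteq> 0" using i ni by (simp add: l_def)
  have "entry n j = l * entry m j" if j: "j < 4" for j
  proof -
    have "entry m i * entry m i * rdet n = entry n i * entry n i * rdet m"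
      "entry m i * entry m j * rdet n = entry n i * entry n j * rdet m"
      using e[OF i(1) i(1)] e[OF i(1) j] D by (simp_all add: field_simps)
    \<comment> \<open>Crosswise multiplication of the diagonal and the mixed relation makes both
      determinants cancel.\<close>
    then have "(entry m i * entry m i * rdet n) * (entry n i * entry n j * rdet m)
             = (entry n i * entry n i * rdet m) * (entry m i * entry m j * rdet n)" by simp
    then have "entry m i * entry n j = entry n i * entry m j"
      using D i ni by (simp add: field_simps)
    then show ?thesis using i by (simp add: l_def field_simps)
  qed
  moreover have "rsnd m = rsnd n" using fun_cong[OF eq, of 16] by simp
  ultimately have "n = rscale l m" by (intro rep_eqI) auto
  with l show ?thesis by blast
qed

definition rep_of :: "bool \<Rightarrow> (nat \<Rightarrow> complex) \<Rightarrow> rep" where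
  "rep_of full T = (SOME m. m \<in> Rep full \<and> cls m = T)"

lemma rep_of_cls:
  assumes "m \<in> Rep full"
  obtains l where "l \<noteq> 0" "rep_of full (cls m) = rscale l m"
proof -
  have "rep_of full (cls m) \<in> Rep full \<and> cls (rep_of full (cls m)) = cls m"
    unfolding rep_of_def by (rule someI[of _ m]) (simp add: assms)
  then show thesis using cls_eqD[OF assms] that by metis
qed

definition pgl :: "bool \<Rightarrow> (nat \<Rightarrow> complex, 'd) chart set \<Rightarrow> (nat \<Rightarrow> complex, 'd) liegroup" where
  "pgl full C = \<lparr>carrier = cls ` Rep full,
     mult = (\<lambda>S T. cls (rmul (rep_of full S) (rep_of full T))), one = cls rone,
     topo = top_of_set (cls ` Rep full), charts = C\<rparr>"

lemma carrier_pgl [simp]: "carrier (pgl full C) = cls ` Rep full"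
  and one_pgl [simp]: "\<one>\<^bsub>pgl full C\<^esub> = cls rone"
  and topo_pgl [simp]: "topo (pgl full C) = top_of_set (cls ` Rep full)"
  and charts_pgl [simp]: "charts (pgl full C) = C"
  by (simp_all add: pgl_def)

text \<open>The chosen representatives differ from \<open>m\<close> and \<open>n\<close> by nonzero
  scalars, which \<open>rmul\<close> multiplies together and \<open>cls\<close> forgets.\<close>

lemma mult_pgl [simp]:
  assumes "m \<in> Rep full" "n \<in> Rep full"
  shows "cls m \<otimes>\<^bsub>pgl full C\<^esub> cls n = cls (rmul m n)"
proof -
  obtain k l where "k \<noteq> 0" "l \<noteq> 0" "rep_of full (cls m) = rscale k m" "rep_of full (cls n) = rscale l n"
    using rep_of_cls[OF assms(1)] rep_of_cls[OF assms(2)] by metis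
  then show ?thesis by (simp add: pgl_def rmul_rscale)
qed

lemma rmul_assoc: "rmul (rmul k m) n = rmul k (rmul m n)"
  by (cases k; cases m; cases n) (simp add: algebra_simps)

lemma rmul_rone [simp]: "rmul rone m = m"
  by (cases m) (simp add: rone_def)

lemma rmul_rinv: "rsnd m \<noteq> 0 \<Longrightarrow> rmul (rinv m) m = rscale (rdet m) rone"
  by (cases m) (simp add: rone_def algebra_simps)

lemma cls_rinv_mult: "m \<in> Rep full \<Longrightarrow> cls (rmul (rinv m) m) = cls rone"
  by (subst rmul_rinv) (auto simp: Rep_def)

lemma group_pgl: "group (pgl full C)"
proof (rule groupI)
  fix x y z
  assume "x \<in> carrier (pgl full C)" "y \<in> carrier (pgl full C)" "z \<in> carrier (pgl full C)"
  then obtain k m n where "x = cls k" "y = cls m" "z = cls n" "k \<in> Rep full" "m \<in> Rep full" "n \<in> Rep full"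
    unfolding carrier_pgl by blast
  then show "x \<otimes>\<^bsub>pgl full C\<^esub> y \<otimes>\<^bsub>pgl full C\<^esub> z = x \<otimes>\<^bsub>pgl full C\<^esub> (y \<otimes>\<^bsub>pgl full C\<^esub> z)"
    and "x \<otimes>\<^bsub>pgl full C\<^esub> y \<in> carrier (pgl full C)"
    by (simp_all add: Rep_rmul rmul_assoc)
next
  fix x assume "x \<in> carrier (pgl full C)"
  then obtain m where m: "x = cls m" "m \<in> Rep full" unfolding carrier_pgl by blast
  then have "cls (rinv m) \<otimes>\<^bsub>pgl full C\<^esub> x = \<one>\<^bsub>pgl full C\<^esub>"
    by (simp add: cls_rinv_mult Rep_rinv)
  with m show "\<exists>y\<in>carrier (pgl full C). y \<otimes>\<^bsub>pgl full C\<^esub> x = \<one>\<^bsub>pgl full C\<^esub>"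
    unfolding carrier_pgl by (blast intro: Rep_rinv)
  from m show "\<one>\<^bsub>pgl full C\<^esub> \<otimes>\<^bsub>pgl full C\<^esub> x = x" by simp
qed simp

lemma inv_pgl [simp]:
  assumes "m \<in> Rep full" shows "inv\<^bsub>pgl full C\<^esub> cls m = cls (rinv m)"
  by (rule group.inv_equality[OF group_pgl]) (use assms in \<open>simp_all add: cls_rinv_mult Rep_rinv\<close>)

section \<open>Local sections of the projection and the quotient topology\<close>

definition sec :: "nat \<Rightarrow> (nat \<Rightarrow> complex) \<Rightarrow> rep" where
  "sec i T = (T (4 * i) / T (5 * i), T (4 * i + 1) / T (5 * i), T (4 * i + 2) / T (5 * i),
              T (4 * i + 3) / T (5 * i), T 16)"

lemma cls_diag: "i < 4 \<Longrightarrow> cls m (5 * i) = entry m i ^ 2 / rdet m"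
  using cls_prod[of i i m] by (simp add: power2_eq_square)

text \<open>Row \<open>i\<close> of the table of products is proportional to the entries of
  \<open>m\<close>; dividing it by its diagonal place \<open>4 * i + i = 5 * i\<close> removes the
  unknown scalar by making entry \<open>i\<close> equal to 1.\<close>

lemma sec_cls:
  assumes "m \<in> Rep full" "i < 4" "entry m i \<noteq> 0"
  shows "sec i (cls m) = rscale (1 / entry m i) m"
proof (rule rep_eqI)
  have D: "rdet m \<noteq> 0" using assms by (simp add: Rep_def)
  have q: "cls m (4 * i + j) / cls m (5 * i) = 1 / entry m i * entry m j" if "j < 4" for j
    unfolding cls_prod[OF assms(2) that] cls_diag[OF assms(2)]
    using D assms(3) by (simp add: field_simps power2_eq_square)
  show "entry (sec i (cls m)) j = entry (rscale (1 / entry m i) m) j" if "j < 4" for j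
  proof -
    have "j = 0 \<or> j = 1 \<or> j = 2 \<or> j = 3" using that by auto
    then show ?thesis using q[of 0] q[of 1] q[of 2] q[of 3] unfolding sec_def by auto
  qed
qed (simp add: sec_def)

lemma sec_cls_Rep:
  assumes "m \<in> Rep full" "i < 4" "cls m (5 * i) \<noteq> 0"
  shows "sec i (cls m) \<in> Rep full" "cls (sec i (cls m)) = cls m"
proof -
  have "entry m i \<noteq> 0" using assms by (auto simp: cls_diag)
  then show "sec i (cls m) \<in> Rep full" "cls (sec i (cls m)) = cls m"
    using sec_cls[OF assms(1,2)] assms(1) by auto
qed

lemma continuous_on_sec: "continuous_on {T. T (5 * i) \<noteq> 0} (sec i)"
  unfolding sec_def by (auto intro!: continuous_intros continuous_on_subset[OF continuous_on_product_coordinates])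

text \<open>The projection \<open>cls\<close> has continuous local sections, so continuity can be tested on
  representatives.\<close>

lemma continuous_on_cls2:
  fixes \<Phi> :: "(nat \<Rightarrow> complex) \<times> (nat \<Rightarrow> complex) \<Rightarrow> 'b::topological_space"
  assumes S: "S \<subseteq> cls ` Rep full \<times> cls ` Rep full"
    and eq: "\<And>m n. m \<in> Rep full \<Longrightarrow> n \<in> Rep full \<Longrightarrow> (cls m, cls n) \<in> S \<Longrightarrow> \<Phi> (cls m, cls n) = \<Psi> (m, n)"
    and cont: "continuous_on {(m, n). m \<in> Rep full \<and> n \<in> Rep full \<and> (cls m, cls n) \<in> S} \<Psi>"
  shows "continuous_on S \<Phi>"
  unfolding continuous_on_eq_continuous_within
proof
  fix p assume p: "p \<in> S"
  then obtain m n where mn: "p = (cls m, cls n)" "m \<in> Rep full" "n \<in> Rep full" using S by auto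
  obtain i j where ij: "i < 4" "entry m i \<noteq> 0" "j < 4" "entry n j \<noteq> 0"
    using entry_nonzero mn by (metis (mono_tags, lifting) Rep_def mem_Collect_eq)
  \<comment> \<open>On this open neighbourhood of \<open>p\<close> both sections are defined and
    continuous, and continuity at \<open>p\<close> depends on \<open>S \<inter> O'\<close>
    only.\<close>
  define O' where "O' = {q :: (nat \<Rightarrow> complex) \<times> (nat \<Rightarrow> complex). fst q (5 * i) \<noteq> 0} \<inter> {q. snd q (5 * j) \<noteq> 0}"
  have O': "O' = {T. T (5 * i) \<noteq> 0} \<times> {T. T (5 * j) \<noteq> 0}" unfolding O'_def by auto
  have "open {T :: nat \<Rightarrow> complex. T k \<noteq> 0}" for k
    by (rule open_Collect_neq) (auto intro: continuous_on_product_coordinates)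
  then have opn: "open O'" unfolding O' by (intro open_Times)
  have pO: "p \<in> O'" using mn ij unfolding O' by (auto simp: cls_diag Rep_def)
  let ?s = "\<lambda>q. (sec i (fst q), sec j (snd q))"
  have "continuous_on (S \<inter> O') ?s"
    unfolding O'
    by (intro continuous_on_Pair continuous_on_compose2[OF continuous_on_sec] continuous_intros) auto
  moreover have "?s ` (S \<inter> O') \<subseteq> {(m, n). m \<in> Rep full \<and> n \<in> Rep full \<and> (cls m, cls n) \<in> S}"
  proof
    fix x assume "x \<in> ?s ` (S \<inter> O')"
    then obtain q where "q \<in> S" "q \<in> O'" and x: "x = ?s q" by blast
    moreover from this S obtain m' n' where q: "q = (cls m', cls n')" "m' \<in> Rep full" "n' \<in> Rep full" by blast
    ultimately have "cls m' (5 * i) \<noteq> 0" "cls n' (5 * j) \<noteq> 0" unfolding O' by simp_all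
    with q \<open>q \<in> S\<close> x ij show "x \<in> {(m, n). m \<in> Rep full \<and> n \<in> Rep full \<and> (cls m, cls n) \<in> S}"
      by (simp add: sec_cls_Rep)
  qed
  ultimately have "continuous_on (S \<inter> O') (\<lambda>q. \<Psi> (?s q))"
    by (rule continuous_on_compose2[OF cont])
  moreover have "\<Psi> (?s q) = \<Phi> q" if "q \<in> S \<inter> O'" for q
  proof -
    from subsetD[OF S IntD1[OF that]] have "fst q \<in> cls ` Rep full" "snd q \<in> cls ` Rep full"
      by (simp_all only: mem_Times_iff)
    then obtain m' n' where "fst q = cls m'" "snd q = cls n'" and q: "m' \<in> Rep full" "n' \<in> Rep full"
      by (elim imageE) (rule that)
    then have q: "q = (cls m', cls n')" "m' \<in> Rep full" "n' \<in> Rep full" by (simp_all add: prod_eq_iff)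
    have "cls m' (5 * i) \<noteq> 0" "cls n' (5 * j) \<noteq> 0" using that q unfolding O' by simp_all
    then show ?thesis
      using eq[of "sec i (cls m')" "sec j (cls n')"] sec_cls_Rep q ij that by simp
  qed
  ultimately have "continuous_on (S \<inter> O') \<Phi>" by (metis (no_types, lifting) continuous_on_cong)
  then have "continuous (at p within S \<inter> O') \<Phi>"
    using p pO by (auto simp: continuous_on_eq_continuous_within)
  moreover have "at p within S \<inter> O' = at p within S"
    by (rule at_within_nhd[OF pO opn]) auto
  ultimately show "continuous (at p within S) \<Phi>" by (simp add: continuous_within)
qed

lemma continuous_on_cls1:
  fixes \<Phi> :: "(nat \<Rightarrow> complex) \<Rightarrow> 'b::topological_space"
  assumes S: "S \<subseteq> cls ` Rep full"
    and eq: "\<And>m. m \<in> Rep full \<Longrightarrow> cls m \<in> S \<Longrightarrow> \<Phi> (cls m) = \<Psi> m"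
    and cont: "continuous_on {m \<in> Rep full. cls m \<in> S} \<Psi>"
  shows "continuous_on S \<Phi>"
proof -
  \<comment> \<open>A dummy second argument, frozen at the identity, reduces the claim to the
    version for pairs.\<close>
  have "continuous_on (S \<times> {cls rone}) (\<lambda>p. \<Phi> (fst p))"
  proof (rule continuous_on_cls2[where \<Psi>="\<lambda>p. \<Psi> (fst p)"])
    show "S \<times> {cls rone} \<subseteq> cls ` Rep full \<times> cls ` Rep full" using S by auto
    show "continuous_on {(m, n). m \<in> Rep full \<and> n \<in> Rep full \<and> (cls m, cls n) \<in> S \<times> {cls rone}} (\<lambda>p. \<Psi> (fst p))"
      by (rule continuous_on_compose2[OF cont]) (auto intro!: continuous_intros)
  qed (use eq in auto)
  then have "continuous_on S (\<lambda>T. \<Phi> (fst (T, cls rone)))"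
    by (rule continuous_on_compose2) (auto intro!: continuous_intros)
  then show ?thesis by simp
qed

lemma continuous_on_entry [continuous_intros]:
  assumes "continuous_on S f" shows "continuous_on S (\<lambda>x. entry (f x) k)"
proof -
  have eq: "entry m k = (if k = 0 then fst m else if k = 1 then fst (snd m)
      else if k = 2 then fst (snd (snd m)) else fst (snd (snd (snd m))))" for m by (cases m) simp
  consider "k = 0" | "k = 1" | "k = 2" | "k \<noteq> 0 \<and> k \<noteq> 1 \<and> k \<noteq> 2" by blast
  then show ?thesis unfolding eq by cases (simp_all add: continuous_on_fst continuous_on_snd assms)
qed

lemma rdet_eq: "rdet m = fst m * fst (snd (snd (snd m))) - fst (snd m) * fst (snd (snd m))"
  by (cases m) simp

lemma rsnd_eq: "rsnd m = snd (snd (snd (snd m)))"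
  by (cases m) simp

lemma continuous_on_cls: "continuous_on (Rep full) cls"
proof (rule continuous_on_coordinatewise_then_product)
  fix k
  have "continuous_on (Rep full) (\<lambda>m. entry m i * entry m j / rdet m)" for i j
    unfolding rdet_eq by (intro continuous_intros) (simp add: Rep_def rdet_eq)
  moreover have "continuous_on (Rep full) rsnd"
    unfolding rsnd_eq[abs_def] by (intro continuous_intros)
  ultimately show "continuous_on (Rep full) (\<lambda>m. cls m k)"
    unfolding cls_def by (cases "k < 16"; cases "k = 16") simp_all
qed

lemma continuous_on_rmul: "continuous_on S (\<lambda>p. rmul (fst p) (snd p))"
proof -
  have "rmul m n = (fst m * fst n + fst (snd m) * fst (snd (snd n)),
    fst m * fst (snd n) + fst (snd m) * fst (snd (snd (snd n))),
    fst (snd (snd m)) * fst n + fst (snd (snd (snd m))) * fst (snd (snd n)),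
    fst (snd (snd m)) * fst (snd n) + fst (snd (snd (snd m))) * fst (snd (snd (snd n))),
    snd (snd (snd (snd m))) * snd (snd (snd (snd n))))" for m n by (cases m; cases n) simp
  then show ?thesis by (auto intro!: continuous_intros)
qed

lemma continuous_on_rinv: "continuous_on (Rep full) rinv"
proof -
  have eq: "rinv = (\<lambda>m. (fst (snd (snd (snd m))), - fst (snd m), - fst (snd (snd m)), fst m,
      1 / snd (snd (snd (snd m)))))" by (rule ext, rename_tac m, case_tac m) simp
  show ?thesis unfolding eq
    by (intro continuous_intros) (simp add: Rep_def rsnd_eq)
qed

lemma topological_group_pgl: "topological_group (pgl full C)"
  unfolding topological_group_def
proof (intro conjI group_pgl)
  let ?G = "pgl full C" and ?X = "cls ` Rep full"
  interpret group ?G by (rule group_pgl)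
  have "continuous_on (?X \<times> ?X) (\<lambda>(x, y). x \<otimes>\<^bsub>?G\<^esub> y)"
  proof (rule continuous_on_cls2[where \<Psi>="\<lambda>p. cls (rmul (fst p) (snd p))"])
    show "continuous_on {(m, n). m \<in> Rep full \<and> n \<in> Rep full \<and> (cls m, cls n) \<in> ?X \<times> ?X}
      (\<lambda>p. cls (rmul (fst p) (snd p)))"
    proof (rule continuous_on_compose2[OF continuous_on_cls continuous_on_rmul], rule image_subsetI)
      fix p assume "p \<in> {(m, n). m \<in> Rep full \<and> n \<in> Rep full \<and> (cls m, cls n) \<in> ?X \<times> ?X}"
      then show "rmul (fst p) (snd p) \<in> Rep full" by (simp add: case_prod_beta Rep_rmul)
    qed
  qed simp_all
  moreover have "(\<lambda>(x, y). x \<otimes>\<^bsub>?G\<^esub> y) \<in> ?X \<times> ?X \<rightarrow> ?X"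
  proof (rule Pi_I)
    show "(case p of (x, y) \<Rightarrow> x \<otimes>\<^bsub>?G\<^esub> y) \<in> ?X" if "p \<in> ?X \<times> ?X" for p
      using m_closed[of "fst p" "snd p", unfolded carrier_pgl] that by (simp add: case_prod_beta mem_Times_iff)
  qed
  ultimately show "continuous_map (prod_topology (topo ?G) (topo ?G)) (topo ?G) (\<lambda>(x, y). x \<otimes>\<^bsub>?G\<^esub> y)"
    by (simp add: continuous_map_in_subtopology prod_topology_subtopology_eu)
  have "continuous_on ?X (\<lambda>x. inv\<^bsub>?G\<^esub> x)"
  proof (rule continuous_on_cls1[where \<Psi>="\<lambda>m. cls (rinv m)"])
    show "continuous_on {m \<in> Rep full. cls m \<in> ?X} (\<lambda>m. cls (rinv m))"
      by (rule continuous_on_compose2[OF continuous_on_cls])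
        (use Rep_rinv in \<open>blast intro!: continuous_on_subset[OF continuous_on_rinv]\<close>)+
  qed simp_all
  moreover have "(\<lambda>x. inv\<^bsub>?G\<^esub> x) \<in> ?X \<rightarrow> ?X"
    using inv_closed[unfolded carrier_pgl] by (rule Pi_I)
  ultimately show "continuous_map (topo ?G) (topo ?G) (\<lambda>x. inv\<^bsub>?G\<^esub> x)"
    by (simp add: continuous_map_in_subtopology)
qed simp

section \<open>Charts on representatives\<close>

text \<open>The scalar multiplication of the vector space of 5-tuples, for derivatives. It scales
  the last component too, unlike \<open>rscale\<close>, which relates representatives of one
  class.\<close>

definition rep_scale :: "complex \<Rightarrow> rep \<Rightarrow> rep" where
  "rep_scale c m = (case m of (p, q, r, s, z) \<Rightarrow> (c * p, c * q, c * r, c * s, c * z))"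

definition rhol :: "(complex \<Rightarrow> 'a::real_normed_vector \<Rightarrow> 'a) \<Rightarrow> ('a \<Rightarrow> rep) \<Rightarrow> 'a \<Rightarrow> bool" where
  "rhol sa M x \<longleftrightarrow> hol sa (\<lambda>x. fst (M x)) x \<and> hol sa (\<lambda>x. fst (snd (M x))) x \<and>
     hol sa (\<lambda>x. fst (snd (snd (M x)))) x \<and> hol sa (\<lambda>x. fst (snd (snd (snd (M x))))) x \<and>
     hol sa (\<lambda>x. snd (snd (snd (snd (M x))))) x"

lemma rhol_tuple [hol_intros]:
  "\<lbrakk>hol sa p x; hol sa q x; hol sa r x; hol sa s x; hol sa z x\<rbrakk> \<Longrightarrow> rhol sa (\<lambda>x. (p x, q x, r x, s x, z x)) x"
  by (simp add: rhol_def)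

lemma hol_rep_components [hol_intros]:
  "hol rep_scale (\<lambda>m. fst m) m" "hol rep_scale (\<lambda>m. fst (snd m)) m"
  "hol rep_scale (\<lambda>m. fst (snd (snd m))) m" "hol rep_scale (\<lambda>m. fst (snd (snd (snd m)))) m"
  "hol rep_scale (\<lambda>m. snd (snd (snd (snd m)))) m"
  unfolding hol_def
  by (rule exI, rule conjI, (rule derivative_intros)+, simp add: rep_scale_def case_prod_beta)+

lemma rhol_compose:
  assumes "hol rep_scale F (M x)" and "rhol sa M x"
  shows "hol sa (\<lambda>x. F (M x)) x"
proof -
  have h: "hol sa (\<lambda>x. fst (M x)) x" "hol sa (\<lambda>x. fst (snd (M x))) x"
     "hol sa (\<lambda>x. fst (snd (snd (M x)))) x" "hol sa (\<lambda>x. fst (snd (snd (snd (M x))))) x"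
     "hol sa (\<lambda>x. snd (snd (snd (snd (M x))))) x"
    using assms(2) unfolding rhol_def by simp_all
  obtain p where p: "((\<lambda>x. fst (M x)) has_derivative p) (at x)" "\<And>c v. p (sa c v) = c * p v"
    using h(1) unfolding hol_def by blast
  obtain q where q: "((\<lambda>x. fst (snd (M x))) has_derivative q) (at x)" "\<And>c v. q (sa c v) = c * q v"
    using h(2) unfolding hol_def by blast
  obtain r where r: "((\<lambda>x. fst (snd (snd (M x)))) has_derivative r) (at x)" "\<And>c v. r (sa c v) = c * r v"
    using h(3) unfolding hol_def by blast
  obtain s where s: "((\<lambda>x. fst (snd (snd (snd (M x))))) has_derivative s) (at x)" "\<And>c v. s (sa c v) = c * s v"
    using h(4) unfolding hol_def by blast
  obtain z where z: "((\<lambda>x. snd (snd (snd (snd (M x))))) has_derivative z) (at x)" "\<And>c v. z (sa c v) = c * z v"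
    using h(5) unfolding hol_def by blast
  have "(M has_derivative (\<lambda>v. (p v, q v, r v, s v, z v))) (at x)"
    using has_derivative_Pair[OF p(1) has_derivative_Pair[OF q(1) has_derivative_Pair[OF r(1)
      has_derivative_Pair[OF s(1) z(1)]]]] by simp
  then show ?thesis by (rule hol_compose[where F=F and f=M, OF assms(1)]) (simp add: p q r s z rep_scale_def)
qed

lemma rhol_rmul [hol_intros]:
  assumes "rhol sa M x" "rhol sa M' x" shows "rhol sa (\<lambda>x. rmul (M x) (M' x)) x"
proof -
  have eq: "rmul m n = (fst m * fst n + fst (snd m) * fst (snd (snd n)),
    fst m * fst (snd n) + fst (snd m) * fst (snd (snd (snd n))),
    fst (snd (snd m)) * fst n + fst (snd (snd (snd m))) * fst (snd (snd n)),
    fst (snd (snd m)) * fst (snd n) + fst (snd (snd (snd m))) * fst (snd (snd (snd n))),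
    snd (snd (snd (snd m))) * snd (snd (snd (snd n))))" for m n by (cases m; cases n) simp
  show ?thesis unfolding eq using assms unfolding rhol_def
    by (simp only: fst_conv snd_conv) (intro conjI hol_intros; blast)
qed

lemma rhol_rinv [hol_intros]:
  assumes "rhol sa M x" "rsnd (M x) \<noteq> 0" shows "rhol sa (\<lambda>x. rinv (M x)) x"
proof -
  have eq: "rinv m = (fst (snd (snd (snd m))), - fst (snd m), - fst (snd (snd m)), fst m,
      1 / snd (snd (snd (snd m))))" for m by (cases m) simp
  show ?thesis unfolding eq using assms unfolding rhol_def rsnd_eq
    by (simp only: fst_conv snd_conv) (intro conjI hol_intros; blast)
qed

lemma rhol_fst: "rhol (*s) f (fst p) \<Longrightarrow> rhol pair_scale (\<lambda>p. f (fst p)) p"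
  unfolding rhol_def by (intro conjI hol_fst; blast)

lemma rhol_snd: "rhol (*s) f (snd p) \<Longrightarrow> rhol pair_scale (\<lambda>p. f (snd p)) p"
  unfolding rhol_def by (intro conjI hol_snd; blast)

lemma rhol_imp_isCont: "rhol sa M x \<Longrightarrow> isCont M x"
proof -
  assume "rhol sa M x"
  then have "isCont (\<lambda>x. (fst (M x), fst (snd (M x)), fst (snd (snd (M x))),
      fst (snd (snd (snd (M x)))), snd (snd (snd (snd (M x)))))) x"
    unfolding rhol_def by (intro continuous_Pair) (blast intro: hol_imp_isCont)+
  then show ?thesis by simp
qed

definition rep_map :: "bool \<Rightarrow> (rep \<Rightarrow> complex) \<Rightarrow> (rep \<Rightarrow> complex ^ 'd) \<Rightarrow> (nat \<Rightarrow> complex, 'd) chart" where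
  "rep_map full N F = (cls ` {m \<in> Rep full. N m \<noteq> 0}, \<lambda>T. F (rep_of full T))"

text \<open>A chart is described on representatives: its domain is given by \<open>N \<noteq> 0\<close>, its coordinate map by
  \<open>F\<close>, its image by \<open>L \<noteq> 0\<close>, and \<open>P\<close> is a holomorphic lift of its inverse.\<close>

locale rep_chart =
  fixes full :: bool and N :: "rep \<Rightarrow> complex" and F :: "rep \<Rightarrow> complex ^ 'd::finite"
    and L :: "complex ^ 'd \<Rightarrow> complex" and P :: "complex ^ 'd \<Rightarrow> rep"
  assumes N_scale: "l \<noteq> 0 \<Longrightarrow> m \<in> Rep full \<Longrightarrow> N (rscale l m) \<noteq> 0 \<longleftrightarrow> N m \<noteq> 0"
    and F_scale: "l \<noteq> 0 \<Longrightarrow> m \<in> Rep full \<Longrightarrow> N m \<noteq> 0 \<Longrightarrow> F (rscale l m) = F m"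
    and L_F: "m \<in> Rep full \<Longrightarrow> N m \<noteq> 0 \<Longrightarrow> L (F m) \<noteq> 0"
    and P_F: "m \<in> Rep full \<Longrightarrow> N m \<noteq> 0 \<Longrightarrow> \<exists>l. l \<noteq> 0 \<and> P (F m) = rscale l m"
    and hol_F: "m \<in> Rep full \<Longrightarrow> N m \<noteq> 0 \<Longrightarrow> hol rep_scale (\<lambda>m. F m $ k) m"
    and hol_N: "m \<in> Rep full \<Longrightarrow> hol rep_scale N m"
    and hol_L: "hol (*s) L x"
    and P_Rep: "L x \<noteq> 0 \<Longrightarrow> P x \<in> Rep full"
    and N_P: "L x \<noteq> 0 \<Longrightarrow> N (P x) \<noteq> 0"
    and F_P: "L x \<noteq> 0 \<Longrightarrow> F (P x) = x"
    and rhol_P: "L x \<noteq> 0 \<Longrightarrow> rhol (*s) P x"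
begin

abbreviation chart :: "(nat \<Rightarrow> complex, 'd) chart" where "chart \<equiv> rep_map full N F"

abbreviation image :: "(complex ^ 'd) set" where "image \<equiv> {x. L x \<noteq> 0}"

lemma dom_iff: "m \<in> Rep full \<Longrightarrow> cls m \<in> fst chart \<longleftrightarrow> N m \<noteq> 0"
proof
  assume m: "m \<in> Rep full" and "cls m \<in> fst chart"
  then have "cls m \<in> cls ` {m \<in> Rep full. N m \<noteq> 0}" by (simp add: rep_map_def)
  then obtain n where "cls m = cls n" "n \<in> {m \<in> Rep full. N m \<noteq> 0}" by (rule imageE)
  then have n: "n \<in> Rep full" "N n \<noteq> 0" "cls n = cls m" by simp_all
  obtain l where "l \<noteq> 0" "m = rscale l n" using cls_eqD[OF n(1) m n(3)] by blast
  then show "N m \<noteq> 0" using n N_scale by simp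
next
  assume "m \<in> Rep full" "N m \<noteq> 0"
  then show "cls m \<in> fst chart" by (simp add: rep_map_def)
qed

lemma dom_subset: "fst chart \<subseteq> cls ` Rep full"
  by (simp add: rep_map_def image_mono)

lemma snd_chart: "m \<in> Rep full \<Longrightarrow> N m \<noteq> 0 \<Longrightarrow> snd chart (cls m) = F m"
  by (rule rep_of_cls[of m full]) (simp_all add: rep_map_def F_scale)

lemma domE:
  assumes "T \<in> fst chart" obtains m where "m \<in> Rep full" "N m \<noteq> 0" "T = cls m" "snd chart T = F m"
proof -
  from assms obtain m where "m \<in> Rep full" "N m \<noteq> 0" "T = cls m" unfolding rep_map_def by (auto simp del: split_paired_Ex)
  with snd_chart that show thesis by simp
qed

lemma cls_P_F: "m \<in> Rep full \<Longrightarrow> N m \<noteq> 0 \<Longrightarrow> cls (P (F m)) = cls m"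
  by (drule (1) P_F, erule exE) simp

lemma cls_P: "L x \<noteq> 0 \<Longrightarrow> cls (P x) \<in> fst chart" "L x \<noteq> 0 \<Longrightarrow> snd chart (cls (P x)) = x"
  by (simp_all add: dom_iff snd_chart P_Rep N_P F_P)

lemma image_chart: "snd chart ` fst chart = image"
proof
  show "snd chart ` fst chart \<subseteq> image" 
    by (rule image_subsetI, erule domE) (simp add: L_F)
  show "image \<subseteq> snd chart ` fst chart" 

  proof
    fix x assume "x \<in> image"
    then show "x \<in> snd chart ` fst chart"
      by (intro image_eqI[of _ _ "cls (P x)"]) (simp_all add: cls_P)
  qed
qed

lemma inj_on_chart: "inj_on (snd chart) (fst chart)"
proof (rule inj_onI)
  fix S T assume "S \<in> fst chart" "T \<in> fst chart" "snd chart S = snd chart T"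
  then show "S = T" by (elim domE) (metis cls_P_F)
qed

lemma param_chart: "L x \<noteq> 0 \<Longrightarrow> param chart x = cls (P x)"
  using inv_into_f_f[OF inj_on_chart cls_P(1)] cls_P(2) by simp

lemma open_image: "open image"
  by (rule open_Collect_neq) (auto intro!: continuous_at_imp_continuous_on hol_imp_isCont[OF hol_L])

lemma continuous_on_N: "continuous_on (Rep full) N"
  by (rule continuous_at_imp_continuous_on) (blast intro: hol_imp_isCont hol_N)

text \<open>Since \<open>rep_of\<close> need not be continuous, openness is read off the sections:
  on each of the four sets \<open>T (5 * i) \<noteq> 0\<close> the condition
  \<open>N (sec i T) \<noteq> 0\<close> is open, and these sets cover because some entry is
  nonzero.\<close>

lemma openin_chart: "openin (top_of_set (cls ` Rep full)) (fst chart)"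
proof -
  let ?X = "cls ` Rep full"
  let ?U = "\<lambda>i. ?X \<inter> {T. T (5 * i) \<noteq> 0}"
  have "open {T :: nat \<Rightarrow> complex. T k \<noteq> 0}" for k
    by (rule open_Collect_neq) (auto intro: continuous_on_product_coordinates)
  then have U: "openin (top_of_set ?X) (?U i)" for i by (simp add: openin_open_Int)
  have V: "openin (top_of_set ?X) (?U i \<inter> (\<lambda>T. N (sec i T)) -` (- {0}))" if "i < 4" for i
  proof (rule openin_trans[OF continuous_openin_preimage_gen U])
    show "continuous_on (?U i) (\<lambda>T. N (sec i T))"
    proof (rule continuous_on_compose2[OF continuous_on_N])
      show "continuous_on (?U i) (sec i)"
        by (rule continuous_on_subset[OF continuous_on_sec]) simp
      show "sec i ` ?U i \<subseteq> Rep full"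
      proof (rule image_subsetI)
        fix T assume T: "T \<in> ?U i"
        then obtain m where "T = cls m" "m \<in> Rep full" by blast
        with T sec_cls_Rep[OF _ that] show "sec i T \<in> Rep full" by simp
      qed
    qed
  qed (rule open_Compl, simp)
  have "fst chart = (\<Union>i\<in>{..<4}. ?U i \<inter> (\<lambda>T. N (sec i T)) -` (- {0}))"
  proof (intro Set.set_eqI iffI)
    fix T assume "T \<in> fst chart"
    then obtain m where m: "m \<in> Rep full" "N m \<noteq> 0" "T = cls m" by (rule domE)
    then have D: "rdet m \<noteq> 0" by (simp add: Rep_def)
    then obtain i where i: "i < 4" "entry m i \<noteq> 0" using entry_nonzero by blast
    then have "T (5 * i) \<noteq> 0" "sec i T = rscale (1 / entry m i) m"
      using m cls_diag[OF i(1), of m] sec_cls[OF m(1) i] D by simp_all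
    moreover from this have "N (sec i T) \<noteq> 0" using i m N_scale by simp
    moreover have "T \<in> ?X" using m by blast
    ultimately have "T \<in> ?U i \<inter> (\<lambda>T. N (sec i T)) -` (- {0})" by simp
    with i show "T \<in> (\<Union>i\<in>{..<4}. ?U i \<inter> (\<lambda>T. N (sec i T)) -` (- {0}))" by (intro UN_I[of i]) simp_all
  next
    fix T assume "T \<in> (\<Union>i\<in>{..<4}. ?U i \<inter> (\<lambda>T. N (sec i T)) -` (- {0}))"
    then obtain i where i: "i < 4" "T \<in> ?X" "T (5 * i) \<noteq> 0" "N (sec i T) \<noteq> 0"
      by (elim UN_E) simp
    then obtain m where m: "m \<in> Rep full" "T = cls m" by blast
    with i have "sec i T \<in> Rep full" "cls (sec i T) = T" using sec_cls_Rep[OF m(1) i(1)] by simp_all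
    with i(4) dom_iff[of "sec i T"] show "T \<in> fst chart" by simp
  qed
  moreover have "openin (top_of_set ?X) (\<Union>i\<in>{..<4}. ?U i \<inter> (\<lambda>T. N (sec i T)) -` (- {0}))"
    by (rule openin_Union, erule imageE) (simp only: lessThan_iff V)
  ultimately show ?thesis by (simp only:)
qed

lemma is_chart_chart: "is_chart (top_of_set (cls ` Rep full)) chart"
  unfolding is_chart_def image_chart homeomorphic_map_maps
proof (intro conjI openin_chart open_image exI)
  let ?D = "fst chart"
  have top: "subtopology (top_of_set (cls ` Rep full)) ?D = top_of_set ?D"
    using dom_subset by (simp add: subtopology_subtopology Int_absorb1)
  have 1: "continuous_on ?D (snd chart)"
  proof (rule continuous_on_cls1[OF dom_subset, where \<Psi>=F])
    have "isCont (\<lambda>m. F m $ k) m" if "m \<in> {m \<in> Rep full. cls m \<in> ?D}" for m k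
      using hol_imp_isCont[OF hol_F[of m]] dom_iff[of m] that by simp
    then have "continuous_on {m \<in> Rep full. cls m \<in> ?D} (\<lambda>m. \<chi> k. F m $ k)"
      by (intro continuous_on_vec_lambda continuous_at_imp_continuous_on ballI)
    then show "continuous_on {m \<in> Rep full. cls m \<in> ?D} F" by simp
  qed (simp add: dom_iff snd_chart)
  have 2: "continuous_on image (\<lambda>x. cls (P x))"
  proof (rule continuous_on_compose2[OF continuous_on_cls])
    show "continuous_on image P"
      by (intro continuous_at_imp_continuous_on ballI rhol_imp_isCont[OF rhol_P]) simp
    show "P ` image \<subseteq> Rep full" by (rule image_subsetI) (simp add: P_Rep)
  qed
  have 3: "snd chart ` ?D = image" by (rule image_chart)
  show "homeomorphic_maps (subtopology (top_of_set (cls ` Rep full)) ?D) (top_of_set image)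
     (snd chart) (\<lambda>x. cls (P x))"
    unfolding homeomorphic_maps_def top
  proof (intro conjI ballI)
    show "continuous_map (top_of_set ?D) (top_of_set image) (snd chart)"
      using 1 3 by (simp add: continuous_map_in_subtopology image_subset_iff_funcset[symmetric])
    show "continuous_map (top_of_set image) (top_of_set ?D) (\<lambda>x. cls (P x))"
      using 2 by (simp add: continuous_map_in_subtopology Pi_iff cls_P)
    show "cls (P (snd chart T)) = T" if "T \<in> topspace (top_of_set ?D)" for T
    proof -
      from that have "T \<in> ?D" by simp
      then show ?thesis by (rule domE) (simp add: cls_P_F)
    qed
  qed (simp add: cls_P)
qed

text \<open>All holomorphy conditions of a Lie group reduce to this: a map with a holomorphic lift
  \<open>M\<close> to representatives reads \<open>F (M x)\<close> in the chart, on the open set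
  \<open>N (M x) \<noteq> 0\<close>.\<close>

lemma holo_on_chart:
  fixes f :: "'a::real_normed_vector \<Rightarrow> complex ^ 'd"
  assumes "vector_space sa" and S: "open S" and M: "\<And>x. x \<in> S \<Longrightarrow> rhol sa M x" "\<And>x. x \<in> S \<Longrightarrow> M x \<in> Rep full"
    and D: "D = {x \<in> S. cls (M x) \<in> fst chart}" and f: "\<And>x. x \<in> D \<Longrightarrow> f x = snd chart (cls (M x))"
  shows "holo_on sa (*s) f D"
proof (rule holo_onI[OF assms(1)])
  have iff: "cls (M x) \<in> fst chart \<longleftrightarrow> N (M x) \<noteq> 0" if "x \<in> S" for x
    by (rule dom_iff[OF M(2)[OF that]])
  have D': "D = S \<inter> (\<lambda>x. N (M x)) -` (- {0})"
    unfolding D using iff by (simp add: set_eq_iff cong: conj_cong)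
  have "continuous_on S (\<lambda>x. N (M x))"
    by (intro continuous_at_imp_continuous_on ballI
      hol_imp_isCont[OF rhol_compose[where F=N and M=M, OF hol_N[OF M(2)] M(1)]])
  then show D_open: "open D"
    unfolding D' by (intro continuous_open_preimage S open_Compl) simp_all
  fix x i assume x: "x \<in> D"
  show "hol sa (\<lambda>x. f x $ i) x"
  proof (rule hol_cong_open[OF rhol_compose[where M=M] D_open x])
    show "hol rep_scale (\<lambda>m. F m $ i) (M x)" using x hol_F[OF M(2)[of x]] unfolding D' by simp
    show "rhol sa M x" using x D M(1) by auto
    show "F (M y) $ i = f y $ i" if "y \<in> D" for y
      using f[OF that] that snd_chart[OF M(2)[of y]] unfolding D' by simp
  qed
qed

end

definition is_rep_chart :: "bool \<Rightarrow> (nat \<Rightarrow> complex, 'd::finite) chart \<Rightarrow> bool" where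
  "is_rep_chart full c \<longleftrightarrow> (\<exists>N F L P. c = rep_map full N F \<and> rep_chart full N F L P)"

lemma is_rep_chartE:
  assumes "is_rep_chart full c"
  obtains N F L P where "c = rep_map full N F" "rep_chart full N F L P"
  using assms unfolding is_rep_chart_def by blast

text \<open>The map \<open>P\<close> of the first chart is itself a holomorphic lift, so the
  transition map is \<open>F'\<close> after \<open>P\<close>.\<close>

lemma charts_compatible_half:
  assumes "is_rep_chart full a" "is_rep_chart full c"
  shows "holo_on (*s) (*s) (\<lambda>x. snd c (param a x)) (snd a ` (fst a \<inter> fst c))"
proof -
  obtain N F L P where a: "a = rep_map full N F" "rep_chart full N F L P" using assms(1) by (rule is_rep_chartE)
  obtain N' F' L' P' where c: "c = rep_map full N' F'" "rep_chart full N' F' L' P'"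
    using assms(2) by (rule is_rep_chartE)
  interpret a: rep_chart full N F L P by fact
  interpret c: rep_chart full N' F' L' P' by fact
  have D: "snd a ` (fst a \<inter> fst c) = {x \<in> a.image. cls (P x) \<in> fst c}"
  proof (intro Set.set_eqI iffI)
    fix x assume "x \<in> snd a ` (fst a \<inter> fst c)"
    then obtain T where T: "T \<in> fst a" "T \<in> fst c" "x = snd a T" by blast
    from T(1) obtain m where "m \<in> Rep full" "N m \<noteq> 0" "T = cls m" "snd a T = F m"
      unfolding a(1) by (rule a.domE)
    with T show "x \<in> {x \<in> a.image. cls (P x) \<in> fst c}" using a.cls_P_F a.L_F by simp
  next
    fix x assume "x \<in> {x \<in> a.image. cls (P x) \<in> fst c}"
    then show "x \<in> snd a ` (fst a \<inter> fst c)" unfolding a(1) using a.cls_P by force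
  qed
  show ?thesis
    by (rule c.holo_on_chart[OF vec.vector_space_axioms a.open_image a.rhol_P a.P_Rep])
      (simp_all add: D a.param_chart[folded a(1)] flip: c(1))
qed

lemma charts_compatible_rep:
  "is_rep_chart full a \<Longrightarrow> is_rep_chart full c \<Longrightarrow> charts_compatible a c"
  unfolding charts_compatible_def using charts_compatible_half[of full a c] charts_compatible_half[of full c a]
  by (simp add: Int_commute)

lemma second_countable_top_of_set:
  "second_countable_space (top_of_set (X :: 'a::second_countable_topology set))"
proof -
  obtain B :: "'a set set" where B: "countable B" "topological_basis B" using ex_countable_basis by blast
  show ?thesis unfolding second_countable_space_def
  proof (intro exI conjI allI impI ballI)
    show "countable ((\<lambda>V. X \<inter> V) ` B)" using B by simp
    show "openin (top_of_set X) V" if "V \<in> (\<lambda>V. X \<inter> V) ` B" for V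
      using that B topological_basis_open by (auto intro!: openin_open_Int)
    fix U x assume "openin (top_of_set X) U \<and> x \<in> U"
    then obtain W where W: "open W" "U = X \<inter> W" "x \<in> W" "x \<in> X" by (auto simp: openin_open)
    then obtain V where "V \<in> B" "x \<in> V" "V \<subseteq> W" using topological_basisE[OF B(2)] by metis
    with W show "\<exists>V\<in>(\<lambda>V. X \<inter> V) ` B. x \<in> V \<and> V \<subseteq> U" by (intro bexI[of _ "X \<inter> V"]) auto
  qed
qed

text \<open>The lifts required are \<open>rmul (P x) (P' y)\<close> for multiplication and
  \<open>rinv (P x)\<close> for inversion.\<close>

lemma complex_lie_group_pgl:
  fixes C :: "(nat \<Rightarrow> complex, 'd::finite) chart set"
  assumes C: "\<And>c. c \<in> C \<Longrightarrow> is_rep_chart full c" and cover: "(\<Union>c\<in>C. fst c) = cls ` Rep full"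
  shows "complex_lie_group (pgl full C)"
proof -
  let ?X = "cls ` Rep full"
  have "complex_manifold (top_of_set ?X) C"
    unfolding complex_manifold_def
  proof (intro conjI ballI)
    show "Hausdorff_space (top_of_set ?X)" by (simp add: Hausdorff_space_subtopology)
    show "is_chart (top_of_set ?X) c" if "c \<in> C" for c
      using C[OF that] by (rule is_rep_chartE) (simp add: rep_chart.is_chart_chart)
  qed (auto simp: second_countable_top_of_set cover intro: charts_compatible_rep C)
  moreover have "holo_on pair_scale (*s) (\<lambda>(x, y). snd c (param a x \<otimes>\<^bsub>pgl full C\<^esub> param b y))
          {(x, y). x \<in> snd a ` fst a \<and> y \<in> snd b ` fst b \<and> param a x \<otimes>\<^bsub>pgl full C\<^esub> param b y \<in> fst c}"
    if abc: "a \<in> C" "b \<in> C" "c \<in> C" for a b c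
  proof -
    obtain N F L P where a: "a = rep_map full N F" "rep_chart full N F L P"
      using C[OF abc(1)] by (rule is_rep_chartE)
    obtain N' F' L' P' where b: "b = rep_map full N' F'" "rep_chart full N' F' L' P'"
      using C[OF abc(2)] by (rule is_rep_chartE)
    obtain N'' F'' L'' P'' where c: "c = rep_map full N'' F''" "rep_chart full N'' F'' L'' P''"
      using C[OF abc(3)] by (rule is_rep_chartE)
    interpret a: rep_chart full N F L P by fact
    interpret b: rep_chart full N' F' L' P' by fact
    interpret c: rep_chart full N'' F'' L'' P'' by fact
    have eq: "param a x \<otimes>\<^bsub>pgl full C\<^esub> param b y = cls (rmul (P x) (P' y))" if "L x \<noteq> 0" "L' y \<noteq> 0" for x y
      using that by (simp add: a b a.param_chart b.param_chart a.P_Rep b.P_Rep)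
    show ?thesis
    proof (rule c.holo_on_chart[OF vector_space_pair_scale open_Times[OF a.open_image b.open_image],
          where M="\<lambda>p. rmul (P (fst p)) (P' (snd p))"])
      show "rhol pair_scale (\<lambda>p. rmul (P (fst p)) (P' (snd p))) p" if "p \<in> a.image \<times> b.image" for p
        using that by (intro rhol_rmul rhol_fst rhol_snd a.rhol_P b.rhol_P) auto
      show "rmul (P (fst p)) (P' (snd p)) \<in> Rep full" if "p \<in> a.image \<times> b.image" for p
        using that by (intro Rep_rmul a.P_Rep b.P_Rep) auto
      show "{(x, y). x \<in> snd a ` fst a \<and> y \<in> snd b ` fst b \<and> param a x \<otimes>\<^bsub>pgl full C\<^esub> param b y \<in> fst c}
        = {p \<in> a.image \<times> b.image. cls (rmul (P (fst p)) (P' (snd p))) \<in> fst c.chart}"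
        by (rule Set.set_eqI) (simp add: a.image_chart[folded a(1)] b.image_chart[folded b(1)]
          case_prod_beta mem_Times_iff eq flip: c(1) cong: conj_cong)
      show "(case p of (x, y) \<Rightarrow> snd c (param a x \<otimes>\<^bsub>pgl full C\<^esub> param b y))
         = snd c.chart (cls (rmul (P (fst p)) (P' (snd p))))"
        if "p \<in> {(x, y). x \<in> snd a ` fst a \<and> y \<in> snd b ` fst b \<and> param a x \<otimes>\<^bsub>pgl full C\<^esub> param b y \<in> fst c}" for p
        using that by (simp add: a.image_chart[folded a(1)] b.image_chart[folded b(1)]
          case_prod_beta mem_Times_iff eq flip: c(1))
    qed
  qed
  moreover have "holo_on (*s) (*s) (\<lambda>x. snd c (inv\<^bsub>pgl full C\<^esub> (param a x)))
          {x. x \<in> snd a ` fst a \<and> inv\<^bsub>pgl full C\<^esub> (param a x) \<in> fst c}"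
    if ac: "a \<in> C" "c \<in> C" for a c
  proof -
    obtain N F L P where a: "a = rep_map full N F" "rep_chart full N F L P"
      using C[OF ac(1)] by (rule is_rep_chartE)
    obtain N'' F'' L'' P'' where c: "c = rep_map full N'' F''" "rep_chart full N'' F'' L'' P''"
      using C[OF ac(2)] by (rule is_rep_chartE)
    interpret a: rep_chart full N F L P by fact
    interpret c: rep_chart full N'' F'' L'' P'' by fact
    have eq: "inv\<^bsub>pgl full C\<^esub> (param a x) = cls (rinv (P x))" if "L x \<noteq> 0" for x
      using that by (simp add: a a.param_chart a.P_Rep)
    show ?thesis
    proof (rule c.holo_on_chart[OF vec.vector_space_axioms a.open_image, where M="\<lambda>x. rinv (P x)"])
      show "rhol (*s) (\<lambda>x. rinv (P x)) x" if "x \<in> a.image" for x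
        using that a.P_Rep[of x] by (intro rhol_rinv a.rhol_P) (auto simp: Rep_def)
      show "rinv (P x) \<in> Rep full" if "x \<in> a.image" for x
        using that by (intro Rep_rinv a.P_Rep) auto
    qed (simp_all add: a.image_chart[folded a(1)] eq flip: c(1) cong: conj_cong)
  qed
  ultimately show ?thesis
    unfolding complex_lie_group_def by (simp add: topological_group_pgl)
qed

section \<open>The affine charts\<close>

abbreviation ra :: "rep \<Rightarrow> complex" where "ra m \<equiv> fst m"
abbreviation rb :: "rep \<Rightarrow> complex" where "rb m \<equiv> fst (snd m)"
abbreviation rc :: "rep \<Rightarrow> complex" where "rc m \<equiv> fst (snd (snd m))"
abbreviation rd :: "rep \<Rightarrow> complex" where "rd m \<equiv> fst (snd (snd (snd m)))"

lemma rep_components_rscale [simp]: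
  "ra (rscale l m) = l * ra m" "rb (rscale l m) = l * rb m"
  "rc (rscale l m) = l * rc m" "rd (rscale l m) = l * rd m"
  by (cases m; simp)+

lemma rmul_components [simp]:
  "ra (rmul m n) = ra m * ra n + rb m * rc n" "rb (rmul m n) = ra m * rb n + rb m * rd n"
  "rc (rmul m n) = rc m * ra n + rd m * rc n" "rd (rmul m n) = rc m * rb n + rd m * rd n"
  by (cases m; cases n; simp)+

lemma rinv_components [simp]:
  "ra (rinv m) = rd m" "rb (rinv m) = - rb m" "rc (rinv m) = - rc m" "rd (rinv m) = ra m"
  by (cases m; simp)+

lemma rone_components [simp]:
  "ra rone = 1" "rb rone = 0" "rc rone = 0" "rd rone = 1" "rsnd rone = 1"
  by (simp_all add: rone_def)

lemma Rep_components: "m \<in> Rep b \<longleftrightarrow> ra m * rd m \<noteq> rb m * rc m \<and> rsnd m \<noteq> 0 \<and> (b \<or> rsnd m = 1)"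
  by (simp add: Rep_def rdet_eq)

lemma rep_eq_iff: "m = n \<longleftrightarrow> ra m = ra n \<and> rb m = rb n \<and> rc m = rc n \<and> rd m = rd n \<and> rsnd m = rsnd n"
  by (simp add: prod_eq_iff rsnd_eq)

lemma hol_rsnd [hol_intros]: "hol rep_scale rsnd m"
  using hol_rep_components(5)[of m] by (simp add: rsnd_eq[abs_def])

text \<open>A multiplicative character of the torus (or unipotent group) of matrices
  \<open>(u, v; \<rho>\<^sup>2 v, u)\<close> modulo scalars; \<open>exp (v / u)\<close> is the limit case \<open>\<rho> = 0\<close>.\<close>

definition torus_char :: "bool \<Rightarrow> complex \<Rightarrow> complex \<Rightarrow> complex \<Rightarrow> complex" where
  "torus_char t \<rho> u v = (if \<not> t then 1 else if \<rho> = 0 then exp (v / u) else (u + \<rho> * v) / (u - \<rho> * v))"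

text \<open>The two factors are the eigenvalues of the matrix
  \<open>(u, v; \<rho>\<^sup>2 v, u)\<close>, and their product is its determinant.\<close>

lemma torus_factors:
  fixes u v \<rho> :: complex
  assumes "u\<^sup>2 \<noteq> \<rho>\<^sup>2 * v\<^sup>2"
  shows "u + \<rho> * v \<noteq> 0" "u - \<rho> * v \<noteq> 0" "\<rho> = 0 \<Longrightarrow> u \<noteq> 0"
proof -
  have "(u + \<rho> * v) * (u - \<rho> * v) \<noteq> 0" using assms by (simp add: power2_eq_square algebra_simps)
  then show "u + \<rho> * v \<noteq> 0" "u - \<rho> * v \<noteq> 0" by auto
qed (use assms in auto)

lemma torus_char_nonzero: "u\<^sup>2 \<noteq> \<rho>\<^sup>2 * v\<^sup>2 \<Longrightarrow> torus_char t \<rho> u v \<noteq> 0"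
  using torus_factors[of u \<rho> v] by (simp add: torus_char_def)

lemma torus_char_scale [simp]: "l \<noteq> 0 \<Longrightarrow> torus_char t \<rho> (l * u) (l * v) = torus_char t \<rho> u v"
proof -
  assume l: "l \<noteq> 0"
  have "l * u + \<rho> * (l * v) = l * (u + \<rho> * v)" "l * u - \<rho> * (l * v) = l * (u - \<rho> * v)"
    by (simp_all add: algebra_simps)
  then show ?thesis using l by (simp add: torus_char_def)
qed

text \<open>The arguments on the left form the first row of the product of two such matrices.
  Eigenvalues multiply, and in the case \<rho> = 0 the quotients v / u add.\<close>

lemma torus_char_mult:
  assumes "u\<^sup>2 \<noteq> \<rho>\<^sup>2 * v\<^sup>2" "u'\<^sup>2 \<noteq> \<rho>\<^sup>2 * v'\<^sup>2"
  shows "torus_char t \<rho> (u * u' + \<rho>\<^sup>2 * v * v') (u * v' + v * u') = torus_char t \<rho> u v * torus_char t \<rho> u' v'"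
proof (cases "\<rho> = 0")
  case True
  then show ?thesis using assms by (simp add: torus_char_def flip: exp_add) (simp add: field_simps)
next
  case False
  have "u * u' + \<rho>\<^sup>2 * v * v' + \<rho> * (u * v' + v * u') = (u + \<rho> * v) * (u' + \<rho> * v')"
    "u * u' + \<rho>\<^sup>2 * v * v' - \<rho> * (u * v' + v * u') = (u - \<rho> * v) * (u' - \<rho> * v')"
    by (simp_all add: power2_eq_square algebra_simps)
  with False show ?thesis by (simp add: torus_char_def)
qed

lemma torus_char_1 [simp]: "u \<noteq> 0 \<Longrightarrow> torus_char t \<rho> u 0 = 1"
  by (simp add: torus_char_def)

lemma hol_torus_char [hol_intros]:
  assumes "hol sa f x" "hol sa g x" "(f x)\<^sup>2 \<noteq> \<rho>\<^sup>2 * (g x)\<^sup>2"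
  shows "hol sa (\<lambda>x. torus_char t \<rho> (f x) (g x)) x"
  using torus_factors[OF assms(3)] unfolding torus_char_def
  by (cases "t"; cases "\<rho> = 0") (auto intro!: hol_intros assms)

locale coords =
  fixes i0 i1 i2 i3 :: "'d::finite"
  assumes distinct: "i0 \<noteq> i1" "i0 \<noteq> i2" "i1 \<noteq> i2" "i3 \<noteq> i1" "i3 \<noteq> i2"
    and UNIV_eq: "(UNIV :: 'd set) = {i0, i1, i2, i3}"
begin

text \<open>With \<open>i3 = i0\<close> there are only three coordinates, and the fourth entry of \<open>mk\<close> is ignored.\<close>

abbreviation full :: bool where "full \<equiv> i3 \<noteq> i0"

definition mk :: "complex \<Rightarrow> complex \<Rightarrow> complex \<Rightarrow> complex \<Rightarrow> complex ^ 'd" where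
  "mk p q s z = (\<chi> k. if k = i0 then p else if k = i1 then q else if k = i2 then s else z)"

definition zc :: "complex ^ 'd \<Rightarrow> complex" where "zc x = (if full then x $ i3 else 1)"

lemma mk_nth [simp]: "mk p q s z $ i0 = p" "mk p q s z $ i1 = q" "mk p q s z $ i2 = s"
  "full \<Longrightarrow> mk p q s z $ i3 = z"
  using distinct by (auto simp: mk_def)

lemma zc_mk [simp]: "zc (mk p q s z) = (if full then z else 1)"
  by (simp add: zc_def)

lemma index_cases: obtains "k = i0" | "k = i1" | "k = i2" | "k = i3" full
  using UNIV_eq UNIV_I[of k] by auto

lemma vec_eqI:
  assumes "x $ i0 = y $ i0" "x $ i1 = y $ i1" "x $ i2 = y $ i2" "full \<Longrightarrow> x $ i3 = y $ i3"
  shows "x = y"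
  unfolding vec_eq_iff by (rule allI, rule_tac k=i in index_cases) (use assms in simp_all)

lemma mk_nth_same: "mk (x $ i0) (x $ i1) (x $ i2) (zc x) = x"
  by (rule vec_eqI) (simp_all add: zc_def)

lemma hol_mk [hol_intros]:
  "\<lbrakk>hol sa p x; hol sa q x; hol sa s x; hol sa z x\<rbrakk> \<Longrightarrow> hol sa (\<lambda>x. mk (p x) (q x) (s x) (z x) $ k) x"
  by (rule index_cases[of k]) simp_all

lemma hol_zc [hol_intros]: "hol (*s) zc x"
proof (cases full)
  case True
  then have "zc = (\<lambda>x. x $ i3)" unfolding zc_def[abs_def] by simp
  then show ?thesis by (simp add: hol_vec_nth)
next
  case False
  then have "zc = (\<lambda>x. 1)" unfolding zc_def[abs_def] by simp
  then show ?thesis by (simp add: hol_const)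
qed

text \<open>Dividing by \<open>ra\<close> leaves the three other entries and the C* component as
  coordinates. \<open>La x\<close> is the determinant of \<open>Pa x\<close> times its last
  component, so it is nonzero exactly when \<open>Pa x\<close> is invertible. The other three
  families do the same for the other entries.\<close>

definition "Na m = ra m"
definition "Fa m = mk (rb m / ra m) (rc m / ra m) (rd m / ra m) (rsnd m)"
definition "La x = (x $ i2 - x $ i0 * x $ i1) * zc x"
definition "Pa x = (1 :: complex, x $ i0, x $ i1, x $ i2, zc x)"

definition "Nb m = rb m"
definition "Fb m = mk (ra m / rb m) (rc m / rb m) (rd m / rb m) (rsnd m)"
definition "Lb x = (x $ i0 * x $ i2 - x $ i1) * zc x"
definition "Pb x = (x $ i0, 1 :: complex, x $ i1, x $ i2, zc x)"

definition "Nc m = rc m"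
definition "Fc m = mk (ra m / rc m) (rb m / rc m) (rd m / rc m) (rsnd m)"
definition "Lc x = (x $ i0 * x $ i2 - x $ i1) * zc x"
definition "Pc x = (x $ i0, x $ i1, 1 :: complex, x $ i2, zc x)"

definition "Nd m = rd m"
definition "Fd m = mk (ra m / rd m) (rb m / rd m) (rc m / rd m) (rsnd m)"
definition "Ld x = (x $ i0 - x $ i1 * x $ i2) * zc x"
definition "Pd x = (x $ i0, x $ i1, x $ i2, 1 :: complex, zc x)"

lemma rep_chart_a: "rep_chart full Na Fa La Pa"
proof
  fix m :: rep assume m: "m \<in> Rep full" "Na m \<noteq> 0"
  then have "m \<in> Rep full" "ra m \<noteq> 0" by (simp_all add: Na_def)
  then show "\<exists>l. l \<noteq> 0 \<and> Pa (Fa m) = rscale l m" "La (Fa m) \<noteq> 0"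
    by (intro exI[of _ "1 / ra m"], simp_all add: rep_eq_iff Fa_def Pa_def La_def Rep_components field_simps)
  show "hol rep_scale (\<lambda>m. Fa m $ k) m" for k
    using m unfolding Fa_def Na_def by (intro hol_intros) simp_all
next
  fix x :: "complex ^ 'd" assume x: "La x \<noteq> 0"
  then show "Pa x \<in> Rep full" by (auto simp: La_def Pa_def Rep_components zc_def)
  show "Fa (Pa x) = x" by (simp add: Fa_def Pa_def mk_nth_same)
  show "rhol (*s) Pa x" unfolding Pa_def by (intro hol_intros)
qed (auto simp: Na_def Fa_def Pa_def La_def[abs_def] Na_def[abs_def] intro!: hol_intros)

lemma rep_chart_b: "rep_chart full Nb Fb Lb Pb"
proof
  fix m :: rep assume m: "m \<in> Rep full" "Nb m \<noteq> 0"
  then have "m \<in> Rep full" "rb m \<noteq> 0" by (simp_all add: Nb_def)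
  then show "\<exists>l. l \<noteq> 0 \<and> Pb (Fb m) = rscale l m" "Lb (Fb m) \<noteq> 0"
    by (intro exI[of _ "1 / rb m"], simp_all add: rep_eq_iff Fb_def Pb_def Lb_def Rep_components field_simps)
  show "hol rep_scale (\<lambda>m. Fb m $ k) m" for k
    using m unfolding Fb_def Nb_def by (intro hol_intros) simp_all
next
  fix x :: "complex ^ 'd" assume x: "Lb x \<noteq> 0"
  then show "Pb x \<in> Rep full" by (auto simp: Lb_def Pb_def Rep_components zc_def)
  show "Fb (Pb x) = x" by (simp add: Fb_def Pb_def mk_nth_same)
  show "rhol (*s) Pb x" unfolding Pb_def by (intro hol_intros)
qed (auto simp: Nb_def Fb_def Pb_def Lb_def[abs_def] Nb_def[abs_def] intro!: hol_intros)

lemma rep_chart_c: "rep_chart full Nc Fc Lc Pc"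
proof
  fix m :: rep assume m: "m \<in> Rep full" "Nc m \<noteq> 0"
  then have "m \<in> Rep full" "rc m \<noteq> 0" by (simp_all add: Nc_def)
  then show "\<exists>l. l \<noteq> 0 \<and> Pc (Fc m) = rscale l m" "Lc (Fc m) \<noteq> 0"
    by (intro exI[of _ "1 / rc m"], simp_all add: rep_eq_iff Fc_def Pc_def Lc_def Rep_components field_simps)
  show "hol rep_scale (\<lambda>m. Fc m $ k) m" for k
    using m unfolding Fc_def Nc_def by (intro hol_intros) simp_all
next
  fix x :: "complex ^ 'd" assume x: "Lc x \<noteq> 0"
  then show "Pc x \<in> Rep full" by (auto simp: Lc_def Pc_def Rep_components zc_def)
  show "Fc (Pc x) = x" by (simp add: Fc_def Pc_def mk_nth_same)
  show "rhol (*s) Pc x" unfolding Pc_def by (intro hol_intros)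
qed (auto simp: Nc_def Fc_def Pc_def Lc_def[abs_def] Nc_def[abs_def] intro!: hol_intros)

lemma rep_chart_d: "rep_chart full Nd Fd Ld Pd"
proof
  fix m :: rep assume m: "m \<in> Rep full" "Nd m \<noteq> 0"
  then have "m \<in> Rep full" "rd m \<noteq> 0" by (simp_all add: Nd_def)
  then show "\<exists>l. l \<noteq> 0 \<and> Pd (Fd m) = rscale l m" "Ld (Fd m) \<noteq> 0"
    by (intro exI[of _ "1 / rd m"], simp_all add: rep_eq_iff Fd_def Pd_def Ld_def Rep_components field_simps)
  show "hol rep_scale (\<lambda>m. Fd m $ k) m" for k
    using m unfolding Fd_def Nd_def by (intro hol_intros) simp_all
next
  fix x :: "complex ^ 'd" assume x: "Ld x \<noteq> 0"
  then show "Pd x \<in> Rep full" by (auto simp: Ld_def Pd_def Rep_components zc_def)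
  show "Fd (Pd x) = x" by (simp add: Fd_def Pd_def mk_nth_same)
  show "rhol (*s) Pd x" unfolding Pd_def by (intro hol_intros)
qed (auto simp: Nd_def Fd_def Pd_def Ld_def[abs_def] Nd_def[abs_def] intro!: hol_intros)

end

section \<open>Charts adapted to the big cell\<close>

locale matched_model = coords i0 i1 i2 i3 for i0 i1 i2 i3 :: "'d::finite" +
  fixes t :: bool and \<rho> :: complex
  assumes t_full: "t \<Longrightarrow> full"
begin

abbreviation tc :: "complex \<Rightarrow> complex \<Rightarrow> complex" where "tc \<equiv> torus_char t \<rho>"

definition quad :: "rep \<Rightarrow> complex" where "quad m = (ra m)\<^sup>2 - \<rho>\<^sup>2 * (rb m)\<^sup>2"

lemma quad_rscale [simp]: "quad (rscale l m) = l\<^sup>2 * quad m"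
  by (simp add: quad_def power2_eq_square algebra_simps)

lemma hol_quad [hol_intros]: "hol rep_scale quad m"
  unfolding quad_def by (intro hol_intros)

text \<open>On \<open>quad \<noteq> 0\<close> every class is uniquely \<open>(1, 0; g, e) (u, v; \<rho>\<^sup>2 v, u)\<close>, where \<open>(u, v)\<close> is its
  first row; \<open>g\<close> and \<open>e - 1\<close> are the middle coordinates.\<close>

definition straight :: "complex \<Rightarrow> rep \<Rightarrow> complex ^ 'd" where
  "straight s m = mk s ((rc m * ra m - \<rho>\<^sup>2 * rb m * rd m) / quad m) ((ra m * rd m - rb m * rc m) / quad m - 1)
     (rsnd m / tc (ra m) (rb m) - 1)"

text \<open>Undoes the shift by 1 in the last coordinate of \<open>straight\<close>; the shift turns
  the graph of the character into the linear condition \<open>x $ i3 = 0\<close>.\<close>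

definition zs :: "complex ^ 'd \<Rightarrow> complex" where "zs x = (if full then 1 + x $ i3 else 1)"

lemma hol_zs [hol_intros]: "hol (*s) zs x"
proof (cases full)
  case True
  then have "zs = (\<lambda>x. 1 + x $ i3)" unfolding zs_def[abs_def] by simp
  then show ?thesis by (simp add: hol_intros)
next
  case False
  then have "zs = (\<lambda>x. 1)" unfolding zs_def[abs_def] by simp
  then show ?thesis by (simp add: hol_const)
qed

text \<open>The class of the torus factor is measured by v / u here and by u / v in the second
  chart. With s = \<open>x $ i0\<close>, g = \<open>x $ i1\<close> and e =
  \<open>1 + x $ i2\<close>, the matrix of \<open>P1 x\<close> is the product of (1, 0; g, e) and
  \<open>(1, s; \<rho>\<^sup>2 s, 1)\<close>; that of \<open>P2 x\<close> uses
  \<open>(s, 1; \<rho>\<^sup>2, s)\<close> instead.\<close>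

definition "N1 m = ra m * quad m"
definition "F1 m = straight (rb m / ra m) m"
definition "L1 x = (1 - \<rho>\<^sup>2 * (x $ i0)\<^sup>2) * (1 + x $ i2) * zs x"
definition "P1 x = (1, x $ i0, x $ i1 + (1 + x $ i2) * \<rho>\<^sup>2 * x $ i0, x $ i1 * x $ i0 + (1 + x $ i2), zs x * tc 1 (x $ i0))"

definition "N2 m = rb m * quad m"
definition "F2 m = straight (ra m / rb m) m"
definition "L2 x = ((x $ i0)\<^sup>2 - \<rho>\<^sup>2) * (1 + x $ i2) * zs x"
definition "P2 x = (x $ i0, 1, x $ i1 * x $ i0 + (1 + x $ i2) * \<rho>\<^sup>2, x $ i1 + (1 + x $ i2) * x $ i0, zs x * tc (x $ i0) 1)"

lemma not_full_tc: "\<not> full \<Longrightarrow> tc u v = 1"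
  using t_full by (auto simp: torus_char_def)

lemma quad_tc: "quad m \<noteq> 0 \<Longrightarrow> tc (ra m) (rb m) \<noteq> 0"
  by (rule torus_char_nonzero) (simp add: quad_def)

lemma straight_rscale:
  assumes "l \<noteq> 0" shows "straight s (rscale l m) = straight s m"
proof -
  have "l * rc m * (l * ra m) - \<rho>\<^sup>2 * (l * rb m) * (l * rd m) = l\<^sup>2 * (rc m * ra m - \<rho>\<^sup>2 * rb m * rd m)"
    "l * ra m * (l * rd m) - l * rb m * (l * rc m) = l\<^sup>2 * (ra m * rd m - rb m * rc m)"
    by (simp_all add: power2_eq_square algebra_simps)
  then show ?thesis using assms by (simp add: straight_def)
qed

text \<open>Cramer's rule for the second row of the factorization, a linear system in
  \<open>g\<close> and \<open>e\<close> with determinant \<open>quad m\<close>.\<close>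

lemma straight_solve:
  assumes q: "quad m \<noteq> 0"
  defines "g \<equiv> (rc m * ra m - \<rho>\<^sup>2 * rb m * rd m) / quad m" and "e \<equiv> (ra m * rd m - rb m * rc m) / quad m"
  shows "g * ra m + e * \<rho>\<^sup>2 * rb m = rc m" "g * rb m + e * ra m = rd m"
proof -
  have "g * ra m + e * \<rho>\<^sup>2 * rb m = (rc m * quad m) / quad m"
    unfolding g_def e_def times_divide_eq_left add_divide_distrib[symmetric]
    by (rule arg_cong[where f="\<lambda>x. x / quad m"]) (simp add: quad_def power2_eq_square algebra_simps)
  then show "g * ra m + e * \<rho>\<^sup>2 * rb m = rc m" using q by simp
  have "g * rb m + e * ra m = (rd m * quad m) / quad m"
    unfolding g_def e_def times_divide_eq_left add_divide_distrib[symmetric]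
    by (rule arg_cong[where f="\<lambda>x. x / quad m"]) (simp add: quad_def power2_eq_square algebra_simps)
  then show "g * rb m + e * ra m = rd m" using q by simp
qed

lemma hol_straight:
  assumes "hol rep_scale s m" "quad m \<noteq> 0"
  shows "hol rep_scale (\<lambda>m. straight (s m) m $ k) m"
  unfolding straight_def using assms(2) quad_tc[OF assms(2)]
  by (intro hol_intros assms(1)) (auto simp: quad_def)

lemma zs_straight:
  assumes "m \<in> Rep full" "quad m \<noteq> 0"
  shows "zs (straight s m) * tc (ra m) (rb m) = rsnd m"
  using assms quad_tc[OF assms(2)] not_full_tc by (auto simp: straight_def zs_def Rep_components)

lemma rep_chart_1: "rep_chart full N1 F1 L1 P1"
proof
  fix m :: rep assume "m \<in> Rep full" "N1 m \<noteq> 0"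
  then have m: "m \<in> Rep full" "ra m \<noteq> 0" "quad m \<noteq> 0" by (simp_all add: N1_def)
  have tc: "tc 1 (rb m / ra m) = tc (ra m) (rb m)"
    using torus_char_scale[of "1 / ra m" t \<rho> "ra m" "rb m"] m by simp
  note sol = straight_solve[OF m(3)] and zs = zs_straight[OF m(1,3), of "rb m / ra m"]
  have "P1 (F1 m) = rscale (1 / ra m) m"
    using m sol zs unfolding rep_eq_iff
    by (simp add: P1_def F1_def straight_def tc add_divide_distrib[symmetric] divide_simps)
  then show "\<exists>l. l \<noteq> 0 \<and> P1 (F1 m) = rscale l m" using m by (intro exI[of _ "1 / ra m"]) simp
  have "1 - \<rho>\<^sup>2 * (rb m / ra m)\<^sup>2 = quad m / (ra m)\<^sup>2" using m by (simp add: quad_def field_simps)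
  moreover have "zs (F1 m) \<noteq> 0" using zs m by (auto simp: F1_def Rep_components)
  ultimately show "L1 (F1 m) \<noteq> 0" using m by (simp add: L1_def F1_def straight_def Rep_components)
  show "hol rep_scale (\<lambda>m. F1 m $ k) m" for k
    using m unfolding F1_def by (intro hol_straight hol_intros)
next
  fix x :: "complex ^ 'd" assume "L1 x \<noteq> 0"
  then have x: "1 - \<rho>\<^sup>2 * (x $ i0)\<^sup>2 \<noteq> 0" "1 + x $ i2 \<noteq> 0" "zs x \<noteq> 0" by (simp_all add: L1_def)
  have q: "quad (P1 x) = 1 - \<rho>\<^sup>2 * (x $ i0)\<^sup>2" by (simp add: quad_def P1_def)
  have tc: "tc 1 (x $ i0) \<noteq> 0" by (rule torus_char_nonzero) (use x(1) in simp)
  \<comment> \<open>The determinant of the product: the triangular factor contributes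
    \<open>1 + x $ i2\<close>, the torus factor \<open>quad (P1 x)\<close>.\<close>
  have det: "ra (P1 x) * rd (P1 x) - rb (P1 x) * rc (P1 x) = (1 + x $ i2) * quad (P1 x)"
    unfolding q by (simp add: P1_def power2_eq_square algebra_simps)
  have g: "rc (P1 x) * ra (P1 x) - \<rho>\<^sup>2 * rb (P1 x) * rd (P1 x) = x $ i1 * quad (P1 x)"
    unfolding q by (simp add: P1_def power2_eq_square algebra_simps)
  show "P1 x \<in> Rep full" using det q x tc not_full_tc
    by (auto simp: Rep_components P1_def zs_def)
  show "F1 (P1 x) = x"
    unfolding F1_def straight_def det g using x q tc
    by (intro vec_eqI) (simp_all add: P1_def zs_def)
  show "rhol (*s) P1 x" unfolding P1_def using x(1) by (intro hol_intros) simp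
  show "N1 (P1 x) \<noteq> 0" using x q by (simp add: N1_def) (simp add: P1_def)
qed (auto simp: N1_def F1_def L1_def[abs_def] N1_def[abs_def] straight_rscale intro!: hol_intros)

lemma rep_chart_2: "rep_chart full N2 F2 L2 P2"
proof
  fix m :: rep assume "m \<in> Rep full" "N2 m \<noteq> 0"
  then have m: "m \<in> Rep full" "rb m \<noteq> 0" "quad m \<noteq> 0" by (simp_all add: N2_def)
  have tc: "tc (ra m / rb m) 1 = tc (ra m) (rb m)"
    using torus_char_scale[of "1 / rb m" t \<rho> "ra m" "rb m"] m by simp
  note sol = straight_solve[OF m(3)] and zs = zs_straight[OF m(1,3), of "ra m / rb m"]
  have "P2 (F2 m) = rscale (1 / rb m) m"
    using m sol zs unfolding rep_eq_iff
    by (simp add: P2_def F2_def straight_def tc add_divide_distrib[symmetric] divide_simps)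
  then show "\<exists>l. l \<noteq> 0 \<and> P2 (F2 m) = rscale l m" using m by (intro exI[of _ "1 / rb m"]) simp
  have "(ra m / rb m)\<^sup>2 - \<rho>\<^sup>2 = quad m / (rb m)\<^sup>2" using m by (simp add: quad_def field_simps)
  moreover have "zs (F2 m) \<noteq> 0" using zs m by (auto simp: F2_def Rep_components)
  ultimately show "L2 (F2 m) \<noteq> 0" using m by (simp add: L2_def F2_def straight_def Rep_components)
  show "hol rep_scale (\<lambda>m. F2 m $ k) m" for k
    using m unfolding F2_def by (intro hol_straight hol_intros)
next
  fix x :: "complex ^ 'd" assume "L2 x \<noteq> 0"
  then have x: "(x $ i0)\<^sup>2 - \<rho>\<^sup>2 \<noteq> 0" "1 + x $ i2 \<noteq> 0" "zs x \<noteq> 0" by (simp_all add: L2_def)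
  have q: "quad (P2 x) = (x $ i0)\<^sup>2 - \<rho>\<^sup>2" by (simp add: quad_def P2_def)
  have tc: "tc (x $ i0) 1 \<noteq> 0" by (rule torus_char_nonzero) (use x(1) in simp)
  have det: "ra (P2 x) * rd (P2 x) - rb (P2 x) * rc (P2 x) = (1 + x $ i2) * quad (P2 x)"
    unfolding q by (simp add: P2_def power2_eq_square algebra_simps)
  have g: "rc (P2 x) * ra (P2 x) - \<rho>\<^sup>2 * rb (P2 x) * rd (P2 x) = x $ i1 * quad (P2 x)"
    unfolding q by (simp add: P2_def power2_eq_square algebra_simps)
  show "P2 x \<in> Rep full" using det q x tc not_full_tc
    by (auto simp: Rep_components P2_def zs_def)
  show "F2 (P2 x) = x"
    unfolding F2_def straight_def det g using x q tc
    by (intro vec_eqI) (simp_all add: P2_def zs_def)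
  show "rhol (*s) P2 x" unfolding P2_def using x(1) by (intro hol_intros) simp
  show "N2 (P2 x) \<noteq> 0" using x q by (simp add: N2_def) (simp add: P2_def)
qed (auto simp: N2_def F2_def L2_def[abs_def] N2_def[abs_def] straight_rscale intro!: hol_intros)

end

section \<open>The two subgroups\<close>

definition subtopgroup :: "('a, 'm) topgroup_scheme \<Rightarrow> 'a set \<Rightarrow> 'a topgroup" where
  "subtopgroup G H = \<lparr>carrier = H, mult = mult G, one = one G, topo = subtopology (topo G) H\<rparr>"

lemma topological_group_subtopgroup:
  assumes G: "topological_group G" and H: "subgroup H G"
  shows "topological_group (subtopgroup G H)"
proof -
  let ?S = "subtopgroup G H"
  interpret G: group G using G by (simp add: topological_group_def)
  interpret H: subgroup H G by fact
  have sel: "carrier ?S = H" "mult ?S = mult G" "one ?S = one G" "topo ?S = subtopology (topo G) H"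
    by (simp_all add: subtopgroup_def)
  have grp: "group ?S"
    by (rule groupI) (auto simp: sel G.m_assoc intro!: bexI[of _ "inv\<^bsub>G\<^esub> _"])
  have inv: "inv\<^bsub>?S\<^esub> x = inv\<^bsub>G\<^esub> x" if "x \<in> H" for x
    by (rule group.inv_equality[OF grp]) (use that in \<open>auto simp: sel\<close>)
  show ?thesis unfolding topological_group_def
  proof (intro conjI grp)
    show "topspace (topo ?S) = carrier ?S"
      using G H.subset by (auto simp: sel topological_group_def)
    have "continuous_map (prod_topology (topo G) (topo G)) (topo G) (\<lambda>(x, y). x \<otimes>\<^bsub>G\<^esub> y)"
      using G by (simp add: topological_group_def)
    then show "continuous_map (prod_topology (topo ?S) (topo ?S)) (topo ?S) (\<lambda>(x, y). x \<otimes>\<^bsub>?S\<^esub> y)"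
      unfolding sel prod_topology_subtopology(1) prod_topology_subtopology(2)
      by (auto simp: continuous_map_in_subtopology intro!: continuous_map_from_subtopology)
    have "continuous_map (subtopology (topo G) H) (subtopology (topo G) H) (\<lambda>x. inv\<^bsub>G\<^esub> x)"
      using G by (auto simp: topological_group_def continuous_map_in_subtopology intro!: continuous_map_from_subtopology)
    then show "continuous_map (topo ?S) (topo ?S) (\<lambda>x. inv\<^bsub>?S\<^esub> x)"
      unfolding sel by (rule continuous_map_eq) (use G in \<open>auto simp: topological_group_def inv\<close>)
  qed
qed

text \<open>A scale-invariant condition takes the same value on the chosen representative, so it
  descends to a continuous function on classes. A general \<open>S\<close> permits closedness
  relative to a smaller set.\<close>

lemma closedin_cls:
  fixes \<Psi> :: "rep \<Rightarrow> 'b::real_normed_vector"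
  assumes S: "S \<subseteq> cls ` Rep full" and cont: "continuous_on {m \<in> Rep full. cls m \<in> S} \<Psi>"
    and scale: "\<And>m l. m \<in> Rep full \<Longrightarrow> cls m \<in> S \<Longrightarrow> l \<noteq> 0 \<Longrightarrow> \<Psi> (rscale l m) = \<Psi> m"
  shows "closedin (top_of_set S) (cls ` {m \<in> Rep full. cls m \<in> S \<and> \<Psi> m = 0})"
proof -
  have eq: "\<Psi> (rep_of full (cls m)) = \<Psi> m" if m: "m \<in> Rep full" "cls m \<in> S" for m
    by (rule rep_of_cls[OF m(1)]) (simp add: scale m)
  have "continuous_on S (\<lambda>T. \<Psi> (rep_of full T))"
    by (rule continuous_on_cls1[OF S _ cont]) (rule eq)
  then have "closedin (top_of_set S) (S \<inter> (\<lambda>T. \<Psi> (rep_of full T)) -` {0})"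
    by (rule continuous_closedin_preimage) simp
  also have "S \<inter> (\<lambda>T. \<Psi> (rep_of full T)) -` {0} = cls ` {m \<in> Rep full. cls m \<in> S \<and> \<Psi> m = 0}"
  proof (intro equalityI subsetI)
    fix T assume T: "T \<in> S \<inter> (\<lambda>T. \<Psi> (rep_of full T)) -` {0}"
    with S obtain m where "T = cls m" "m \<in> Rep full" by blast
    with T eq[of m] have "m \<in> {m \<in> Rep full. cls m \<in> S \<and> \<Psi> m = 0}" by simp
    with \<open>T = cls m\<close> show "T \<in> cls ` {m \<in> Rep full. cls m \<in> S \<and> \<Psi> m = 0}" by blast
  next
    fix T assume "T \<in> cls ` {m \<in> Rep full. cls m \<in> S \<and> \<Psi> m = 0}"
    then obtain m where "T = cls m" "m \<in> {m \<in> Rep full. cls m \<in> S \<and> \<Psi> m = 0}" by (rule imageE)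
    with eq[of m] show "T \<in> S \<inter> (\<lambda>T. \<Psi> (rep_of full T)) -` {0}" by simp
  qed
  finally show ?thesis .
qed

lemma (in rep_chart) straightened:
  assumes "\<And>m. m \<in> Rep full \<Longrightarrow> N m \<noteq> 0 \<Longrightarrow> cls m \<in> H \<longleftrightarrow> F m \<in> W"
  shows "snd chart ` (fst chart \<inter> H) = snd chart ` fst chart \<inter> W"
proof (intro equalityI subsetI)
  fix x assume "x \<in> snd chart ` (fst chart \<inter> H)"
  then obtain T where T: "T \<in> fst chart" "T \<in> H" "x = snd chart T" by blast
  from T(1) obtain m where "m \<in> Rep full" "N m \<noteq> 0" "T = cls m" "snd chart T = F m" by (rule domE)
  with T assms have "x \<in> W" by simp
  with T show "x \<in> snd chart ` fst chart \<inter> W" by blast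
next
  fix x assume "x \<in> snd chart ` fst chart \<inter> W"
  then obtain T where T: "T \<in> fst chart" "x \<in> W" "x = snd chart T" by blast
  from T(1) obtain m where "m \<in> Rep full" "N m \<noteq> 0" "T = cls m" "snd chart T = F m" by (rule domE)
  with T assms have "T \<in> H" by simp
  with T show "x \<in> snd chart ` (fst chart \<inter> H)" by blast
qed

lemma holomorphic_chart_pgl:
  assumes "\<And>c. c \<in> C \<Longrightarrow> is_rep_chart full c" and "is_rep_chart full c"
  shows "holomorphic_chart (topo (pgl full C)) (charts (pgl full C)) c"
  unfolding holomorphic_chart_def topo_pgl charts_pgl
proof (intro conjI ballI)
  show "is_chart (top_of_set (cls ` Rep full)) c"
    using assms(2) by (rule is_rep_chartE) (simp add: rep_chart.is_chart_chart)
qed (rule charts_compatible_rep[OF assms(2)], rule assms(1))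

context coords
begin

definition atlas :: "(nat \<Rightarrow> complex, 'd) chart set" where
  "atlas = {rep_map full Na Fa, rep_map full Nb Fb, rep_map full Nc Fc, rep_map full Nd Fd}"

abbreviation G :: "(nat \<Rightarrow> complex, 'd) liegroup" where "G \<equiv> pgl full atlas"

lemma is_rep_chart_atlas: "c \<in> atlas \<Longrightarrow> is_rep_chart full c"
  unfolding atlas_def is_rep_chart_def using rep_chart_a rep_chart_b rep_chart_c rep_chart_d by blast

lemma atlas_cover: "(\<Union>c\<in>atlas. fst c) = cls ` Rep full"
proof (intro equalityI subsetI)
  fix T assume "T \<in> (\<Union>c\<in>atlas. fst c)"
  then show "T \<in> cls ` Rep full" by (auto simp: atlas_def rep_map_def simp del: split_paired_Ex)
next
  fix T assume "T \<in> cls ` Rep full"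
  then obtain m where m: "T = cls m" "m \<in> Rep full" by (rule imageE)
  have "Na m \<noteq> 0 \<or> Nb m \<noteq> 0 \<or> Nc m \<noteq> 0 \<or> Nd m \<noteq> 0"
    using m(2) by (auto simp: Rep_components Na_def Nb_def Nc_def Nd_def)
  then show "T \<in> (\<Union>c\<in>atlas. fst c)" using m
    by (auto simp: atlas_def rep_map_def simp del: split_paired_Ex)
qed

lemma complex_lie_group_G: "complex_lie_group G"
  by (rule complex_lie_group_pgl[OF is_rep_chart_atlas atlas_cover])

lemma holomorphic_chart_G: "is_rep_chart full c \<Longrightarrow> holomorphic_chart (topo G) (charts G) c"
  by (rule holomorphic_chart_pgl[OF is_rep_chart_atlas])

end

section \<open>The Borel subgroup times the centre, and the graph of the character\<close>

context matched_model
begin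

definition H1 :: "(nat \<Rightarrow> complex) set" where "H1 = cls ` {m \<in> Rep full. rb m = 0}"

definition in_H2 :: "rep \<Rightarrow> bool" where
  "in_H2 m \<longleftrightarrow> rd m = ra m \<and> rc m = \<rho>\<^sup>2 * rb m \<and> rsnd m = tc (ra m) (rb m)"

definition H2 :: "(nat \<Rightarrow> complex) set" where "H2 = cls ` {m \<in> Rep full. in_H2 m}"

lemma cls_H1_iff: "m \<in> Rep full \<Longrightarrow> cls m \<in> H1 \<longleftrightarrow> rb m = 0"
proof
  assume m: "m \<in> Rep full" and "cls m \<in> H1"
  then obtain n where n: "cls m = cls n" "n \<in> {m \<in> Rep full. rb m = 0}" unfolding H1_def by (elim imageE)
  then obtain l where "l \<noteq> 0" "n = rscale l m" using cls_eqD[OF m _ n(1)] by auto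
  with n show "rb m = 0" by simp
qed (simp add: H1_def)

lemma in_H2_rscale [simp]: "l \<noteq> 0 \<Longrightarrow> in_H2 (rscale l m) \<longleftrightarrow> in_H2 m"
  by (auto simp: in_H2_def)

lemma cls_H2_iff: "m \<in> Rep full \<Longrightarrow> cls m \<in> H2 \<longleftrightarrow> in_H2 m"
proof
  assume m: "m \<in> Rep full" and "cls m \<in> H2"
  then obtain n where n: "cls m = cls n" "n \<in> {m \<in> Rep full. in_H2 m}" unfolding H2_def by (elim imageE)
  then obtain l where "l \<noteq> 0" "n = rscale l m" using cls_eqD[OF m _ n(1)] by auto
  with n show "in_H2 m" by simp
qed (simp add: H2_def)

lemma H_subset: "H1 \<subseteq> cls ` Rep full" "H2 \<subseteq> cls ` Rep full"
  unfolding H1_def H2_def by (auto intro!: image_mono)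

text \<open>For such a representative the difference of the two sides is its determinant.\<close>

lemma in_H2_quad: "m \<in> Rep full \<Longrightarrow> in_H2 m \<Longrightarrow> (ra m)\<^sup>2 \<noteq> \<rho>\<^sup>2 * (rb m)\<^sup>2"
  by (auto simp: in_H2_def Rep_components power2_eq_square algebra_simps)

lemma in_H2_rmul:
  assumes m: "m \<in> Rep full" "in_H2 m" and n: "n \<in> Rep full" "in_H2 n" shows "in_H2 (rmul m n)"
proof -
  note q = in_H2_quad[OF m] in_H2_quad[OF n]
  have e: "ra (rmul m n) = ra m * ra n + \<rho>\<^sup>2 * rb m * rb n" "rb (rmul m n) = ra m * rb n + rb m * ra n"
    using m n by (simp_all add: in_H2_def algebra_simps)
  have "rsnd (rmul m n) = tc (ra (rmul m n)) (rb (rmul m n))"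
    unfolding e torus_char_mult[OF q] using m n by (simp add: in_H2_def)
  with m n show ?thesis by (simp add: in_H2_def algebra_simps)
qed

lemma in_H2_rone [simp]: "in_H2 rone"
  by (simp add: in_H2_def)

lemma in_H2_rinv:
  assumes m: "m \<in> Rep full" "in_H2 m" shows "in_H2 (rinv m)"
proof -
  have q: "(ra m)\<^sup>2 \<noteq> \<rho>\<^sup>2 * (- rb m)\<^sup>2" "(ra m)\<^sup>2 \<noteq> \<rho>\<^sup>2 * (rb m)\<^sup>2" using in_H2_quad[OF m] by simp_all
  \<comment> \<open>The rows (u, v) and (u, -v) multiply to
    \<open>(u\<^sup>2 - \<rho>\<^sup>2 v\<^sup>2, 0)\<close>, where the character is 1 because the
    first entry is nonzero.\<close>
  have "ra m * ra m + \<rho>\<^sup>2 * rb m * - rb m \<noteq> 0" using q by (simp add: power2_eq_square algebra_simps)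
  then have "tc (ra m) (rb m) * tc (ra m) (- rb m) = 1"
    using torus_char_mult[OF q(2,1), of t] by (simp add: mult.commute)
  then have "tc (ra m) (- rb m) = 1 / tc (ra m) (rb m)"
    using torus_char_nonzero[OF q(2), of t] by (simp add: field_simps)
  with m show ?thesis by (simp add: in_H2_def)
qed

lemma subgroup_cls:
  assumes "\<And>m n. m \<in> Rep full \<Longrightarrow> n \<in> Rep full \<Longrightarrow> Q m \<Longrightarrow> Q n \<Longrightarrow> Q (rmul m n)"
    and "\<And>m. m \<in> Rep full \<Longrightarrow> Q m \<Longrightarrow> Q (rinv m)" and "Q rone"
  shows "subgroup (cls ` {m \<in> Rep full. Q m}) G"
proof
  show "cls ` {m \<in> Rep full. Q m} \<subseteq> carrier G" by (simp add: image_mono)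
  show "\<one>\<^bsub>G\<^esub> \<in> cls ` {m \<in> Rep full. Q m}" using assms(3) by (auto simp del: split_paired_Ex)
  fix x assume "x \<in> cls ` {m \<in> Rep full. Q m}"
  then obtain m where m: "x = cls m" "m \<in> {m \<in> Rep full. Q m}" by (rule imageE)
  then show "inv\<^bsub>G\<^esub> x \<in> cls ` {m \<in> Rep full. Q m}" using assms(2)[of m] by (simp add: Rep_rinv)
  fix y assume "y \<in> cls ` {m \<in> Rep full. Q m}"
  then obtain n where n: "y = cls n" "n \<in> {m \<in> Rep full. Q m}" by (rule imageE)
  with m show "x \<otimes>\<^bsub>G\<^esub> y \<in> cls ` {m \<in> Rep full. Q m}" using assms(1)[of m n] by (simp add: Rep_rmul)
qed

lemma subgroup_H1: "subgroup H1 G"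
  unfolding H1_def by (rule subgroup_cls) simp_all

lemma subgroup_H2: "subgroup H2 G"
  unfolding H2_def by (rule subgroup_cls) (simp_all add: in_H2_rmul in_H2_rinv)

lemma closedin_H1: "closedin (topo G) H1"
proof -
  \<comment> \<open>Square and determinant both have degree two in the matrix entries, so the
    quotient is unchanged by \<open>rscale\<close> and vanishes with \<open>rb m\<close>.\<close>
  let ?\<Psi> = "\<lambda>m. (rb m)\<^sup>2 / rdet m"
  have "closedin (top_of_set (cls ` Rep full)) (cls ` {m \<in> Rep full. cls m \<in> cls ` Rep full \<and> ?\<Psi> m = 0})"
  proof (rule closedin_cls)
    show "continuous_on {m \<in> Rep full. cls m \<in> cls ` Rep full} ?\<Psi>"
      unfolding rdet_eq by (intro continuous_intros) (simp add: Rep_components)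
  qed (simp_all add: power2_eq_square)
  also have "{m \<in> Rep full. cls m \<in> cls ` Rep full \<and> ?\<Psi> m = 0} = {m \<in> Rep full. rb m = 0}"
    by (rule Collect_cong) (simp add: Rep_def cong: conj_cong)
  finally show ?thesis by (simp add: H1_def)
qed

text \<open>Two stages are used because the continuity of the character is available only where its
  arguments satisfy the torus inequality: the matrix conditions cut out a closed set on which that
  inequality holds, and the graph is closed inside it.\<close>

lemma closedin_H2: "closedin (topo G) H2"
proof -
  let ?\<Psi> = "\<lambda>m. ((rd m - ra m)\<^sup>2 / rdet m, (rc m - \<rho>\<^sup>2 * rb m)\<^sup>2 / rdet m)"
  let ?Q = "\<lambda>m. rd m = ra m \<and> rc m = \<rho>\<^sup>2 * rb m"
  let ?S = "cls ` {m \<in> Rep full. ?Q m}"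
  have "closedin (top_of_set (cls ` Rep full)) (cls ` {m \<in> Rep full. cls m \<in> cls ` Rep full \<and> ?\<Psi> m = 0})"
  proof (rule closedin_cls)
    show "continuous_on {m \<in> Rep full. cls m \<in> cls ` Rep full} ?\<Psi>"
      unfolding rdet_eq by (intro continuous_intros) (simp_all add: Rep_components)
    show "?\<Psi> (rscale l m) = ?\<Psi> m" if "l \<noteq> 0" for l m
    proof -
      have "(l * rd m - l * ra m)\<^sup>2 = l\<^sup>2 * (rd m - ra m)\<^sup>2"
        "(l * rc m - \<rho>\<^sup>2 * (l * rb m))\<^sup>2 = l\<^sup>2 * (rc m - \<rho>\<^sup>2 * rb m)\<^sup>2"
        by (simp_all add: power2_eq_square algebra_simps)
      with that show ?thesis by simp
    qed
  qed simp
  also have "{m \<in> Rep full. cls m \<in> cls ` Rep full \<and> ?\<Psi> m = 0} = {m \<in> Rep full. ?Q m}"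
    by (rule Collect_cong) (simp add: Rep_def zero_prod_def cong: conj_cong)
  finally have 1: "closedin (top_of_set (cls ` Rep full)) ?S" .
  have Q_iff: "cls m \<in> ?S \<longleftrightarrow> ?Q m" if m: "m \<in> Rep full" for m
  proof
    assume "cls m \<in> ?S"
    then obtain n where n: "cls m = cls n" "n \<in> {m \<in> Rep full. ?Q m}" by (rule imageE)
    then obtain l where "l \<noteq> 0" "n = rscale l m" using cls_eqD[OF m _ n(1)] by auto
    with n show "?Q m" by auto
  qed (use m in simp)
  have quad: "(ra m)\<^sup>2 \<noteq> \<rho>\<^sup>2 * (rb m)\<^sup>2" if "m \<in> Rep full" "?Q m" for m
    using that by (auto simp: Rep_components power2_eq_square algebra_simps)
  let ?z = "\<lambda>m. rsnd m - tc (ra m) (rb m)"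
  have "closedin (top_of_set ?S) (cls ` {m \<in> Rep full. cls m \<in> ?S \<and> ?z m = 0})"
  proof (rule closedin_cls)
    show "?S \<subseteq> cls ` Rep full" by (rule image_mono) simp
    have "hol rep_scale ?z m" if "m \<in> {m \<in> Rep full. cls m \<in> ?S}" for m
      using that Q_iff[of m] quad[of m] by (intro hol_intros) simp
    then show "continuous_on {m \<in> Rep full. cls m \<in> ?S} ?z"
      by (intro continuous_at_imp_continuous_on ballI hol_imp_isCont)
  qed simp
  also have "{m \<in> Rep full. cls m \<in> ?S \<and> ?z m = 0} = {m \<in> Rep full. in_H2 m}"
    by (rule Collect_cong) (simp only: Q_iff in_H2_def right_minus_eq conj_assoc cong: conj_cong)
  finally show ?thesis using closedin_trans[OF _ 1] by (simp add: H2_def)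
qed

lemma closed_complex_lie_subgroup_H1: "closed_complex_lie_subgroup H1 G"
  unfolding closed_complex_lie_subgroup_def
proof (intro conjI ballI subgroup_H1 closedin_H1)
  \<comment> \<open>Invertibility together with \<open>rb m = 0\<close> forces
    \<open>ra m \<noteq> 0\<close>, so this single chart covers the subgroup and shows it as a
    coordinate hyperplane.\<close>
  interpret rep_chart full Na Fa La Pa by (rule rep_chart_a)
  fix T assume "T \<in> H1"
  then obtain m where m: "T = cls m" "m \<in> {m \<in> Rep full. rb m = 0}" unfolding H1_def by (rule imageE)
  have "chart \<in> atlas" by (simp add: atlas_def)
  then have "holomorphic_chart (topo G) (charts G) chart"
    by (intro holomorphic_chart_G is_rep_chart_atlas)
  moreover have "T \<in> fst chart" using m dom_iff[of m] by (auto simp: Na_def Rep_components)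
  moreover have "vec.subspace {x :: complex ^ 'd. x $ i0 = 0}" by (auto simp: vec.subspace_def)
  moreover have "snd chart ` (fst chart \<inter> H1) = snd chart ` fst chart \<inter> {x. x $ i0 = 0}"
    by (rule straightened) (simp add: cls_H1_iff Fa_def Na_def)
  ultimately show "\<exists>c W. holomorphic_chart (topo G) (charts G) c \<and> T \<in> fst c \<and> vec.subspace W \<and>
      snd c ` (fst c \<inter> H1) = snd c ` fst c \<inter> W" by blast
qed

definition W2 :: "(complex ^ 'd) set" where
  "W2 = {x. x $ i1 = 0 \<and> x $ i2 = 0 \<and> (full \<longrightarrow> x $ i3 = 0)}"

text \<open>Membership means that the left factor of the factorization is trivial: g = 0, e = 1, and
  a central component equal to the character.\<close>

lemma in_H2_straight:
  assumes m: "m \<in> Rep full" "quad m \<noteq> 0"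
  shows "in_H2 m \<longleftrightarrow> straight s m \<in> W2"
proof
  assume h: "in_H2 m"
  then have "ra m * rd m - rb m * rc m = quad m" by (simp add: in_H2_def quad_def power2_eq_square)
  with h m quad_tc[OF m(2)] show "straight s m \<in> W2" by (simp add: W2_def straight_def in_H2_def)
next
  assume "straight s m \<in> W2"
  then have "(rc m * ra m - \<rho>\<^sup>2 * rb m * rd m) / quad m = 0" "(ra m * rd m - rb m * rc m) / quad m = 1"
    "full \<Longrightarrow> rsnd m = tc (ra m) (rb m)"
    using quad_tc[OF m(2)] m(2) by (simp_all add: W2_def straight_def)
  moreover have "\<not> full \<Longrightarrow> rsnd m = tc (ra m) (rb m)" using m not_full_tc by (simp add: Rep_components)
  ultimately show "in_H2 m" using straight_solve[OF m(2)] by (auto simp: in_H2_def)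
qed

lemma closed_complex_lie_subgroup_H2: "closed_complex_lie_subgroup H2 G"
  unfolding closed_complex_lie_subgroup_def
proof (intro conjI ballI subgroup_H2 closedin_H2)
  interpret c1: rep_chart full N1 F1 L1 P1 by (rule rep_chart_1)
  interpret c2: rep_chart full N2 F2 L2 P2 by (rule rep_chart_2)
  fix T assume "T \<in> H2"
  then obtain m where m: "T = cls m" "m \<in> {m \<in> Rep full. in_H2 m}" unfolding H2_def by (rule imageE)
  then have q: "quad m \<noteq> 0" using in_H2_quad[of m] by (simp add: quad_def)
  have W: "vec.subspace W2" by (auto simp: vec.subspace_def W2_def)
  have "is_rep_chart full c1.chart" "is_rep_chart full c2.chart"
    unfolding is_rep_chart_def using rep_chart_1 rep_chart_2 by blast+
  note h = this[THEN holomorphic_chart_G]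
  have s: "snd c1.chart ` (fst c1.chart \<inter> H2) = snd c1.chart ` fst c1.chart \<inter> W2"
    "snd c2.chart ` (fst c2.chart \<inter> H2) = snd c2.chart ` fst c2.chart \<inter> W2"
    by (rule c1.straightened c2.straightened,
      simp add: cls_H2_iff F1_def N1_def F2_def N2_def in_H2_straight flip: in_H2_straight)+
  show "\<exists>c W. holomorphic_chart (topo G) (charts G) c \<and> T \<in> fst c \<and> vec.subspace W \<and>
      snd c ` (fst c \<inter> H2) = snd c ` fst c \<inter> W"
  \<comment> \<open>Both charts are required: if \<rho> is nonzero, the subgroup contains an element
    with matrix \<open>(0, 1; \<rho>\<^sup>2, 0)\<close>.\<close>
  proof (cases "ra m = 0")
    case False
    then have "T \<in> fst c1.chart" using m q c1.dom_iff[of m] by (simp add: N1_def)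
    then show ?thesis using h(1) s(1) W by blast
  next
    case True
    then have "rb m \<noteq> 0" using m by (auto simp: Rep_components)
    then have "T \<in> fst c2.chart" using m q c2.dom_iff[of m] by (simp add: N2_def)
    then show ?thesis using h(2) s(2) W by blast
  qed
qed

lemma H1_Int_H2: "H1 \<inter> H2 = {\<one>\<^bsub>G\<^esub>}"
proof (intro equalityI subsetI)
  fix T assume "T \<in> H1 \<inter> H2"
  then obtain m where m: "T = cls m" "m \<in> Rep full" using H_subset by blast
  with \<open>T \<in> H1 \<inter> H2\<close> have b: "rb m = 0" "in_H2 m" by (simp_all add: cls_H1_iff cls_H2_iff)
  then have a: "ra m \<noteq> 0" using m by (auto simp: Rep_components)
  \<comment> \<open>The matrix is scalar, hence trivial in PGL2, and with zero second entry the
    character leaves only 1 for the central component.\<close>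
  then have "m = rscale (ra m) rone" using b by (simp add: rep_eq_iff in_H2_def)
  then have "T = cls (rscale (ra m) rone)" using m by simp
  then show "T \<in> {\<one>\<^bsub>G\<^esub>}" using a by simp
next
  fix T assume "T \<in> {\<one>\<^bsub>G\<^esub>}"
  then show "T \<in> H1 \<inter> H2" by (simp add: cls_H1_iff cls_H2_iff)
qed

end

section \<open>Measure and connectedness\<close>

text \<open>The real part of the equation already confines the set to a real hyperplane; if both
  linear coefficients vanish, the set is empty.\<close>

lemma negligible_affine_form:
  fixes \<alpha> \<beta> \<gamma> :: complex
  assumes "i \<noteq> j" and "\<alpha> \<noteq> 0 \<or> \<beta> \<noteq> 0 \<or> \<gamma> \<noteq> 0"
  shows "negligible {x :: complex ^ 'd::finite. \<alpha> * x $ i + \<beta> * x $ j + \<gamma> = 0}"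
proof (cases "\<alpha> = 0 \<and> \<beta> = 0")
  case True
  then show ?thesis using assms by simp
next
  case False
  \<comment> \<open>Conjugates, because the real inner product of complex numbers a and b is the
    real part of \<open>cnj a * b\<close>.\<close>
  define v :: "complex ^ 'd" where "v = axis i (cnj \<alpha>) + axis j (cnj \<beta>)"
  have "v $ i = cnj \<alpha>" "v $ j = cnj \<beta>" using assms(1) by (simp_all add: v_def axis_def)
  then have "v \<noteq> 0" using False by auto
  then have neg: "negligible {x. v \<bullet> x = Re (- \<gamma>)}" by (intro negligible_hyperplane) simp
  have *: "v \<bullet> x = Re (\<alpha> * x $ i + \<beta> * x $ j)" for x
    by (simp add: v_def inner_add_left inner_axis' inner_complex_def)
  have "{x. \<alpha> * x $ i + \<beta> * x $ j + \<gamma> = 0} \<subseteq> {x. v \<bullet> x = Re (- \<gamma>)}"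
  proof (intro subsetI)
    fix x assume "x \<in> {x :: complex ^ 'd. \<alpha> * x $ i + \<beta> * x $ j + \<gamma> = 0}"
    then have "\<alpha> * x $ i + \<beta> * x $ j = - \<gamma>" by (simp add: eq_neg_iff_add_eq_0)
    with * show "x \<in> {x. v \<bullet> x = Re (- \<gamma>)}" by (simp only: mem_Collect_eq)
  qed
  with neg show ?thesis by (rule negligible_subset)
qed

lemma finite_quadratic_roots:
  fixes A B C :: complex
  assumes "A + B * s + C * s\<^sup>2 \<noteq> 0"
  shows "finite {s. A + B * s + C * s\<^sup>2 = 0}"
proof -
  have eq: "poly [:A, B, C:] s = A + B * s + C * s\<^sup>2" for s
    by (simp add: power2_eq_square algebra_simps)
  have "[:A, B, C:] \<noteq> 0" using assms eq[of s] by (metis poly_0)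
  from poly_roots_finite[OF this] show ?thesis by (simp only: eq)
qed

text \<open>Two points are joined by a complex line, in which only finitely many points are removed.\<close>

lemma connected_complement_quadric:
  fixes q :: "'a::topological_space \<Rightarrow> complex" and line :: "'a \<Rightarrow> 'a \<Rightarrow> complex \<Rightarrow> 'a"
  assumes cont: "\<And>x y. continuous_on UNIV (line x y)"
    and ends: "\<And>x y. line x y 0 = x" "\<And>x y. line x y 1 = y"
    and q: "\<And>x y s. q (line x y s) = A x y + B x y * s + C x y * s\<^sup>2"
  shows "connected {x. q x \<noteq> 0}"
proof (subst connected_iff_connected_component, intro ballI, unfold connected_component_def)
  fix x y assume xy: "x \<in> {x. q x \<noteq> 0}" "y \<in> {x. q x \<noteq> 0}"
  let ?U = "UNIV - {s. q (line x y s) = 0}"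
  have "q (line x y 0) \<noteq> 0" using xy by (simp only: ends mem_Collect_eq simp_thms)
  then have "A x y + B x y * 0 + C x y * 0\<^sup>2 \<noteq> 0" unfolding q .
  then have "countable {s. q (line x y s) = 0}" unfolding q by (intro countable_finite finite_quadratic_roots)
  then have "connected ?U" by (intro connected_open_diff_countable) (simp_all add: connected_UNIV)
  then have "connected (line x y ` ?U)"
    by (rule connected_continuous_image[OF continuous_on_subset[OF cont subset_UNIV]])
  moreover have "line x y ` ?U \<subseteq> {x. q x \<noteq> 0}" by (rule image_subsetI) simp
  moreover have "x \<in> line x y ` ?U" using xy ends by (intro image_eqI[of _ _ 0]) simp_all
  moreover have "y \<in> line x y ` ?U" using xy ends by (intro image_eqI[of _ _ 1]) simp_all
  ultimately show "\<exists>T. connected T \<and> T \<subseteq> {x. q x \<noteq> 0} \<and> x \<in> T \<and> y \<in> T" by blast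
qed

lemma connected_rdet: "connected {m. rdet m \<noteq> 0}"
proof (rule connected_complement_quadric)
  let ?l = "\<lambda>m n s. (ra m + s * (ra n - ra m), rb m + s * (rb n - rb m), rc m + s * (rc n - rc m),
    rd m + s * (rd n - rd m), rsnd m + s * (rsnd n - rsnd m)) :: rep"
  show "continuous_on UNIV (?l m n)" for m n by (intro continuous_intros)
  show "?l m n 0 = m" "?l m n 1 = n" for m n by (simp_all add: prod_eq_iff rsnd_eq)
  show "rdet (?l m n s) = rdet m + (ra m * (rd n - rd m) + rd m * (ra n - ra m) - rb m * (rc n - rc m) - rc m * (rb n - rb m)) * s
     + ((ra n - ra m) * (rd n - rd m) - (rb n - rb m) * (rc n - rc m)) * s\<^sup>2" for m n s
    by (simp add: rdet_eq power2_eq_square algebra_simps)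
qed

lemma connected_torus: "connected {p. (fst p)\<^sup>2 - \<rho>\<^sup>2 * (snd p)\<^sup>2 \<noteq> (0 :: complex)}"
proof (rule connected_complement_quadric)
  let ?l = "\<lambda>p q s. (fst p + s * (fst q - fst p), snd p + s * (snd q - snd p)) :: complex \<times> complex"
  show "continuous_on UNIV (?l p q)" for p q by (intro continuous_intros)
  show "?l p q 0 = p" "?l p q 1 = q" for p q by (simp_all add: prod_eq_iff)
  show "(fst (?l p q s))\<^sup>2 - \<rho>\<^sup>2 * (snd (?l p q s))\<^sup>2 = ((fst p)\<^sup>2 - \<rho>\<^sup>2 * (snd p)\<^sup>2)
     + (2 * fst p * (fst q - fst p) - 2 * \<rho>\<^sup>2 * snd p * (snd q - snd p)) * s
     + ((fst q - fst p)\<^sup>2 - \<rho>\<^sup>2 * (snd q - snd p)\<^sup>2) * s\<^sup>2" for p q s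
    by (simp add: power2_eq_square algebra_simps)
qed

lemma connected_nonzero: "connected (- {0 :: complex})"
  by (rule connected_punctured_universe) simp

section \<open>The big cell and its null complement\<close>

context matched_model
begin

text \<open>The right factor is the element of \<open>H2\<close> with the first row of
  \<open>m\<close>, the left factor is given by \<open>straight_solve\<close>, and the last
  component is split into its quotient by the character and the character itself.\<close>

lemma big_cell:
  assumes m: "m \<in> Rep full" "quad m \<noteq> 0"
  shows "cls m \<in> H1 <#>\<^bsub>G\<^esub> H2"
proof -
  define g where "g = (rc m * ra m - \<rho>\<^sup>2 * rb m * rd m) / quad m"
  define e where "e = (ra m * rd m - rb m * rc m) / quad m"
  define k :: rep where "k = (1, 0, g, e, rsnd m / tc (ra m) (rb m))"
  define n :: rep where "n = (ra m, rb m, \<rho>\<^sup>2 * rb m, ra m, tc (ra m) (rb m))"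
  have e: "e \<noteq> 0" using m by (simp add: e_def Rep_components)
  have k: "k \<in> Rep full" "rb k = 0" using m e quad_tc[OF m(2)] not_full_tc
    by (auto simp: k_def Rep_components)
  have n: "n \<in> Rep full" "in_H2 n" using m quad_tc[OF m(2)] not_full_tc
    by (auto simp: n_def Rep_components in_H2_def quad_def power2_eq_square algebra_simps)
  have "rmul k n = m"
    using straight_solve[OF m(2), folded g_def e_def] quad_tc[OF m(2)]
    by (simp add: rep_eq_iff k_def n_def algebra_simps)
  moreover have "cls k \<in> H1" "cls n \<in> H2" using k n by (simp_all add: cls_H1_iff cls_H2_iff)
  moreover have "cls (rmul k n) = cls k \<otimes>\<^bsub>G\<^esub> cls n" using k n by simp
  ultimately show ?thesis unfolding set_mult_def by (intro UN_I[of "cls k"] UN_I[of "cls n"]) simp_all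
qed

lemma outside_big_cell:
  assumes "rep_chart full N F L P"
  shows "snd (rep_map full N F) ` (fst (rep_map full N F) \<inter> (carrier G - (H1 <#>\<^bsub>G\<^esub> H2))) \<subseteq> {x. quad (P x) = 0}"
proof (rule image_subsetI)
  interpret rep_chart full N F L P by fact
  fix T assume T: "T \<in> fst chart \<inter> (carrier G - (H1 <#>\<^bsub>G\<^esub> H2))"
  then have "T \<in> fst chart" by simp
  then obtain m where m: "m \<in> Rep full" "N m \<noteq> 0" "T = cls m" "snd chart T = F m" by (rule domE)
  then have "quad m = 0" using T big_cell[of m] by auto
  moreover obtain l where "P (F m) = rscale l m" using P_F m by blast
  ultimately show "snd chart T \<in> {x. quad (P x) = 0}" using m by simp
qed

lemma quad_factor: "quad m = (ra m + \<rho> * rb m) * (ra m - \<rho> * rb m)"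
  by (simp add: quad_def power2_eq_square algebra_simps)

text \<open>\<open>quad\<close> is a product of two linear forms in the first row, which become
  affine in the chart coordinates. The last assumption prevents either of them from vanishing
  identically.\<close>

lemma negligible_quad:
  assumes "i \<noteq> j" and P: "\<And>x. ra (P x) = \<alpha> * x $ i + \<beta>" "\<And>x. rb (P x) = \<alpha>' * x $ j + \<beta>'"
    and "\<alpha> \<noteq> 0 \<or> (\<beta> + \<rho> * \<beta>' \<noteq> 0 \<and> \<beta> - \<rho> * \<beta>' \<noteq> 0)"
  shows "negligible {x :: complex ^ 'd. quad (P x) = 0}"
proof -
  have "negligible ({x :: complex ^ 'd. \<alpha> * x $ i + (\<rho> * \<alpha>') * x $ j + (\<beta> + \<rho> * \<beta>') = 0} \<union>
    {x. \<alpha> * x $ i + (- \<rho> * \<alpha>') * x $ j + (\<beta> - \<rho> * \<beta>') = 0})"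
    using assms(1,4) by (intro negligible_Un negligible_affine_form) auto
  then show ?thesis
  proof (rule negligible_subset, intro subsetI)
    fix x assume "x \<in> {x :: complex ^ 'd. quad (P x) = 0}"
    then have "ra (P x) + \<rho> * rb (P x) = 0 \<or> ra (P x) - \<rho> * rb (P x) = 0" by (simp add: quad_factor)
    then show "x \<in> {x. \<alpha> * x $ i + (\<rho> * \<alpha>') * x $ j + (\<beta> + \<rho> * \<beta>') = 0} \<union>
      {x. \<alpha> * x $ i + (- \<rho> * \<alpha>') * x $ j + (\<beta> - \<rho> * \<beta>') = 0}"
      unfolding P by (auto simp: algebra_simps)
  qed
qed

lemma measure_zero_G: "measure_zero G (carrier G - (H1 <#>\<^bsub>G\<^esub> H2))"
proof -
  have "negligible {x :: complex ^ 'd. quad (Pa x) = 0}"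
    by (rule negligible_quad[OF distinct(1)[symmetric], where \<alpha>=0 and \<beta>=1 and \<alpha>'=1 and \<beta>'=0]) (simp_all add: Pa_def)
  moreover have "negligible {x :: complex ^ 'd. quad (Pb x) = 0}"
    by (rule negligible_quad[OF distinct(1), where \<alpha>=1 and \<beta>=0 and \<alpha>'=0 and \<beta>'=1]) (simp_all add: Pb_def)
  moreover have "negligible {x :: complex ^ 'd. quad (Pc x) = 0}"
    by (rule negligible_quad[OF distinct(1), where \<alpha>=1 and \<beta>=0 and \<alpha>'=1 and \<beta>'=0]) (simp_all add: Pc_def)
  moreover have "negligible {x :: complex ^ 'd. quad (Pd x) = 0}"
    by (rule negligible_quad[OF distinct(1), where \<alpha>=1 and \<beta>=0 and \<alpha>'=1 and \<beta>'=0]) (simp_all add: Pd_def)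
  ultimately have "negligible (snd c ` (fst c \<inter> (carrier G - (H1 <#>\<^bsub>G\<^esub> H2))))" if "c \<in> atlas" for c
    using that[unfolded atlas_def] outside_big_cell[OF rep_chart_a] outside_big_cell[OF rep_chart_b]
      outside_big_cell[OF rep_chart_c] outside_big_cell[OF rep_chart_d]
    by (elim insertE emptyE) (simp_all only: negligible_subset)
  then show ?thesis unfolding measure_zero_def charts_pgl by (rule ballI)
qed

abbreviation J1 :: "(nat \<Rightarrow> complex) topgroup" where "J1 \<equiv> subtopgroup G H1"
abbreviation J2 :: "(nat \<Rightarrow> complex) topgroup" where "J2 \<equiv> subtopgroup G H2"

text \<open>Commutativity is what lets the identity map serve as the anti-homomorphism
  \<open>j\<close>.\<close>

lemma mult_H2_commute:
  assumes "x \<in> H2" "y \<in> H2" shows "x \<otimes>\<^bsub>G\<^esub> y = y \<otimes>\<^bsub>G\<^esub> x"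
proof -
  obtain m n where m: "x = cls m" "m \<in> {m \<in> Rep full. in_H2 m}" and n: "y = cls n" "n \<in> {m \<in> Rep full. in_H2 m}"
    using assms unfolding H2_def by (elim imageE)
  then have "rmul m n = rmul n m" by (simp add: rep_eq_iff in_H2_def algebra_simps)
  then show ?thesis using m n by simp
qed

lemma embedding_map_subtopology: "embedding_map (subtopology X H) X id"
  unfolding embedding_map_def by (simp only: image_id id_apply topspace_subtopology subtopology_restrict homeomorphic_map_id)

lemma matched_pair_G: "matched_pair_complex_lie_groups G J1 J2 id id"
proof -
  have tg: "topological_group G" by (rule topological_group_pgl)
  have c: "carrier J1 = H1" "carrier J2 = H2" "topo J1 = subtopology (topo G) H1"
    "topo J2 = subtopology (topo G) H2" "mult J1 = mult G" "mult J2 = mult G"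
    by (simp_all add: subtopgroup_def)
  have hom: "id \<in> hom J1 G" using H_subset(1) unfolding hom_def c carrier_pgl by (simp add: subset_iff)
  have antihom: "id \<in> antihom J2 G" 
    using H_subset(2) mult_H2_commute unfolding antihom_def c carrier_pgl by (simp add: subset_iff)
  have im: "id ` H1 = H1" "id ` H2 = H2" by simp_all
  show ?thesis
    unfolding matched_pair_complex_lie_groups_def c im
    by (intro conjI complex_lie_group_G topological_group_subtopgroup tg subgroup_H1 subgroup_H2
      embedding_map_subtopology closed_complex_lie_subgroup_H1 closed_complex_lie_subgroup_H2 H1_Int_H2
      measure_zero_G hom antihom)
qed

section \<open>Connectedness of the three groups\<close>

definition Zs :: "complex set" where "Zs = (if full then - {0} else {1})"

lemma connected_Zs: "connected Zs"
  using connected_nonzero by (simp add: Zs_def)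

lemma connected_cls_image:
  assumes "connected S" "continuous_on S f" "f ` S \<subseteq> Rep full"
  shows "connected (cls ` f ` S)"
  by (intro connected_continuous_image continuous_on_subset[OF continuous_on_cls assms(3)] assms(1,2))

lemma connected_G: "connected (cls ` Rep full)"
proof -
  let ?S = "{m. rdet m \<noteq> 0} \<times> Zs"
  \<comment> \<open>The determinant ignores the fifth component, which is therefore arbitrary in the
    first factor; the map replaces it by a point of \<open>Zs\<close>.\<close>
  let ?f = "\<lambda>p. (ra (fst p), rb (fst p), rc (fst p), rd (fst p), snd p) :: rep"
  have "?f ` ?S = Rep full"
  proof (intro equalityI subsetI)
    fix m assume "m \<in> ?f ` ?S"
    then obtain p where p: "m = ?f p" "p \<in> ?S" by (rule imageE)
    then have "rdet (fst p) \<noteq> 0" "snd p \<in> Zs" by (simp_all add: mem_Times_iff)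
    then show "m \<in> Rep full" using p(1) by (simp add: Rep_def rdet_eq Zs_def split: if_splits)
  next
    fix m assume "m \<in> Rep full"
    then have "m = ?f (m, rsnd m)" "(m, rsnd m) \<in> ?S"
      by (simp_all add: rep_eq_iff Rep_def Zs_def)
    then show "m \<in> ?f ` ?S" by (rule image_eqI)
  qed
  moreover have "continuous_on ?S ?f" by (intro continuous_intros)
  moreover have "connected ?S" by (intro connected_Times connected_rdet connected_Zs)
  ultimately show ?thesis using connected_cls_image[of ?S ?f] by (simp only: order_refl)
qed

lemma connected_H1: "connected H1"
proof -
  let ?S = "(UNIV :: complex set) \<times> (- {0 :: complex}) \<times> Zs"
  let ?f = "\<lambda>p. (1, 0, fst p, fst (snd p), snd (snd p)) :: rep"
  have R: "?f p \<in> Rep full" if "p \<in> ?S" for p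
    using that by (cases p) (simp add: Rep_def Zs_def split: if_splits)
  have "cls ` ?f ` ?S = H1"
  proof (intro equalityI subsetI)
    fix T assume "T \<in> cls ` ?f ` ?S"
    then obtain p where p: "T = cls (?f p)" "p \<in> ?S" by (elim imageE) simp
    with cls_H1_iff[OF R[OF p(2)]] show "T \<in> H1" by simp
  next
    fix T assume "T \<in> H1"
    then obtain m where m: "T = cls m" "m \<in> {m \<in> Rep full. rb m = 0}" unfolding H1_def by (rule imageE)
    then have a: "ra m \<noteq> 0" "rd m \<noteq> 0" by (auto simp: Rep_components)
    have "rscale (1 / ra m) m = ?f (rc m / ra m, rd m / ra m, rsnd m)"
      using m a by (simp add: rep_eq_iff)
    moreover have "(rc m / ra m, rd m / ra m, rsnd m) \<in> ?S" using m a by (simp add: Zs_def Rep_components)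
    ultimately have "rscale (1 / ra m) m \<in> ?f ` ?S" by (rule image_eqI)
    moreover have "T = cls (rscale (1 / ra m) m)" using m a by simp
    ultimately show "T \<in> cls ` ?f ` ?S" by blast
  qed
  moreover have "continuous_on ?S ?f" by (intro continuous_intros)
  moreover have "connected ?S" by (intro connected_Times connected_UNIV connected_nonzero connected_Zs)
  moreover have "?f ` ?S \<subseteq> Rep full" by (rule image_subsetI) (rule R)
  ultimately show ?thesis using connected_cls_image[of ?S ?f] by (simp only:)
qed

lemma connected_H2: "connected H2"
proof -
  let ?S = "{p. (fst p)\<^sup>2 - \<rho>\<^sup>2 * (snd p)\<^sup>2 \<noteq> (0 :: complex)}"
  let ?f = "\<lambda>p. (fst p, snd p, \<rho>\<^sup>2 * snd p, fst p, tc (fst p) (snd p)) :: rep"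
  have R: "?f p \<in> Rep full" if "p \<in> ?S" for p
    using that torus_char_nonzero[of "fst p" \<rho> "snd p" t] not_full_tc
    by (auto simp: Rep_def power2_eq_square algebra_simps)
  have "{m \<in> Rep full. in_H2 m} = ?f ` ?S"
  proof (intro equalityI subsetI)
    show "m \<in> {m \<in> Rep full. in_H2 m}" if "m \<in> ?f ` ?S" for m
      using that R by (elim imageE) (simp add: in_H2_def)
    fix m assume m: "m \<in> {m \<in> Rep full. in_H2 m}"
    then have "m = ?f (ra m, rb m)" by (simp add: rep_eq_iff in_H2_def)
    moreover have "(ra m, rb m) \<in> ?S" using m in_H2_quad by simp
    ultimately show "m \<in> ?f ` ?S" by (rule image_eqI)
  qed
  moreover have "continuous_on ?S ?f"
  proof -
    have nz: "fst p - \<rho> * snd p \<noteq> 0" "\<rho> = 0 \<Longrightarrow> fst p \<noteq> 0" if "p \<in> ?S" for p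
      using torus_factors[of "fst p" \<rho> "snd p"] that by simp_all
    have "continuous_on ?S (\<lambda>p. exp (snd p / fst p))" if "\<rho> = 0"
      using that nz(2) by (intro continuous_on_exp continuous_on_divide continuous_on_fst continuous_on_snd continuous_on_id) blast
    moreover have "continuous_on ?S (\<lambda>p. (fst p + \<rho> * snd p) / (fst p - \<rho> * snd p))"
      using nz(1) by (intro continuous_on_divide continuous_intros) blast
    ultimately have "continuous_on ?S (\<lambda>p. tc (fst p) (snd p))"
      unfolding torus_char_def by (cases t; cases "\<rho> = 0") simp_all
    then show ?thesis
      by (intro continuous_on_Pair continuous_on_mult continuous_on_const continuous_on_fst continuous_on_snd continuous_on_id)
  qed
  moreover have "?f ` ?S \<subseteq> Rep full" by (rule image_subsetI) (rule R)
  ultimately show ?thesis using connected_cls_image[OF connected_torus, of \<rho> ?f] by (simp only: H2_def)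
qed

lemma connected_spaces: "connected_space (topo G)" "connected_space (topo J1)" "connected_space (topo J2)"
proof -
  have *: "connected_space (top_of_set S)" if "connected S" for S :: "(nat \<Rightarrow> complex) set"
    by (rule connected_space_subtopology) (use that in simp)
  have "topo J1 = top_of_set H1" "topo J2 = top_of_set H2"
    using H_subset by (simp_all add: subtopgroup_def subtopology_subtopology Int_absorb1)
  then show "connected_space (topo G)" "connected_space (topo J1)" "connected_space (topo J2)"
    using connected_G connected_H1 connected_H2 by (simp_all add: *)
qed

end

section \<open>Tangent spaces and the bracket\<close>

context coords
begin

abbreviation ca :: "(nat \<Rightarrow> complex, 'd) chart" where "ca \<equiv> rep_map full Na Fa"

definition e1 :: "complex ^ 'd" where "e1 = mk 0 0 1 1"

lemma Fa_rone [simp]: "Fa rone = e1"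
  by (simp add: Fa_def rone_def e1_def)

lemma Na_rone [simp]: "Na rone = 1"
  by (simp add: Na_def rone_def)

lemma snd_ca_one: "snd ca \<one>\<^bsub>G\<^esub> = e1"
  using rep_chart.snd_chart[OF rep_chart_a, of rone] by simp

lemma La_e1 [simp]: "La e1 = 1" and Pa_e1 [simp]: "Pa e1 = rone"
  by (simp_all add: La_def Pa_def e1_def rone_def)

lemma chart_at_one_ca: "chart_at_one G ca"
  using rep_chart.dom_iff[OF rep_chart_a, of rone] by (simp add: chart_at_one_def atlas_def)

lemma has_derivative_mk:
  assumes "(p has_derivative p') F" "(q has_derivative q') F" "(r has_derivative r') F" "(s has_derivative s') F"
    and F: "F = at x"
  shows "((\<lambda>y. mk (p y) (q y) (r y) (s y)) has_derivative (\<lambda>v. mk (p' v) (q' v) (r' v) (s' v))) F"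
  unfolding F
  by (rule has_derivative_vecI, rule_tac k=i in index_cases) (use assms in simp_all)

text \<open>The derivative at y = \<open>e1\<close> of the product of the matrices (1, x0; x1, x2)
  and (1, y0; y1, y2) divided by its upper left entry 1 + x0 y1, together with that of the product
  of the last components.\<close>

definition lfield :: "complex ^ 'd \<Rightarrow> complex ^ 'd \<Rightarrow> complex ^ 'd" where
  "lfield v x = mk (v $ i0 + x $ i0 * v $ i2 - (x $ i0)\<^sup>2 * v $ i1) (x $ i2 * v $ i1 - x $ i1 * x $ i0 * v $ i1)
     (x $ i1 * v $ i0 + x $ i2 * v $ i2 - x $ i2 * x $ i0 * v $ i1) (zc x * (if full then v $ i3 else 0))"

lemma has_derivative_zc: "((\<lambda>y. zc y) has_derivative (\<lambda>v. if full then v $ i3 else 0)) (at x)"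
proof (cases full)
  case True
  then show ?thesis unfolding zc_def by (auto intro!: derivative_eq_intros)
next
  case False
  then show ?thesis unfolding zc_def by simp
qed

lemma left_field_ca:
  assumes "La x \<noteq> 0" shows "left_field G ca v x = lfield v x"
proof -
  interpret rep_chart full Na Fa La Pa by (rule rep_chart_a)
  define f where "f y = mk ((y $ i0 + x $ i0 * y $ i2) / (1 + x $ i0 * y $ i1))
      ((x $ i1 + x $ i2 * y $ i1) / (1 + x $ i0 * y $ i1))
      ((x $ i1 * y $ i0 + x $ i2 * y $ i2) / (1 + x $ i0 * y $ i1)) (zc x * zc y)" for y
  define S where "S = {y. La y * (1 + x $ i0 * y $ i1) \<noteq> 0}"
  have "hol (*s) (\<lambda>y. La y * (1 + x $ i0 * y $ i1)) y" for y
    by (intro hol_intros hol_L)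
  then have S: "open S" unfolding S_def
    by (intro open_Collect_neq continuous_at_imp_continuous_on ballI continuous_on_const hol_imp_isCont)
  have e: "e1 \<in> S" by (simp add: S_def) (simp add: e1_def)
  have eq: "snd ca (param ca x \<otimes>\<^bsub>G\<^esub> param ca y) = f y" if "y \<in> S" for y
  proof -
    have y: "La y \<noteq> 0" "1 + x $ i0 * y $ i1 \<noteq> 0" using that by (simp_all add: S_def)
    have m: "rmul (Pa x) (Pa y) \<in> Rep full" "Na (rmul (Pa x) (Pa y)) \<noteq> 0"
      using y by (simp_all add: Rep_rmul P_Rep assms) (simp add: Na_def Pa_def)
    have "snd ca (param ca x \<otimes>\<^bsub>G\<^esub> param ca y) = Fa (rmul (Pa x) (Pa y))"
      using snd_chart[OF m] y by (simp add: param_chart assms P_Rep)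
    also have "\<dots> = f y" by (simp add: Fa_def f_def Pa_def)
    finally show ?thesis .
  qed
  have d: "(f has_derivative (\<lambda>v. lfield v x)) (at e1)"
    unfolding f_def lfield_def
  proof (rule has_derivative_mk[OF _ _ _ _ refl])
    have n: "1 + x $ i0 * e1 $ i1 \<noteq> 0" by (simp add: e1_def)
    note c = e1_def power2_eq_square algebra_simps
    show "((\<lambda>y. (y $ i0 + x $ i0 * y $ i2) / (1 + x $ i0 * y $ i1)) has_derivative
      (\<lambda>v. v $ i0 + x $ i0 * v $ i2 - (x $ i0)\<^sup>2 * v $ i1)) (at e1)"
      by (rule derivative_eq_intros n refl | simp add: c fun_eq_iff)+
    show "((\<lambda>y. (x $ i1 + x $ i2 * y $ i1) / (1 + x $ i0 * y $ i1)) has_derivative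
      (\<lambda>v. x $ i2 * v $ i1 - x $ i1 * x $ i0 * v $ i1)) (at e1)"
      by (rule derivative_eq_intros n refl | simp add: c fun_eq_iff)+
    show "((\<lambda>y. (x $ i1 * y $ i0 + x $ i2 * y $ i2) / (1 + x $ i0 * y $ i1)) has_derivative
      (\<lambda>v. x $ i1 * v $ i0 + x $ i2 * v $ i2 - x $ i2 * x $ i0 * v $ i1)) (at e1)"
      by (rule derivative_eq_intros n refl | simp add: c fun_eq_iff)+
    show "((\<lambda>y. zc x * zc y) has_derivative (\<lambda>v. zc x * (if full then v $ i3 else 0))) (at e1)"
      by (intro has_derivative_mult_right has_derivative_zc)
  qed
  have "((\<lambda>y. snd ca (param ca x \<otimes>\<^bsub>G\<^esub> param ca y)) has_derivative (\<lambda>v. lfield v x)) (at e1)"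
    by (rule has_derivative_transform_within_open[OF d S e]) (simp only: eq)
  then show ?thesis
    unfolding left_field_def snd_ca_one by (simp flip: frechet_derivative_at)
qed

lemma has_derivative_left_field:
  "(left_field G ca w has_derivative (\<lambda>v. mk (v $ i0 * w $ i2) (v $ i2 * w $ i1)
     (v $ i1 * w $ i0 + v $ i2 * w $ i2 - v $ i0 * w $ i1) ((if full then v $ i3 else 0) * (if full then w $ i3 else 0))))
   (at e1)"
proof (rule has_derivative_transform_within_open)
  interpret rep_chart full Na Fa La Pa by (rule rep_chart_a)
  show "open image" by (rule open_image)
  show "e1 \<in> image" by simp
  show "lfield w x = left_field G ca w x" if "x \<in> image" for x using left_field_ca[of x w] that by simp
  note c = e1_def power2_eq_square algebra_simps
  show "(lfield w has_derivative (\<lambda>v. mk (v $ i0 * w $ i2) (v $ i2 * w $ i1)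
     (v $ i1 * w $ i0 + v $ i2 * w $ i2 - v $ i0 * w $ i1) ((if full then v $ i3 else 0) * (if full then w $ i3 else 0)))) (at e1)"
    unfolding lfield_def
  proof (rule has_derivative_mk[OF _ _ _ _ refl])
    show "((\<lambda>x. w $ i0 + x $ i0 * w $ i2 - (x $ i0)\<^sup>2 * w $ i1) has_derivative (\<lambda>v. v $ i0 * w $ i2)) (at e1)"
      by (rule derivative_eq_intros refl | simp add: c fun_eq_iff)+
    show "((\<lambda>x. x $ i2 * w $ i1 - x $ i1 * x $ i0 * w $ i1) has_derivative (\<lambda>v. v $ i2 * w $ i1)) (at e1)"
      by (rule derivative_eq_intros refl | simp add: c fun_eq_iff)+
    show "((\<lambda>x. x $ i1 * w $ i0 + x $ i2 * w $ i2 - x $ i2 * x $ i0 * w $ i1) has_derivative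
      (\<lambda>v. v $ i1 * w $ i0 + v $ i2 * w $ i2 - v $ i0 * w $ i1)) (at e1)"
      by (rule derivative_eq_intros refl | simp add: c fun_eq_iff)+
    show "((\<lambda>x. zc x * (if full then w $ i3 else 0)) has_derivative
      (\<lambda>v. (if full then v $ i3 else 0) * (if full then w $ i3 else 0))) (at e1)"
      by (intro has_derivative_mult_left has_derivative_zc)
  qed
qed

text \<open>The commutator of the matrices (0, b; c, d) modulo scalars, with a central last
  coordinate. The factor 2 arises because E11 - E22, the commutator of E12 and E21, is congruent to
  -2 E22.\<close>

lemma lie_bracket_ca:
  "lie_bracket G ca v w = mk (v $ i0 * w $ i2 - w $ i0 * v $ i2) (v $ i2 * w $ i1 - w $ i2 * v $ i1)
     (2 * (v $ i1 * w $ i0 - v $ i0 * w $ i1)) 0"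
  unfolding lie_bracket_def snd_ca_one
    frechet_derivative_at[OF has_derivative_left_field, symmetric]
  by (rule vec_eqI) simp_all

lemma tangentI:
  assumes "r > 0" and c0: "\<And>z. norm z < r \<Longrightarrow> La (f z) \<noteq> 0 \<and> cls (Pa (f z)) \<in> H"
    and hol: "\<And>z i. norm z < r \<Longrightarrow> hol (*) (\<lambda>z. f z $ i) z"
    and d: "(f has_derivative (\<lambda>z. z *s v)) (at 0)" and f0: "f 0 = e1"
  shows "v \<in> tangent_at_one G ca H"
proof -
  interpret rep_chart full Na Fa La Pa by (rule rep_chart_a)
  let ?\<gamma> = "\<lambda>z. cls (Pa (f z))"
  have eq: "f z = snd ca (?\<gamma> z)" if "z \<in> ball 0 r" for z
    using c0[of z] that cls_P[of "f z"] by (simp add: dist_norm)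
  have "holo_on (*) (*s) (\<lambda>z. snd ca (?\<gamma> z)) (ball 0 r)"
  proof (rule holo_onI[OF vector_space_complex_mult open_ball])
    fix z i assume z: "z \<in> ball (0 :: complex) r"
    show "hol (*) (\<lambda>z. snd ca (?\<gamma> z) $ i) z"
      by (rule hol_cong_open[OF hol open_ball z]) (use z eq in \<open>simp_all add: dist_norm\<close>)
  qed
  moreover have "((\<lambda>z. snd ca (?\<gamma> z)) has_derivative (\<lambda>z. z *s v)) (at 0)"
    by (rule has_derivative_transform_within_open[OF d open_ball[of 0 r] _ eq]) (use \<open>r > 0\<close> in simp_all)
  moreover have "?\<gamma> ` ball 0 r \<subseteq> H \<inter> fst ca"
    by (rule image_subsetI) (use c0 cls_P(1) in \<open>simp add: dist_norm\<close>)
  ultimately show ?thesis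
    unfolding tangent_at_one_def using \<open>r > 0\<close> f0
    by (intro CollectI exI[of _ ?\<gamma>] exI[of _ r]) simp
qed

lemma tangentE:
  assumes "v \<in> tangent_at_one G ca H"
  obtains g r where "r > 0" "g 0 = e1" "(g has_derivative (\<lambda>z. z *s v)) (at 0)"
    "\<forall>z \<in> ball (0 :: complex) r. \<exists>m \<in> Rep full. ra m \<noteq> 0 \<and> cls m \<in> H \<and> g z = Fa m"
proof -
  interpret rep_chart full Na Fa La Pa by (rule rep_chart_a)
  obtain \<gamma> :: "complex \<Rightarrow> nat \<Rightarrow> complex" and r where g: "r > 0" "\<gamma> 0 = \<one>\<^bsub>G\<^esub>" "\<gamma> ` ball 0 r \<subseteq> H \<inter> fst ca"
    "((\<lambda>z. snd ca (\<gamma> z)) has_derivative (\<lambda>z. z *s v)) (at 0)"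
    using assms unfolding tangent_at_one_def by blast
  show thesis
  proof (rule that[of r "\<lambda>z. snd ca (\<gamma> z)"])
    show "snd ca (\<gamma> 0) = e1" unfolding g(2) by (rule snd_ca_one)
    show "\<forall>z \<in> ball 0 r. \<exists>m \<in> Rep full. ra m \<noteq> 0 \<and> cls m \<in> H \<and> snd ca (\<gamma> z) = Fa m"
    proof
    fix z :: complex assume "z \<in> ball 0 r"
    then have z: "\<gamma> z \<in> H" "\<gamma> z \<in> fst ca" using g(3) by blast+
    from z(2) obtain m where "m \<in> Rep full" "Na m \<noteq> 0" "\<gamma> z = cls m" "snd ca (\<gamma> z) = Fa m" by (rule domE)
    with z(1) show "\<exists>m \<in> Rep full. ra m \<noteq> 0 \<and> cls m \<in> H \<and> snd ca (\<gamma> z) = Fa m"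
      by (intro bexI[of _ m]) (simp_all add: Na_def)
    qed
  qed (use g in simp_all)
qed

text \<open>This carries the equations of a subgroup over to its tangent vectors: what is constant
  along the curve has velocity zero.\<close>

lemma velocity_zero:
  fixes k :: "complex \<Rightarrow> complex"
  assumes "(k has_derivative (\<lambda>z. z * D)) (at 0)" "r > 0" "\<And>z. z \<in> ball 0 r \<Longrightarrow> k z = c"
  shows "D = 0"
proof -
  have "((\<lambda>z. c) has_derivative (\<lambda>z. z * D)) (at 0)"
    by (rule has_derivative_transform_within_open[OF assms(1) open_ball[of 0 r] _ assms(3)]) (use assms(2) in simp_all)
  then have "(\<lambda>z. z * D) = (\<lambda>z. 0)" by (rule has_derivative_unique) simp
  from fun_cong[OF this, of 1] show "D = 0" by simp
qed

end

section \<open>Tangent spaces of the two subgroups\<close>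

context matched_model
begin

definition kappa :: complex where "kappa = (if \<not> t then 0 else if \<rho> = 0 then 1 else 2 * \<rho>)"

lemma torus_char_derivative: "((\<lambda>w. tc 1 w) has_field_derivative kappa) (at 0)"
proof -
  consider "\<not> t" | "t" "\<rho> = 0" | "t" "\<rho> \<noteq> 0" by blast
  then show ?thesis
    unfolding torus_char_def kappa_def by cases (auto intro!: derivative_eq_intros)
qed

text \<open>The velocity at w = 0 of the curve with matrix
  \<open>(1, w; \<rho>\<^sup>2 w, 1)\<close> and last component \<open>tc 1 w\<close>.\<close>

definition w2 :: "complex ^ 'd" where "w2 = mk 1 (\<rho>\<^sup>2) 0 kappa"

lemma tangent_H1: "tangent_at_one G ca H1 = {v. v $ i0 = 0}"
proof (intro equalityI subsetI)
  fix v assume "v \<in> tangent_at_one G ca H1"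
  then obtain g r where g: "r > 0" "g 0 = e1" "(g has_derivative (\<lambda>z. z *s v)) (at 0)"
    "\<forall>z \<in> ball (0 :: complex) r. \<exists>m \<in> Rep full. ra m \<noteq> 0 \<and> cls m \<in> H1 \<and> g z = Fa m" by (rule tangentE) (rule that)
  have "v $ i0 = 0"
  proof (rule velocity_zero[where k="\<lambda>z. g z $ i0" and c=0, OF _ g(1)])
    show "((\<lambda>z. g z $ i0) has_derivative (\<lambda>z. z * v $ i0)) (at 0)"
      using has_derivative_vec_nth[OF g(3), of i0] by simp
    fix z :: complex assume "z \<in> ball 0 r"
    with g(4) obtain m where "m \<in> Rep full" "ra m \<noteq> 0" "cls m \<in> H1" "g z = Fa m" by blast
    then show "g z $ i0 = 0" by (simp add: cls_H1_iff Fa_def)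
  qed
  then show "v \<in> {v. v $ i0 = 0}" by simp
next
  interpret rep_chart full Na Fa La Pa by (rule rep_chart_a)
  fix v :: "complex ^ 'd" assume v: "v \<in> {v. v $ i0 = 0}"
  \<comment> \<open>In this chart the subgroup is a hyperplane, so a short piece of a straight line
    through the identity stays inside it.\<close>
  let ?f = "\<lambda>z. e1 + z *s v"
  have hol: "hol (*) (\<lambda>z. ?f z $ i) z" for z i by (simp, intro hol_intros)
  have d: "(?f has_derivative (\<lambda>z. z *s v)) (at z)" for z
    by (rule has_derivative_vecI) (auto intro!: derivative_eq_intros)
  have "open (?f -` image)"
    by (intro open_vimage open_image continuous_at_imp_continuous_on ballI has_derivative_continuous[OF d])
  moreover have "0 \<in> ?f -` image" by simp
  ultimately obtain r where r: "r > 0" "ball 0 r \<subseteq> ?f -` image" by (meson open_contains_ball)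
  show "v \<in> tangent_at_one G ca H1"
  proof (rule tangentI[OF r(1) _ hol d])
    fix z :: complex assume "norm z < r"
    then have L: "La (?f z) \<noteq> 0" using r(2) by (auto simp: dist_norm subset_iff)
    moreover have "rb (Pa (?f z)) = 0" using v by (simp add: Pa_def e1_def)
    ultimately show "La (?f z) \<noteq> 0 \<and> cls (Pa (?f z)) \<in> H1" using P_Rep by (simp add: cls_H1_iff)
  qed simp
qed

lemma tangent_H2: "tangent_at_one G ca H2 = range (\<lambda>s. s *s w2)"
proof (intro equalityI subsetI)
  fix v assume "v \<in> tangent_at_one G ca H2"
  then obtain g r where g: "r > 0" "g 0 = e1" "(g has_derivative (\<lambda>z. z *s v)) (at 0)"
    "\<forall>z \<in> ball (0 :: complex) r. \<exists>m \<in> Rep full. ra m \<noteq> 0 \<and> cls m \<in> H2 \<and> g z = Fa m" by (rule tangentE) (rule that)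
  have gd: "((\<lambda>z. g z $ i) has_derivative (\<lambda>z. z * v $ i)) (at 0)" for i
    using has_derivative_vec_nth[OF g(3), of i] by simp
  have rel: "g z $ i1 = \<rho>\<^sup>2 * g z $ i0 \<and> g z $ i2 = 1 \<and> (full \<longrightarrow> g z $ i3 = tc 1 (g z $ i0))" if "z \<in> ball 0 r" for z
  proof -
    obtain m where m: "m \<in> Rep full" "ra m \<noteq> 0" "cls m \<in> H2" "g z = Fa m" using g(4) \<open>z \<in> ball 0 r\<close> by blast
    have "tc 1 (rb m / ra m) = tc (ra m) (rb m)"
      using torus_char_scale[of "1 / ra m" t \<rho> "ra m" "rb m"] m by simp
    with m show ?thesis by (simp add: cls_H2_iff Fa_def in_H2_def)
  qed
  \<comment> \<open>Differentiating the equations of \<open>rel\<close> one after the other leaves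
    only the first coordinate of \<open>v\<close> free.\<close>
  have "v $ i1 - \<rho>\<^sup>2 * v $ i0 = 0"
  proof (rule velocity_zero[where k="\<lambda>z. g z $ i1 - \<rho>\<^sup>2 * g z $ i0" and c=0, OF _ g(1)])
    show "((\<lambda>z. g z $ i1 - \<rho>\<^sup>2 * g z $ i0) has_derivative (\<lambda>z. z * (v $ i1 - \<rho>\<^sup>2 * v $ i0))) (at 0)"
      using has_derivative_diff[OF gd[of i1] has_derivative_mult_right[OF gd[of i0], of "\<rho>\<^sup>2"]]
      by (simp add: algebra_simps)
  qed (use rel in simp)
  moreover have "v $ i2 = 0"
    by (rule velocity_zero[OF gd[of i2] g(1), where c=1]) (use rel in simp)
  moreover have "v $ i3 - kappa * v $ i0 = 0" if full
  proof (rule velocity_zero[where k="\<lambda>z. g z $ i3 - tc 1 (g z $ i0)" and c=0, OF _ g(1)])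
    have "((\<lambda>z. tc 1 (g z $ i0)) has_derivative (\<lambda>z. kappa * (z * v $ i0))) (at 0)"
      by (rule has_derivative_compose[OF gd[of i0]])
        (use torus_char_derivative in \<open>simp add: has_field_derivative_def g(2) e1_def\<close>)
    from has_derivative_diff[OF gd[of i3] this]
    show "((\<lambda>z. g z $ i3 - tc 1 (g z $ i0)) has_derivative (\<lambda>z. z * (v $ i3 - kappa * v $ i0))) (at 0)"
      by (simp add: algebra_simps)
  qed (use rel that in simp)
  ultimately have "v = (v $ i0) *s w2" by (intro vec_eqI) (simp_all add: w2_def)
  then show "v \<in> range (\<lambda>s. s *s w2)" by (rule range_eqI)
next
  interpret rep_chart full Na Fa La Pa by (rule rep_chart_a)
  fix v assume "v \<in> range (\<lambda>s. s *s w2)"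
  then obtain s where v: "v = s *s w2" by (rule rangeE)
  let ?f = "\<lambda>z. mk (s * z) (\<rho>\<^sup>2 * (s * z)) 1 (tc 1 (s * z))"
  let ?S = "{z. 1 - \<rho>\<^sup>2 * (s * z)\<^sup>2 \<noteq> 0}"
  have "open ?S" by (intro open_Collect_neq continuous_intros)
  moreover have "0 \<in> ?S" by simp
  ultimately obtain r where r: "r > 0" "ball 0 r \<subseteq> ?S" by (meson open_contains_ball)
  have S: "1 - \<rho>\<^sup>2 * (s * z)\<^sup>2 \<noteq> 0" if "norm z < r" for z
    using r(2) that by (auto simp: dist_norm subset_iff)
  show "v \<in> tangent_at_one G ca H2"
  proof (rule tangentI[OF r(1)])
    show "?f 0 = e1" by (simp add: e1_def)
    show "hol (*) (\<lambda>z. ?f z $ i) z" if "norm z < r" for z i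
      using S[OF that] by (intro hol_intros) simp
    fix z :: complex assume "norm z < r"
    note S = S[OF this]
    have tc: "tc 1 (s * z) \<noteq> 0" by (rule torus_char_nonzero) (use S in simp)
    then have L: "La (?f z) \<noteq> 0"
      using S by (simp add: La_def) (simp add: power2_eq_square algebra_simps)
    have "in_H2 (Pa (?f z))" using not_full_tc by (simp add: in_H2_def Pa_def)
    with L show "La (?f z) \<noteq> 0 \<and> cls (Pa (?f z)) \<in> H2" using P_Rep by (simp add: cls_H2_iff)
  next
    have tcd: "((\<lambda>z. tc 1 (s * z)) has_derivative (\<lambda>z. kappa * (s * z))) (at 0)"
      by (rule has_derivative_compose[where f="\<lambda>z. s * z"])
        (use torus_char_derivative in \<open>auto simp: has_field_derivative_def intro!: derivative_eq_intros\<close>)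
    have "(?f has_derivative (\<lambda>z. mk (s * z) (\<rho>\<^sup>2 * (s * z)) 0 (kappa * (s * z)))) (at 0)"
      by (rule has_derivative_mk[OF _ _ _ tcd refl]) (auto intro!: derivative_eq_intros)
    moreover have "mk (s * z) (\<rho>\<^sup>2 * (s * z)) 0 (kappa * (s * z)) = z *s v" for z
      by (rule vec_eqI) (simp_all add: v w2_def)
    ultimately show "(?f has_derivative (\<lambda>z. z *s v)) (at 0)" by simp
  qed
qed

end

section \<open>The Lie algebra\<close>

text \<open>The hypotheses on the pair with \<open>g2\<close> replaced by its generator. Of the
  invariance of the common kernel only the vanishing of \<open>chi (beta (beta x))\<close> has to be
  stated; the other membership conditions on \<open>beta x\<close> are already among the
  assumptions.\<close>

locale matched_line = complex_lie_algebra smul bracket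
  for smul :: "complex \<Rightarrow> 'g::ab_group_add \<Rightarrow> 'g" and bracket :: "'g \<Rightarrow> 'g \<Rightarrow> 'g" +
  fixes g1 :: "'g set" and A :: 'g and beta :: "'g \<Rightarrow> 'g" and chi :: "'g \<Rightarrow> complex"
  assumes g1: "subspace g1" and g1_bracket: "x \<in> g1 \<Longrightarrow> y \<in> g1 \<Longrightarrow> bracket x y \<in> g1"
    and A_notin: "A \<notin> g1" and decomp: "\<exists>B\<in>g1. \<exists>c. x = B + smul c A"
    and beta_g1 [simp]: "x \<in> g1 \<Longrightarrow> beta x \<in> g1"
    and bracket_A: "x \<in> g1 \<Longrightarrow> bracket x A = beta x + smul (chi x) A"
    and indep: "(\<And>x. x \<in> g1 \<Longrightarrow> a * chi x + b * chi (beta x) = 0) \<Longrightarrow> a = 0 \<and> b = 0"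
    and K_invariant: "x \<in> g1 \<Longrightarrow> chi x = 0 \<Longrightarrow> chi (beta x) = 0 \<Longrightarrow> chi (beta (beta x)) = 0"
begin

definition K :: "'g set" where "K = {x \<in> g1. chi x = 0 \<and> chi (beta x) = 0}"

lemma bracket_add_left: "bracket (x + y) z = bracket x z + bracket y z"
  and bracket_scale_left: "bracket (smul c x) z = smul c (bracket x z)"
  and bracket_add_right: "bracket z (x + y) = bracket z x + bracket z y"
  and bracket_scale_right: "bracket z (smul c x) = smul c (bracket z x)"
proof -
  interpret l: Vector_Spaces.linear smul smul "\<lambda>x. bracket x z" by (rule linear_left)
  interpret r: Vector_Spaces.linear smul smul "bracket z" by (rule linear_right)
  show "bracket (x + y) z = bracket x z + bracket y z" "bracket (smul c x) z = smul c (bracket x z)"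
    by (rule l.add l.scale)+
  show "bracket z (x + y) = bracket z x + bracket z y" "bracket z (smul c x) = smul c (bracket z x)"
    by (rule r.add r.scale)+
qed

lemma bracket_minus_left: "bracket (- x) z = - bracket x z"
  using bracket_scale_left[of "-1"] by simp

lemma bracket_minus_right: "bracket z (- x) = - bracket z x"
  using bracket_scale_right[of z "-1"] by simp

lemma bracket_zero_right [simp]: "bracket z 0 = 0"
  using bracket_scale_right[of z 0 0] by simp

lemma bracket_diff_left: "bracket (x - y) z = bracket x z - bracket y z"
  using bracket_add_left[of x "- y"] by (simp add: bracket_minus_left)

lemma bracket_diff_right: "bracket z (x - y) = bracket z x - bracket z y"
  using bracket_add_right[of z x "- y"] by (simp add: bracket_minus_right)

lemmas bracket_simps = bracket_add_left bracket_scale_left bracket_add_right bracket_scale_right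
  bracket_minus_left bracket_minus_right bracket_diff_left bracket_diff_right

lemma bracket_anti: "bracket y x = - bracket x y"
proof -
  have "bracket (x + y) (x + y) = 0" by (rule alternating)
  then have "bracket x x + bracket y x + (bracket x y + bracket y y) = 0" by (simp only: bracket_simps)
  then show ?thesis by (simp add: alternating eq_neg_iff_add_eq_0)
qed

lemma g1_closed [simp]:
  "x \<in> g1 \<Longrightarrow> y \<in> g1 \<Longrightarrow> x + y \<in> g1" "x \<in> g1 \<Longrightarrow> y \<in> g1 \<Longrightarrow> x - y \<in> g1"
  "x \<in> g1 \<Longrightarrow> smul c x \<in> g1" "x \<in> g1 \<Longrightarrow> - x \<in> g1" "0 \<in> g1"
  using g1 by (simp_all add: subspace_add subspace_diff subspace_scale subspace_neg subspace_0)

lemma decomp_unique: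
  assumes "B + smul c A = B' + smul c' A" "B \<in> g1" "B' \<in> g1"
  shows "B = B'" "c = c'"
proof -
  have e: "smul (c - c') A = B' - B"
    using assms(1) by (simp add: scale_left_diff_distrib algebra_simps)
  show c: "c = c'"
  proof (rule ccontr)
    assume "c \<noteq> c'"
    then have "A = smul (1 / (c - c')) (B' - B)" by (simp flip: e)
    also have "\<dots> \<in> g1" using assms by simp
    finally show False using A_notin by simp
  qed
  then show "B = B'" using assms by simp
qed

text \<open>Linearity is not assumed: it comes from the bilinearity of the bracket and the
  uniqueness of components along \<open>g1\<close> and \<open>A\<close>.\<close>

lemma beta_chi_linear:
  assumes "x \<in> g1" "y \<in> g1"
  shows "beta (x + y) = beta x + beta y" "chi (x + y) = chi x + chi y"
    "beta (smul c x) = smul c (beta x)" "chi (smul c x) = c * chi x"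
proof -
  have "beta (x + y) + smul (chi (x + y)) A = (beta x + beta y) + smul (chi x + chi y) A"
    using bracket_A[of "x + y"] assms by (simp add: bracket_simps bracket_A scale_left_distrib add_ac)
  from decomp_unique[OF this] assms show "beta (x + y) = beta x + beta y" "chi (x + y) = chi x + chi y" by simp_all
  have "beta (smul c x) + smul (chi (smul c x)) A = smul c (beta x) + smul (c * chi x) A"
    using bracket_A[of "smul c x"] assms by (simp add: bracket_simps bracket_A scale_right_distrib)
  from decomp_unique[OF this] assms show "beta (smul c x) = smul c (beta x)" "chi (smul c x) = c * chi x" by simp_all
qed

lemma beta_chi_minus:
  assumes "x \<in> g1"
  shows "beta (- x) = - beta x" "chi (- x) = - chi x"
  using beta_chi_linear(3,4)[OF assms assms, of "-1"] by simp_all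

lemma beta_chi_diff:
  assumes "x \<in> g1" "y \<in> g1"
  shows "beta (x - y) = beta x - beta y" "chi (x - y) = chi x - chi y"
  using beta_chi_linear(1,2)[of x "- y"] beta_chi_minus[of y] assms by simp_all

lemma beta_chi_zero [simp]: "beta 0 = 0" "chi 0 = 0"
  using beta_chi_linear(3,4)[of 0 0 0] by simp_all

lemmas bc_simps = beta_chi_linear beta_chi_diff beta_chi_minus

text \<open>The Jacobi identity for \<open>x, y, A\<close>, split along \<open>g1\<close> and \<open>A\<close>.\<close>

lemma beta_bracket:
  assumes xy: "x \<in> g1" "y \<in> g1"
  shows "beta (bracket x y) = bracket x (beta y) - bracket y (beta x) + smul (chi y) (beta x) - smul (chi x) (beta y)"
    and "chi (bracket x y) = 0"
proof -
  have "bracket x (bracket y A) + bracket y (bracket A x) + bracket A (bracket x y) = 0" by (rule jacobi)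
  then have "bracket (bracket x y) A = bracket x (bracket y A) - bracket y (bracket x A)"
    by (simp add: bracket_anti[of A] bracket_minus_right algebra_simps)
  then have "beta (bracket x y) + smul (chi (bracket x y)) A =
     (bracket x (beta y) - bracket y (beta x) + smul (chi y) (beta x) - smul (chi x) (beta y)) + smul 0 A"
    using xy by (simp add: bracket_A g1_bracket bracket_simps scale_right_distrib mult.commute algebra_simps)
  from decomp_unique[OF this] xy
  show "beta (bracket x y) = bracket x (beta y) - bracket y (beta x) + smul (chi y) (beta x) - smul (chi x) (beta y)"
    and "chi (bracket x y) = 0" by (simp_all add: g1_bracket)
qed

text \<open>Apply \<open>chi\<close> to the formula for \<open>beta (bracket x y)\<close>;
  \<open>chi\<close> kills both brackets of elements of \<open>g1\<close>.\<close>

lemma chi_beta_bracket: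
  assumes xy: "x \<in> g1" "y \<in> g1"
  shows "chi (beta (bracket x y)) = chi y * chi (beta x) - chi x * chi (beta y)"
  unfolding beta_bracket(1)[OF xy] using xy by (simp add: bc_simps g1_bracket beta_bracket(2))

section \<open>The common kernel and the normal form of the brackets\<close>

lemma K_simps: "x \<in> K \<Longrightarrow> x \<in> g1" "x \<in> K \<Longrightarrow> chi x = 0" "x \<in> K \<Longrightarrow> chi (beta x) = 0"
  by (simp_all add: K_def)

text \<open>\<open>chi\<close> kills every bracket in \<open>g1\<close>, and the formula for
  \<open>chi (beta (bracket x z))\<close> vanishes for z in \<open>K\<close>; hence \<open>K\<close>
  is an ideal of \<open>g1\<close>.\<close>

lemma bracket_K: "x \<in> g1 \<Longrightarrow> z \<in> K \<Longrightarrow> bracket x z \<in> K"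
  by (simp add: K_def g1_bracket beta_bracket(2) chi_beta_bracket)

lemma beta_K: "z \<in> K \<Longrightarrow> beta z \<in> K"
  using K_invariant by (simp add: K_def)

lemma dual_basis:
  obtains X Y where "X \<in> g1" "Y \<in> g1" "chi X = 1" "chi (beta X) = 0" "chi Y = 0" "chi (beta Y) = 1"
proof -
  obtain P where P: "P \<in> g1" "chi P \<noteq> 0" using indep[of 1 0] by auto
  define P' where "P' = smul (1 / chi P) P"
  have P': "P' \<in> g1" "chi P' = 1" using P by (simp_all add: P'_def bc_simps)
  define s where "s = chi (beta P')"
  \<comment> \<open>The functional \<open>chi (beta x) - s * chi x\<close> vanishes at
    \<open>P'\<close> but is nonzero by independence; subtracting the \<open>P'\<close> part of
    \<open>Q\<close> leaves a multiple of the second dual vector.\<close>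
  obtain Q where Q: "Q \<in> g1" "chi (beta Q) - s * chi Q \<noteq> 0" using indep[of "- s" 1] by auto
  define Y where "Y = smul (1 / (chi (beta Q) - s * chi Q)) (Q - smul (chi Q) P')"
  have Y: "Y \<in> g1" "chi Y = 0" "chi (beta Y) = 1"
    using P' Q by (simp_all add: Y_def bc_simps flip: s_def)
  have "P' - smul s Y \<in> g1" "chi (P' - smul s Y) = 1" "chi (beta (P' - smul s Y)) = 0"
    using P' Y by (simp_all add: bc_simps flip: s_def)
  with Y that show thesis by blast
qed

lemma dual_expansion:
  assumes "X \<in> g1" "Y \<in> g1" "chi X = 1" "chi (beta X) = 0" "chi Y = 0" "chi (beta Y) = 1"
    and Z: "\<And>x. x \<in> K \<Longrightarrow> \<exists>c. x = smul c Z" and W: "W \<in> g1"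
  obtains c where "W = smul (chi W) X + smul (chi (beta W)) Y + smul c Z"
proof -
  have "W - smul (chi W) X - smul (chi (beta W)) Y \<in> K"
    using assms(1-6) W by (simp add: K_def bc_simps)
  then obtain c where "W - smul (chi W) X - smul (chi (beta W)) Y = smul c Z" using Z by blast
  then have "W = smul (chi W) X + smul (chi (beta W)) Y + smul c Z" by (simp add: algebra_simps)
  then show thesis by (rule that)
qed

lemma normal_form:
  assumes Z: "Z \<in> K" "\<And>x. x \<in> K \<Longrightarrow> \<exists>c. x = smul c Z"
  obtains X Y q p where "X \<in> g1" "Y \<in> g1" "chi X = 1" "chi (beta X) = 0" "chi Y = 0" "chi (beta Y) = 1"
    "bracket X Y = - Y" "bracket X A = A + smul q Y + smul p Z" "bracket Y A = X"
    "bracket X Z = 0" "bracket Y Z = 0" "bracket Z A = 0"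
proof -
  obtain X0 Y0 where d0: "X0 \<in> g1" "Y0 \<in> g1" "chi X0 = 1" "chi (beta X0) = 0" "chi Y0 = 0" "chi (beta Y0) = 1"
    by (rule dual_basis)
  note Zs = K_simps[OF Z(1)]
  obtain c where c: "bracket X0 Z = smul c Z" using Z bracket_K d0 by blast
  obtain e where e: "bracket Y0 Z = smul e Z" using Z bracket_K d0 by blast
  obtain l where l: "beta Z = smul l Z" using Z beta_K by blast
  obtain a where "bracket X0 Y0 = smul (chi (bracket X0 Y0)) X0 + smul (chi (beta (bracket X0 Y0))) Y0 + smul a Z"
    by (rule dual_expansion[OF d0 Z(2) g1_bracket[OF d0(1,2)]])
  then have XY0: "bracket X0 Y0 = - Y0 + smul a Z"
    using d0 by (simp add: beta_bracket(2) chi_beta_bracket)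
  \<comment> \<open>The two double brackets with \<open>Z\<close> contribute c e and -c e times
    \<open>Z\<close> and cancel; only \<open>bracket Y0 Z\<close> survives.\<close>
  have "bracket X0 (bracket Y0 Z) + bracket Y0 (bracket Z X0) + bracket Z (bracket X0 Y0) = 0" by (rule jacobi)
  then have e0: "bracket Y0 Z = 0"
    by (simp add: bracket_anti[of Z X0] bracket_anti[of Z Y0] XY0 c e bracket_simps alternating mult.commute)
  obtain q0 where "beta X0 = smul (chi (beta X0)) X0 + smul (chi (beta (beta X0))) Y0 + smul q0 Z"
    by (rule dual_expansion[OF d0 Z(2) beta_g1[OF d0(1)]])
  then obtain u where bX0: "beta X0 = smul u Y0 + smul q0 Z" using d0 by auto
  \<comment> \<open>Once this bracket vanishes, the terms with c l cancel in
    \<open>beta_bracket\<close> for \<open>X0\<close> and \<open>Z\<close>, leaving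
    \<open>beta Z = 0\<close>.\<close>
  have "bracket (beta X0) Z = 0" unfolding bX0 by (simp add: bracket_simps e0 alternating)
  then have "bracket Z (beta X0) = 0" using bracket_anti[of Z "beta X0"] by simp
  then have l0: "beta Z = 0"
    using beta_bracket(1)[OF d0(1) Zs(1)] d0 Zs by (simp add: c l bc_simps bracket_simps mult.commute)
  \<comment> \<open>\<open>beta Y0\<close> contains \<open>X0\<close> with coefficient 1, so its
    bracket with \<open>Z\<close>, which is about to vanish, equals \<open>bracket X0 Z\<close>;
    this makes \<open>Z\<close> central.\<close>
  obtain p0 where "beta Y0 = smul (chi (beta Y0)) X0 + smul (chi (beta (beta Y0))) Y0 + smul p0 Z"
    by (rule dual_expansion[OF d0 Z(2) beta_g1[OF d0(2)]])
  then obtain v where bY0: "beta Y0 = X0 + smul v Y0 + smul p0 Z" using d0 by auto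
  have "bracket (beta Y0) Z = bracket X0 Z" unfolding bY0 by (simp add: bracket_simps e0 alternating)
  moreover have "bracket Z (beta Y0) = 0"
    using beta_bracket(1)[OF d0(2) Zs(1)] d0 Zs by (simp add: e0 l0 bc_simps bracket_simps)
  ultimately have c0: "bracket X0 Z = 0" using bracket_anti[of Z "beta Y0"] by simp
  \<comment> \<open>Absorbs the central term of \<open>bracket X0 Y0\<close>.\<close>
  define Y where "Y = Y0 - smul a Z"
  have Y: "Y \<in> g1" "chi Y = 0" "chi (beta Y) = 1" using d0 Zs by (simp_all add: Y_def bc_simps)
  obtain p' where "beta Y = smul (chi (beta Y)) X0 + smul (chi (beta (beta Y))) Y + smul p' Z"
    by (rule dual_expansion[OF d0(1) Y(1) d0(3,4) Y(2,3) Z(2) beta_g1[OF Y(1)]])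
  then obtain r where p': "beta Y = X0 + smul r Y + smul p' Z" using Y by auto
  \<comment> \<open>Absorbs the central term of \<open>beta Y\<close>.\<close>
  define X where "X = X0 + smul p' Z"
  have X: "X \<in> g1" "chi X = 1" "chi (beta X) = 0" using d0 Zs l0 by (simp_all add: X_def bc_simps)
  have bY: "beta Y = X + smul r Y" unfolding p' by (simp add: X_def algebra_simps)
  have XZ: "bracket X Z = 0" "bracket Y Z = 0" "bracket Z Y = 0" "bracket Z Y0 = 0"
    using bracket_anti[of Z Y0]
    by (simp_all add: X_def Y_def bracket_simps alternating c0 e0 diff_conv_add_uminus del: add_uminus_conv_diff)
  have XY: "bracket X Y = - Y"
    by (simp add: X_def Y_def bracket_simps alternating c0 XY0 XZ diff_conv_add_uminus del: add_uminus_conv_diff)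
  obtain p where "beta X = smul (chi (beta X)) X + smul (chi (beta (beta X))) Y + smul p Z"
    by (rule dual_expansion[OF X(1) Y(1) X(2,3) Y(2,3) Z(2) beta_g1[OF X(1)]])
  then obtain q where bX: "beta X = smul q Y + smul p Z" using X by auto
  have "bracket Y (beta X) = 0" unfolding bX by (simp add: bracket_simps alternating XZ)
  moreover have "beta (bracket X Y) = - beta Y" unfolding XY using Y by (simp add: bc_simps)
  \<comment> \<open>In \<open>beta_bracket\<close> for \<open>X\<close> and \<open>Y\<close> the
    term \<open>- beta Y\<close> stands on both sides; what remains is
    \<open>bracket X (beta Y) = 0\<close>, whose left side is \<open>- smul r Y\<close>.\<close>
  ultimately have "smul r Y = 0"
    using beta_bracket(1)[OF X(1) Y(1)] X Y by (simp add: bY bracket_simps alternating XY)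
  then have bY': "beta Y = X" using bY by simp
  show thesis
  proof (rule that[OF X(1) Y(1) X(2,3) Y(2,3) XY _ _ XZ(1,2)])
    show "bracket X A = A + smul q Y + smul p Z"
      using bracket_A[OF X(1)] X by (simp add: bX algebra_simps)
    show "bracket Y A = X" using bracket_A[OF Y(1)] Y bY' by simp
    show "bracket Z A = 0" using bracket_A[OF Zs(1)] Zs l0 by simp
  qed
qed

text \<open>The condition on \<open>Z\<close> ties the algebra to the model: a fourth coordinate
  exists exactly when the central line is nonzero. The isomorphism is built on the basis supplied by
  \<open>normal_form\<close>.\<close>

lemma exponentiation:
  fixes i0 i1 i2 i3 :: "'d::finite"
  assumes "coords i0 i1 i2 i3"
    and Z: "Z \<in> K" "\<And>x. x \<in> K \<Longrightarrow> \<exists>c. x = smul c Z" and Z0: "Z = 0 \<longleftrightarrow> i3 = i0"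
  shows "\<exists>(G :: (nat \<Rightarrow> complex, 'd) liegroup) (G1 :: (nat \<Rightarrow> complex) topgroup)
           (G2 :: (nat \<Rightarrow> complex) topgroup) i j.
           exponentiated_to smul bracket g1 (span {A}) G G1 G2 i j \<and>
           connected_space (topo G) \<and> connected_space (topo G1) \<and> connected_space (topo G2)"
proof -
  obtain X Y q p where n: "X \<in> g1" "Y \<in> g1" "chi X = 1" "chi (beta X) = 0" "chi Y = 0" "chi (beta Y) = 1"
    "bracket X Y = - Y" "bracket X A = A + smul q Y + smul p Z" "bracket Y A = X"
    "bracket X Z = 0" "bracket Y Z = 0" "bracket Z A = 0"
    by (rule normal_form[OF Z])
  note dual = n(1-6) and Zs = K_simps[OF Z(1)]
  \<comment> \<open>The character is switched on exactly when \<open>A\<close> has a central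
    component to be matched.\<close>
  define t where "t = (i3 \<noteq> i0 \<and> p \<noteq> 0)"
  define \<rho> where "\<rho> = csqrt (q / 4)"
  have rho: "\<rho>\<^sup>2 = q / 4" by (simp add: \<rho>_def)
  interpret coords i0 i1 i2 i3 by fact
  interpret M: matched_model i0 i1 i2 i3 t \<rho> by unfold_locales (simp add: t_def)
  define \<kappa> where "\<kappa> = M.kappa"
  have kappa: "t \<Longrightarrow> \<kappa> \<noteq> 0" "\<not> t \<Longrightarrow> \<kappa> = 0" unfolding \<kappa>_def M.kappa_def by simp_all
  \<comment> \<open>\<open>Z'\<close> rescales \<open>Z\<close> so that \<open>A\<close> is the velocity \<open>(1, q/4, 0, \<kappa>)\<close> of the second subgroup; \<open>A'\<close>, \<open>- 2 Y\<close>, \<open>- X\<close>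
    correspond to the coordinates \<open>b\<close>, \<open>c\<close>, \<open>d\<close> of the chart at the identity.\<close>
  define Z' where "Z' = (if t then smul (- p / \<kappa>) Z else Z)"
  have kZ': "smul \<kappa> Z' = smul (- p) Z"
    using kappa Z0 by (cases t) (auto simp: Z'_def t_def)
  have Z': "Z' \<in> g1" "chi Z' = 0" "chi (beta Z') = 0" "full \<Longrightarrow> Z' \<noteq> 0"
    using Zs kappa Z0 by (auto simp: Z'_def bc_simps t_def)
  have Z_Z': "\<exists>c. Z = smul c Z'"
  proof (cases t)
    case True
    then have "Z = smul (- \<kappa> / p) Z'" using kappa by (simp add: Z'_def t_def)
    then show ?thesis by blast
  qed (auto simp: Z'_def intro: exI[of _ 1])
  have cZ': "bracket X Z' = 0" "bracket Y Z' = 0" "bracket Z' A = 0" "bracket Z' X = 0" "bracket Z' Y = 0"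
    "bracket A Z' = 0"
    using n bracket_anti[of Z X] bracket_anti[of Z Y] bracket_anti[of A Z] by (simp_all add: Z'_def bracket_simps)
  \<comment> \<open>Chosen so that \<open>bracket X A' = A'\<close> and
    \<open>bracket Y A' = X\<close>; then \<open>A'\<close>, \<open>- 2 Y\<close>,
    \<open>- X\<close> satisfy the relations of E12, E21, E22 modulo scalars, and \<open>A\<close>
    equals \<open>A' - (q/2) Y - p Z\<close>.\<close>
  define A' where "A' = A + smul (q / 2) Y + smul p Z"
  define m :: "complex ^ 'd \<Rightarrow> complex" where "m v = (if full then v $ i3 else 0)" for v
  define \<phi> where "\<phi> v = smul (v $ i0) A' + smul (- 2 * v $ i1) Y + smul (- v $ i2) X + smul (m v) Z'" for v
  have A'Z: "bracket A' Z' = 0" "bracket Z' A' = 0"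
    using cZ' bracket_anti[of Z' Z] by (auto simp: A'_def bracket_simps Z'_def alternating split: if_splits)
  have br: "bracket X Y = - Y" "bracket Y X = Y" "bracket X A' = A'" "bracket A' X = - A'" "bracket Y A' = X" "bracket A' Y = - X"
  proof -
    show 1: "bracket X Y = - Y" "bracket Y X = Y" using n(7) bracket_anti[of Y X] by simp_all
    have "smul q Y - smul (q / 2) Y = smul (q / 2) Y" by (simp flip: scale_left_diff_distrib)
    then show 2: "bracket X A' = A'"
      by (simp add: A'_def bracket_simps n algebra_simps)
    show 3: "bracket Y A' = X" by (simp add: A'_def bracket_simps n alternating)
    show "bracket A' X = - A'" "bracket A' Y = - X" using bracket_anti[of A'] 2 3 by simp_all
  qed
  have lin: "\<phi> (v + w) = \<phi> v + \<phi> w" "\<phi> (c *s v) = smul c (\<phi> v)" for v w c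
    by (simp_all add: \<phi>_def m_def scale_left_distrib scale_right_distrib scale_left_diff_distrib
      distrib_left algebra_simps)
  have hom: "\<phi> (lie_bracket G ca v w) = bracket (\<phi> v) (\<phi> w)" for v w
  proof -
    have "bracket (\<phi> v) (\<phi> w) = smul (v $ i0 * w $ i2 - w $ i0 * v $ i2) A'
      + smul (- 2 * (v $ i2 * w $ i1 - w $ i2 * v $ i1)) Y + smul (- (2 * (v $ i1 * w $ i0 - v $ i0 * w $ i1))) X"
      unfolding \<phi>_def
      by (simp add: bracket_simps br cZ' A'Z alternating scale_left_distrib scale_right_distrib
        scale_left_diff_distrib algebra_simps)
    then show ?thesis by (simp add: \<phi>_def m_def lie_bracket_ca)
  qed
  have in_g1: "smul (- 2 * v $ i1) Y + smul (- v $ i2) X + smul (m v) Z' \<in> g1" for v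
    using n Z' by simp
  have split: "\<phi> v = (smul (v $ i0 * (q / 2)) Y + smul (v $ i0 * p) Z
      + (smul (- 2 * v $ i1) Y + smul (- v $ i2) X + smul (m v) Z')) + smul (v $ i0) A" for v
    by (simp add: \<phi>_def A'_def scale_right_distrib algebra_simps)
  have phi_g1: "\<phi> v \<in> g1 \<longleftrightarrow> v $ i0 = 0" for v
  proof
    assume "\<phi> v \<in> g1"
    then have "\<phi> v + smul 0 A = (smul (v $ i0 * (q / 2)) Y + smul (v $ i0 * p) Z
      + (smul (- 2 * v $ i1) Y + smul (- v $ i2) X + smul (m v) Z')) + smul (v $ i0) A" using split by simp
    from decomp_unique(2)[OF this \<open>\<phi> v \<in> g1\<close>] in_g1 n Zs show "v $ i0 = 0" by simp
  next
    assume "v $ i0 = 0"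
    then show "\<phi> v \<in> g1" using in_g1[of v] by (simp add: \<phi>_def)
  qed
  have inj: "inj \<phi>"
  proof (rule injI)
    fix v w assume "\<phi> v = \<phi> w"
    define u where "u = v + (- 1) *s w"
    have u: "\<phi> u = 0" unfolding u_def lin using \<open>\<phi> v = \<phi> w\<close> by simp
    then have u0: "u $ i0 = 0" using phi_g1[of u] by simp
    then have e: "smul (- 2 * u $ i1) Y + smul (- u $ i2) X + smul (m u) Z' = 0" using u by (simp add: \<phi>_def)
    \<comment> \<open>Among the three remaining terms \<open>chi\<close> sees only \<open>X\<close>,
      and \<open>chi\<close> after \<open>beta\<close> only \<open>Y\<close>.\<close>
    from arg_cong[OF e, of chi] have u2: "u $ i2 = 0" using n Z' by (simp add: bc_simps)
    from arg_cong[OF e, of "\<lambda>x. chi (beta x)"] have u1: "u $ i1 = 0" using n Z' by (simp add: bc_simps)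
    have "full \<Longrightarrow> u $ i3 = 0" using e u1 u2 Z' by (simp add: m_def)
    then have "u = 0" using u0 u1 u2 by (intro vec_eqI) simp_all
    then show "v = w" by (simp add: u_def vec_eq_iff)
  qed
  have surj: "\<exists>v. \<phi> v = x" for x
  proof -
    obtain B c where B: "B \<in> g1" "x = B + smul c A" using decomp by blast
    obtain k where k: "B = smul (chi B) X + smul (chi (beta B)) Y + smul k Z"
      by (rule dual_expansion[OF dual Z(2) B(1)])
    obtain l where l: "Z = smul l Z'" using Z_Z' by blast
    \<comment> \<open>Replacing \<open>A\<close> by \<open>A'\<close> lowers the coefficient of
      \<open>Y\<close> by c q/2 and that of \<open>Z\<close> by c p; the first is then divided by
      -2, and \<open>l\<close> converts \<open>Z\<close> into \<open>Z'\<close>.\<close>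
    let ?v = "mk c (- (chi (beta B) - c * (q / 2)) / 2) (- chi B) ((k - c * p) * l)"
    have "smul (m ?v) Z' = smul (k - c * p) Z"
      using l Z0 by (cases full) (auto simp: m_def)
    then have "\<phi> ?v = smul c A' + smul (chi (beta B) - c * (q / 2)) Y + smul (chi B) X + smul (k - c * p) Z"
      by (simp add: \<phi>_def)
    also have "\<dots> = (smul (chi B) X + smul (chi (beta B)) Y + smul k Z) + smul c A"
      by (simp add: A'_def scale_right_distrib scale_left_diff_distrib algebra_simps)
    finally show ?thesis using B(2) k by auto
  qed
  have bij: "bij \<phi>" using inj surj by (auto simp: bij_def surj_def) (metis surj)
  \<comment> \<open>The definition of isomorphic pairs wants a map out of the given Lie algebra,
    whereas \<phi> goes into it.\<close>
  define f where "f = inv_into UNIV \<phi>"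
  have f: "f (\<phi> v) = v" "\<phi> (f x) = x" for v x
    using bij by (simp_all add: f_def bij_is_inj bij_is_surj surj_f_inv_f)
  have f_eqI: "f x = v" if "x = \<phi> v" for x v using that f by simp
  have "Vector_Spaces.linear smul (*s) f"
  proof -
    interpret V: vector_space "(*s) :: complex \<Rightarrow> complex ^ 'd \<Rightarrow> _" by unfold_locales
    show ?thesis by unfold_locales (auto intro!: f_eqI simp: lin f)
  qed
  moreover have "bij f" unfolding f_def by (rule bij_imp_bij_inv[OF bij])
  moreover have "f (bracket x y) = lie_bracket G ca (f x) (f y)" for x y
    by (rule f_eqI) (simp add: hom f)
  moreover have "f ` g1 = tangent_at_one G ca M.H1"
    unfolding M.tangent_H1
  proof (intro equalityI subsetI)
    fix v assume "v \<in> f ` g1"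
    then show "v \<in> {v. v $ i0 = 0}" using phi_g1 f by fastforce
  next
    fix v :: "complex ^ 'd" assume "v \<in> {v. v $ i0 = 0}"
    then have "\<phi> v \<in> g1" using phi_g1 by simp
    then show "v \<in> f ` g1" by (rule rev_image_eqI) (simp add: f)
  qed
  moreover have "f ` span {A} = tangent_at_one G ca M.H2"
  proof -
    have w2: "M.w2 $ i0 = 1" "M.w2 $ i1 = q / 4" "M.w2 $ i2 = 0" by (simp_all add: M.w2_def rho)
    have "full \<Longrightarrow> m M.w2 = \<kappa>" by (simp add: m_def M.w2_def \<kappa>_def)
    moreover have "\<not> full \<Longrightarrow> m M.w2 = 0 \<and> \<kappa> = 0" using kappa(2) by (simp add: m_def t_def)
    ultimately have "smul (m M.w2) Z' = - smul p Z" using kZ' by (cases full) simp_all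
    then have "\<phi> M.w2 = A" by (simp add: \<phi>_def w2 A'_def algebra_simps)
    then have "f (smul c A) = c *s M.w2" for c by (intro f_eqI) (simp add: lin)
    then show ?thesis unfolding M.tangent_H2 span_singleton by (simp add: image_image)
  qed
  ultimately have "matched_pair_lie_algebras_isomorphic smul bracket g1 (span {A}) (*s) (lie_bracket G ca)
     (tangent_at_one G ca M.H1) (tangent_at_one G ca M.H2)"
    unfolding matched_pair_lie_algebras_isomorphic_def by blast
  then have "exponentiated_to smul bracket g1 (span {A}) G M.J1 M.J2 id id"
    unfolding exponentiated_to_def using M.matched_pair_G chart_at_one_ca
    by (intro conjI exI[of _ ca]) (simp_all add: subtopgroup_def)
  then show ?thesis using M.connected_spaces by blast
qed

end

section \<open>Dimension count and labelling of the coordinates\<close>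

lemma coords_3:
  assumes "CARD('d::finite) = 3"
  obtains i0 i1 i2 :: "'d::finite" where "coords i0 i1 i2 i0"
proof -
  obtain xs :: "'d list" where xs: "set xs = UNIV" "distinct xs"
    using finite_distinct_list[OF finite_class.finite_UNIV] by blast
  then have "length xs = Suc (Suc (Suc 0))" using assms distinct_card[of xs] by simp
  then obtain a b c where "xs = [a, b, c]" by (auto simp: length_Suc_conv)
  with xs have "coords a b c a" by (auto simp: coords_def)
  then show thesis by (rule that)
qed

lemma coords_4:
  assumes "CARD('d::finite) = 4"
  obtains i0 i1 i2 i3 :: "'d::finite" where "coords i0 i1 i2 i3" "i3 \<noteq> i0"
proof -
  obtain xs :: "'d list" where xs: "set xs = UNIV" "distinct xs"
    using finite_distinct_list[OF finite_class.finite_UNIV] by blast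
  then have "length xs = Suc (Suc (Suc (Suc 0)))" using assms distinct_card[of xs] by simp
  then obtain a b c d where "xs = [a, b, c, d]" by (auto simp: length_Suc_conv)
  with xs have "coords a b c d" "d \<noteq> a" by (auto simp: coords_def)
  then show thesis by (rule that)
qed

text \<open>The dual vectors \<open>X\<close> and \<open>Y\<close> together with \<open>K\<close>
  span \<open>g1\<close>, so \<open>dim g1 = dim K + 2\<close>, and the bound 3 leaves
  \<open>K\<close> at most a line.\<close>

lemma (in matched_line) central_line:
  assumes "finite_dimensional_vector_space smul E" and n: "dim g1 \<le> 3"
  obtains Z where "Z \<in> K" "\<And>x. x \<in> K \<Longrightarrow> \<exists>c. x = smul c Z" "dim (UNIV :: 'g set) = (if Z = 0 then 3 else 4)"
proof -
  interpret F: finite_dimensional_vector_space smul E by fact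
  obtain X Y where d: "X \<in> g1" "Y \<in> g1" "chi X = 1" "chi (beta X) = 0" "chi Y = 0" "chi (beta Y) = 1"
    by (rule dual_basis)
  have sub1: "subspace {x \<in> g1. chi x = 0}" and subK: "subspace K"
    by (auto simp: subspace_def K_def bc_simps)
  \<comment> \<open>\<open>chi\<close> after \<open>beta\<close> separates \<open>Y\<close> from
    \<open>K\<close>, and \<open>chi\<close> separates \<open>X\<close> from both.\<close>
  have dims: "dim (insert X (insert Y S)) = dim S + 2" if S: "S \<subseteq> K" for S
  proof -
    have "span S \<subseteq> K" using S subK by (rule span_minimal)
    then have Y: "Y \<notin> span S" using d by (auto simp: K_def)
    have "span (insert Y S) \<subseteq> {x \<in> g1. chi x = 0}"
      using sub1 S d by (intro span_minimal) (auto simp: K_def)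
    then have "X \<notin> span (insert Y S)" using d by auto
    with Y show ?thesis by (simp add: F.dim_insert)
  qed
  have le: "dim (insert X (insert Y S)) \<le> dim g1" if "S \<subseteq> K" for S
    by (rule F.dim_subset) (use that d in \<open>auto simp: K_def\<close>)
  have g1_dim: "dim g1 = dim K + 2"
  proof -
    have "g1 \<subseteq> span (insert X (insert Y K))"
    proof
      fix W assume W: "W \<in> g1"
      have k: "W - smul (chi W) X - smul (chi (beta W)) Y \<in> K"
        using d W by (simp add: K_def bc_simps)
      have "(W - smul (chi W) X - smul (chi (beta W)) Y) + smul (chi W) X + smul (chi (beta W)) Y
        \<in> span (insert X (insert Y K))"
        by (intro span_add span_scale span_base) (use k in auto)
      then show "W \<in> span (insert X (insert Y K))" by simp
    qed
    then have "dim g1 \<le> dim (insert X (insert Y K))" 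
      using F.dim_subset[of g1 "span (insert X (insert Y K))"] by (simp add: dim_span)
    with le[of K] dims[of K] show ?thesis by simp
  qed
  have "UNIV \<subseteq> span (insert A g1)"
  proof
    fix x obtain B c where "B \<in> g1" "x = B + smul c A" using decomp by blast
    then show "x \<in> span (insert A g1)" by (auto intro!: span_add span_scale intro: span_base)
  qed
  then have "span (insert A g1) = UNIV" by blast
  then have "dim (UNIV :: 'g set) = dim (insert A g1)" using dim_span[of "insert A g1"] by simp
  also have "\<dots> = dim g1 + 1" using A_notin g1 by (simp add: F.dim_insert span_eq_iff[THEN iffD2])
  finally have U: "dim (UNIV :: 'g set) = dim K + 3" using g1_dim by simp
  show thesis
  proof (cases "K \<subseteq> {0}")
    case True
    then have "dim K = 0" by (simp add: F.dim_eq_0)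
    with U True subK that[of 0] show thesis by (auto simp: subspace_0)
  next
    case False
    then obtain Z where Z: "Z \<in> K" "Z \<noteq> 0" by auto
    have "dim {Z} = 1" using Z by (simp add: F.dim_insert)
    moreover have "dim {Z} \<le> dim K" using Z by (intro F.dim_subset) simp
    ultimately have K1: "dim K = 1" using n g1_dim by simp
    have "span {Z} = span K"
      using \<open>dim {Z} = 1\<close> K1 Z by (intro F.dim_eq_span) simp_all
    then have "K = span {Z}" using subK by (simp add: span_eq_iff[THEN iffD2])
    then have "\<exists>c. x = smul c Z" if "x \<in> K" for x using that by (auto simp: span_singleton)
    with Z U K1 that[of Z] show thesis by simp
  qed
qed

theorem proposition4p9:
  fixes smul :: "complex \<Rightarrow> 'g::ab_group_add \<Rightarrow> 'g"
    and bracket :: "'g \<Rightarrow> 'g \<Rightarrow> 'g"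
    and Basis g1 g2 :: "'g set"
    and A :: 'g
    and n :: nat
    and beta :: "'g \<Rightarrow> 'g"
    and chi :: "'g \<Rightarrow> complex"
  assumes "finite_dimensional_vector_space smul Basis"
    and "matched_pair_lie_algebras smul bracket g1 g2"
    and "vector_space.dim smul g1 = n" and "n \<le> 3"
    and "A \<noteq> 0" and "g2 = module.span smul {A}"
    and "\<forall>X\<in>g1. beta X \<in> g1 \<and> bracket X A = beta X + smul (chi X) A"
    and "\<forall>a b. (\<forall>X\<in>g1. a * chi X + b * chi (beta X) = 0) \<longrightarrow> a = 0 \<and> b = 0"
    and "beta ` {X \<in> g1. chi X = 0 \<and> chi (beta X) = 0} \<subseteq> {X \<in> g1. chi X = 0 \<and> chi (beta X) = 0}"
    and "CARD('d::finite) = vector_space.dim smul (UNIV :: 'g set)"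
  shows "\<exists>(G :: (nat \<Rightarrow> complex, 'd) liegroup) (G1 :: (nat \<Rightarrow> complex) topgroup)
           (G2 :: (nat \<Rightarrow> complex) topgroup) i j.
           exponentiated_to smul bracket g1 g2 G G1 G2 i j \<and>
           connected_space (topo G) \<and> connected_space (topo G1) \<and> connected_space (topo G2)"
proof -
  note mp = assms(2)[unfolded matched_pair_lie_algebras_def lie_subalgebra_def]
  interpret complex_lie_algebra smul bracket using mp by blast
  have "A \<in> g2" unfolding assms(6) by (rule span_base) simp
  then have A: "A \<notin> g1" using mp assms(5) by blast
  interpret matched_line smul bracket g1 A beta chi
  proof unfold_locales
    show "\<exists>B\<in>g1. \<exists>c. x = B + smul c A" for x
    proof -
      obtain B b where "B \<in> g1" "b \<in> g2" "x = B + b" using mp by blast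
      then show ?thesis unfolding assms(6) span_singleton by blast
    qed
    show "chi (beta (beta x)) = 0" if "x \<in> g1" "chi x = 0" "chi (beta x) = 0" for x
      using assms(9) that by blast
    show "(\<And>x. x \<in> g1 \<Longrightarrow> a * chi x + b * chi (beta x) = 0) \<Longrightarrow> a = 0 \<and> b = 0" for a b
      using assms(8) by blast
  qed (use mp A assms(7) in blast)+
  obtain Z where Z: "Z \<in> K" "\<And>x. x \<in> K \<Longrightarrow> \<exists>c. x = smul c Z"
    and U: "dim (UNIV :: 'g set) = (if Z = 0 then 3 else 4)"
    using central_line[OF assms(1)] assms(3,4) by metis
  \<comment> \<open>The index type has 3 or 4 elements according to the dimension of the ambient
    algebra; with 3 elements \<open>i3\<close> is taken to be \<open>i0\<close>.\<close>
  have "\<exists>i0 i1 i2 i3 :: 'd. coords i0 i1 i2 i3 \<and> (Z = 0 \<longleftrightarrow> i3 = i0)"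
  proof (cases "Z = 0")
    case True
    then have "CARD('d) = 3" using assms(10) U by simp
    then obtain i0 i1 i2 :: 'd where "coords i0 i1 i2 i0" by (rule coords_3)
    with True show ?thesis by blast
  next
    case False
    then have "CARD('d) = 4" using assms(10) U by simp
    then obtain i0 i1 i2 i3 :: 'd where "coords i0 i1 i2 i3" "i3 \<noteq> i0" by (rule coords_4)
    with False show ?thesis by blast
  qed
  then obtain i0 i1 i2 i3 :: 'd where "coords i0 i1 i2 i3" "Z = 0 \<longleftrightarrow> i3 = i0" by blast
  from exponentiation[OF this(1) Z this(2)] show ?thesis unfolding assms(6) .
qed

end
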